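(* Let $\alpha\in(0,1)$. For any integer $m\ge 0$ and any set of collocation points $\{\theta_\ell\}_{\ell=0}^m$ with $0<\theta_0<\theta_1<\dots<\theta_m\le 1$, the matrix $M=W^{-1}D_1^{-1}W D_2^{-1}\in\mathbb{R}^{(m+1)\times(m+1)}$ has no negative real eigenvalues. Consequently, if the operator $\mathcal{L}$ has a set of real positive eigenvalues $0<\lambda_1\le\lambda_2\le\dots$ and a corresponding basis of orthonormal eigenfunctions $\{\psi_n\}_{n=1}^\infty$, and $\vec F(x)=(F(x,\theta_0),\dots,F(x,\theta_m))^{\top}$ is sufficiently smooth, then for any $\tau>0$ the problem of finding a function $U(x,t)$, polynomial of degree $m$ in $t\in(0,1]$, with $U=0$ on $\partial\Omega$, such that $$U(x,\theta_\ell)+\tau^\alpha\mathcal{L}J_t^\alpha U(x,\theta_\ell)=F(x,\theta_\ell)\qquad\text{for } x\in\Omega,\ \ell\in\{0,\dots,m\},$$ has a unique solution.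
   Context: $\Omega\subset\mathbb{R}^d$ ($d\in\{1,2,3\}$) is a bounded Lipschitz domain. The operator $\mathcal{L}$ is the linear second-order elliptic operator $$\mathcal{L}u=\sum_{k=1}^d\{-\partial_{x_k}(a_k(x)\partial_{x_k}u)+b_k(x)\partial_{x_k}u\}+c(x)u,$$ with sufficiently smooth coefficients $a_k,b_k,c\in C(\bar\Omega)$, $a_k>0$ in $\bar\Omega$, and either $c\ge0$ or $c-\frac12\sum_{k=1}^d\partial_{x_k}b_k\ge0$; it is considered with homogeneous Dirichlet boundary conditions on $\partial\Omega$. Orthonormality of eigenfunctions and their being a basis are understood in $L_2(\Omega)$. The fractional integral is $J_t^{\alpha}v(\cdot,t)=\frac1{\Gamma(\alpha)}\int_0^t(t-s)^{\alpha-1}v(\cdot,s)\,ds$. "Polynomial of degree $m$" means of degree at most $m$. Matrices (with rows and columns indexed by $0,\dots,m$): $W$ is the Vandermonde matrix with entries $W_{\ell j}=\theta_\ell^{\,j}$, $D_1=\mathrm{diag}(\theta_0^\alpha,\dots,\theta_m^\alpha)$, and $D_2=\mathrm{diag}(c_0,\dots,c_m)$ with $c_j=\frac{\Gamma(j+1)}{\Gamma(j+1+\alpha)}$. *)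

theory Defs
  imports
    "HOL-Analysis.Analysis"
    "Jordan_Normal_Form.Gauss_Jordan_Elimination"
    "Jordan_Normal_Form.Char_Poly"
begin

section \<open>The collocation matrix\<close>

definition vandermonde_matrix :: "nat \<Rightarrow> (nat \<Rightarrow> real) \<Rightarrow> real mat" where
  "vandermonde_matrix m \<theta> = Matrix.mat (m + 1) (m + 1) (\<lambda>(l, j). \<theta> l ^ j)"

definition D1_matrix :: "nat \<Rightarrow> real \<Rightarrow> (nat \<Rightarrow> real) \<Rightarrow> real mat" where
  "D1_matrix m \<alpha> \<theta> = mat_diag (m + 1) (\<lambda>l. \<theta> l powr \<alpha>)"

definition D2_matrix :: "nat \<Rightarrow> real \<Rightarrow> real mat" where
  "D2_matrix m \<alpha> = mat_diag (m + 1) (\<lambda>j. Gamma (real j + 1) / Gamma (real j + 1 + \<alpha>))"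

text \<open>\<^const>\<open>mat_inverse\<close> returns an option; in the situations considered (distinct positive
  nodes, \<open>0 < \<alpha>\<close>) all three matrices are invertible, so \<^const>\<open>the\<close> selects the actual inverse.\<close>

definition collocation_matrix :: "nat \<Rightarrow> real \<Rightarrow> (nat \<Rightarrow> real) \<Rightarrow> real mat" where
  "collocation_matrix m \<alpha> \<theta> =
     the (mat_inverse (vandermonde_matrix m \<theta>)) * the (mat_inverse (D1_matrix m \<alpha> \<theta>)) *
     vandermonde_matrix m \<theta> * the (mat_inverse (D2_matrix m \<alpha>))"

definition collocation_nodes :: "nat \<Rightarrow> (nat \<Rightarrow> real) \<Rightarrow> bool" where
  "collocation_nodes m \<theta> \<longleftrightarrow> 0 < \<theta> 0 \<and> strict_mono_on {..m} \<theta> \<and> \<theta> m \<le> 1"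


section \<open>Domain and coefficients\<close>

text \<open>Euclidean space with its orthonormal \<^const>\<open>Basis\<close> plays the role of \<open>\<real>\<^sup>d\<close>: the
  coordinate directions are the elements of \<^const>\<open>Basis\<close>, and coordinate-indexed
  families such as \<open>a\<^sub>k\<close> are functions of the basis vector \<open>k\<close>.\<close>

abbreviation partial :: "'a::euclidean_space \<Rightarrow> ('a \<Rightarrow> real) \<Rightarrow> 'a \<Rightarrow> real" where
  "partial k f x \<equiv> frechet_derivative f (at x) k"

text \<open>Near every boundary point the domain is the strict epigraph, in some direction \<open>e\<close>, of a
  Lipschitz function \<open>\<gamma>\<close> on the hyperplane orthogonal to \<open>e\<close>.\<close>

definition bounded_lipschitz_domain :: "'a::euclidean_space set \<Rightarrow> bool" where
  "bounded_lipschitz_domain \<Omega> \<longleftrightarrow>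
     open \<Omega> \<and> connected \<Omega> \<and> \<Omega> \<noteq> {} \<and> bounded \<Omega> \<and>
     (\<forall>p \<in> frontier \<Omega>. \<exists>e r C. \<exists>\<gamma> :: 'a \<Rightarrow> real.
        norm e = 1 \<and> 0 < r \<and> C-lipschitz_on {y. inner y e = 0} \<gamma> \<and>
        (\<forall>x \<in> ball p r. x \<in> \<Omega> \<longleftrightarrow> \<gamma> (x - inner x e *\<^sub>R e) < inner x e))"

text \<open>The class \<open>C\<^sup>1\<close> up to the boundary: the function and its first partial derivatives extend
  continuously from the open set to its closure.\<close>

definition C1_closure :: "'a::euclidean_space set \<Rightarrow> ('a \<Rightarrow> real) \<Rightarrow> bool" where
  "C1_closure \<Omega> f \<longleftrightarrow>
     continuous_on (closure \<Omega>) f \<and>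
     (\<forall>x \<in> \<Omega>. f differentiable (at x)) \<and>
     (\<forall>k \<in> Basis. \<exists>h. continuous_on (closure \<Omega>) h \<and> (\<forall>x \<in> \<Omega>. h x = partial k f x))"

definition admissible_coefficients ::
  "'a::euclidean_space set \<Rightarrow> ('a \<Rightarrow> 'a \<Rightarrow> real) \<Rightarrow> ('a \<Rightarrow> 'a \<Rightarrow> real) \<Rightarrow> ('a \<Rightarrow> real) \<Rightarrow> bool" where
  "admissible_coefficients \<Omega> a b c \<longleftrightarrow>
     (\<forall>k \<in> Basis. C1_closure \<Omega> (a k) \<and> C1_closure \<Omega> (b k)) \<and> continuous_on (closure \<Omega>) c \<and>
     (\<forall>k \<in> Basis. \<forall>x \<in> closure \<Omega>. 0 < a k x) \<and>
     ((\<forall>x \<in> \<Omega>. 0 \<le> c x) \<or> (\<forall>x \<in> \<Omega>. 0 \<le> c x - (1/2) * (\<Sum>k\<in>Basis. partial k (b k) x)))"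


section \<open>The spaces \<open>L\<^sub>2\<close> and \<open>H\<^sub>0\<^sup>1\<close>\<close>

definition L2 :: "'a::euclidean_space set \<Rightarrow> ('a \<Rightarrow> real) set" where
  "L2 \<Omega> = {f \<in> borel_measurable (lebesgue_on \<Omega>). integrable (lebesgue_on \<Omega>) (\<lambda>x. (f x)\<^sup>2)}"

definition L2_inner :: "'a::euclidean_space set \<Rightarrow> ('a \<Rightarrow> real) \<Rightarrow> ('a \<Rightarrow> real) \<Rightarrow> real" where
  "L2_inner \<Omega> f g = (\<integral>x. f x * g x \<partial>lebesgue_on \<Omega>)"

definition L2_tendsto :: "'a::euclidean_space set \<Rightarrow> (nat \<Rightarrow> 'a \<Rightarrow> real) \<Rightarrow> ('a \<Rightarrow> real) \<Rightarrow> bool" where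
  "L2_tendsto \<Omega> f g \<longleftrightarrow> (\<lambda>n. \<integral>x. (f n x - g x)\<^sup>2 \<partial>lebesgue_on \<Omega>) \<longlonglongrightarrow> 0"

text \<open>Orthonormal (Schauder) basis of \<open>L\<^sub>2(\<Omega>)\<close>, indexed from \<open>0\<close> instead of \<open>1\<close>.\<close>

definition L2_orthonormal_basis :: "'a::euclidean_space set \<Rightarrow> (nat \<Rightarrow> 'a \<Rightarrow> real) \<Rightarrow> bool" where
  "L2_orthonormal_basis \<Omega> \<psi> \<longleftrightarrow>
     (\<forall>n. \<psi> n \<in> L2 \<Omega>) \<and>
     (\<forall>i j. L2_inner \<Omega> (\<psi> i) (\<psi> j) = (if i = j then 1 else 0)) \<and>
     (\<forall>f \<in> L2 \<Omega>. \<exists>!\<beta>. L2_tendsto \<Omega> (\<lambda>N x. \<Sum>n<N. \<beta> n * \<psi> n x) f)"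

primrec C_k :: "nat \<Rightarrow> ('a::euclidean_space \<Rightarrow> real) \<Rightarrow> bool" where
  "C_k 0 f \<longleftrightarrow> continuous_on UNIV f"
| "C_k (Suc n) f \<longleftrightarrow> (\<forall>x. f differentiable (at x)) \<and> (\<forall>k \<in> Basis. C_k n (partial k f))"

text \<open>\<open>C\<^sub>c\<^sup>\<infinity>(\<Omega>)\<close>, its elements being extended by zero to the whole space.\<close>

definition test_functions :: "'a::euclidean_space set \<Rightarrow> ('a \<Rightarrow> real) set" where
  "test_functions \<Omega> = {\<phi>. (\<forall>n. C_k n \<phi>) \<and>
     compact (closure {x. \<phi> x \<noteq> 0}) \<and> closure {x. \<phi> x \<noteq> 0} \<subseteq> \<Omega>}"

definition weak_gradient ::
  "'a::euclidean_space set \<Rightarrow> ('a \<Rightarrow> real) \<Rightarrow> ('a \<Rightarrow> 'a \<Rightarrow> real) \<Rightarrow> bool" where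
  "weak_gradient \<Omega> u g \<longleftrightarrow>
     (\<forall>k \<in> Basis. \<forall>\<phi> \<in> test_functions \<Omega>.
        L2_inner \<Omega> u (partial k \<phi>) = - L2_inner \<Omega> (g k) \<phi>)"

text \<open>\<open>u \<in> H\<^sub>0\<^sup>1(\<Omega>)\<close> with weak gradient \<open>g\<close>, the space \<open>H\<^sub>0\<^sup>1(\<Omega>)\<close> being the closure of
  \<open>C\<^sub>c\<^sup>\<infinity>(\<Omega>)\<close> in the Sobolev space \<open>H\<^sup>1(\<Omega>)\<close>.\<close>

definition H10_gradient ::
  "'a::euclidean_space set \<Rightarrow> ('a \<Rightarrow> real) \<Rightarrow> ('a \<Rightarrow> 'a \<Rightarrow> real) \<Rightarrow> bool" where
  "H10_gradient \<Omega> u g \<longleftrightarrow>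
     u \<in> L2 \<Omega> \<and> (\<forall>k \<in> Basis. g k \<in> L2 \<Omega>) \<and> weak_gradient \<Omega> u g \<and>
     (\<exists>\<phi>. (\<forall>n. \<phi> n \<in> test_functions \<Omega>) \<and> L2_tendsto \<Omega> \<phi> u \<and>
        (\<forall>k \<in> Basis. L2_tendsto \<Omega> (\<lambda>n. partial k (\<phi> n)) (g k)))"

definition H10 :: "'a::euclidean_space set \<Rightarrow> ('a \<Rightarrow> real) set" where
  "H10 \<Omega> = {u. \<exists>g. H10_gradient \<Omega> u g}"


section \<open>The elliptic operator and the collocation problem\<close>

text \<open>\<open>elliptic_op \<Omega> a b c u w\<close> says that \<open>u\<close> lies in the domain of \<open>\<L>\<close> as an operator in
  \<open>L\<^sub>2(\<Omega>)\<close> with homogeneous Dirichlet conditions, and that \<open>\<L> u = w\<close>: the derivatives in \<open>\<L>\<close> are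
  taken in the sense of distributions (the outer derivative in \<open>\<partial>\<^sub>k(a\<^sub>k \<partial>\<^sub>k u)\<close> is moved onto the
  test function), and the resulting distribution is the \<open>L\<^sub>2\<close> function \<open>w\<close>. On a general Lipschitz
  domain \<open>u\<close> need not be in \<open>H\<^sup>2(\<Omega>)\<close>, and the single terms of \<open>\<L> u\<close> need not be in \<open>L\<^sub>2(\<Omega>)\<close>.\<close>

definition elliptic_op ::
  "'a::euclidean_space set \<Rightarrow> ('a \<Rightarrow> 'a \<Rightarrow> real) \<Rightarrow> ('a \<Rightarrow> 'a \<Rightarrow> real) \<Rightarrow> ('a \<Rightarrow> real) \<Rightarrow>
     ('a \<Rightarrow> real) \<Rightarrow> ('a \<Rightarrow> real) \<Rightarrow> bool" where
  "elliptic_op \<Omega> a b c u w \<longleftrightarrow>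
     w \<in> L2 \<Omega> \<and>
     (\<exists>g. H10_gradient \<Omega> u g \<and>
       (\<forall>\<phi> \<in> test_functions \<Omega>.
          (\<integral>x. (\<Sum>k\<in>Basis. a k x * g k x * partial k \<phi> x + b k x * g k x * \<phi> x)
                + c x * u x * \<phi> x \<partial>lebesgue_on \<Omega>)
          = L2_inner \<Omega> w \<phi>))"

definition frac_int :: "real \<Rightarrow> (real \<Rightarrow> real) \<Rightarrow> real \<Rightarrow> real" where
  "frac_int \<alpha> v t = 1 / Gamma \<alpha> * (LINT s:{0<..<t}|lborel. (t - s) powr (\<alpha> - 1) * v s)"

text \<open>The boundary condition is \<open>U(\<cdot>,t) \<in> H\<^sub>0\<^sup>1(\<Omega>)\<close>, and the collocation equations
  are identities between \<open>L\<^sub>2\<close> functions, i.e. they hold almost everywhere in \<open>\<Omega>\<close>.\<close>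

definition collocation_solution ::
  "'a::euclidean_space set \<Rightarrow> ('a \<Rightarrow> 'a \<Rightarrow> real) \<Rightarrow> ('a \<Rightarrow> 'a \<Rightarrow> real) \<Rightarrow> ('a \<Rightarrow> real) \<Rightarrow>
     real \<Rightarrow> real \<Rightarrow> nat \<Rightarrow> (nat \<Rightarrow> real) \<Rightarrow> ('a \<Rightarrow> real \<Rightarrow> real) \<Rightarrow> ('a \<Rightarrow> real \<Rightarrow> real) \<Rightarrow> bool" where
  "collocation_solution \<Omega> a b c \<alpha> \<tau> m \<theta> F U \<longleftrightarrow>
     (\<forall>x \<in> \<Omega>. \<exists>p :: real poly. degree p \<le> m \<and> (\<forall>t \<in> {0<..1}. U x t = poly p t)) \<and>
     (\<forall>t \<in> {0<..1}. (\<lambda>x. U x t) \<in> H10 \<Omega>) \<and>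
     (\<forall>l \<le> m. \<exists>w. elliptic_op \<Omega> a b c (\<lambda>x. frac_int \<alpha> (U x) (\<theta> l)) w \<and>
        (AE x in lebesgue_on \<Omega>. U x (\<theta> l) + \<tau> powr \<alpha> * w x = F x (\<theta> l)))"

end

theory Submission
  imports Defs
begin

text \<open>A negative eigenvalue of the collocation matrix would make the functions
  \<open>t\<^sup>j + \<kappa> c\<^sub>j t\<^bsup>j+\<alpha>\<^esup>\<close> with some \<open>\<kappa> > 0\<close> linearly dependent on the nodes. Expanding the
  determinant column by column gives a positive combination of generalised Vandermonde determinants
  with the exponents \<open>j\<close> or \<open>j + \<alpha>\<close> in column \<open>j\<close>; these exponents increase with \<open>j\<close> because
  \<open>\<alpha> < 1\<close>, so every term is positive.

  In the eigenbasis the collocation problem decouples into such systems with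
  \<open>\<kappa> = \<tau>\<^sup>\<alpha> \<lambda>\<^sub>n\<close>, whose solutions are \<open>O(1/\<lambda>\<^sub>n)\<close> times the data, so that the series of the
  solution converges in the domain of the (closed) operator. For uniqueness one needs that every
  function in the domain has coefficients on which the operator acts diagonally, which follows from
  the Garding inequality.\<close>

text \<open>The sign of a generalised Vandermonde determinant comes from counting zeros: a
  nontrivial combination of n real powers has fewer than n positive zeros, so the determinant, as a
  function of its last node, cannot vanish to the right of the other nodes.

  The determinants must stay positive in the limit of infinite \<kappa> as well, where, after
  division by \<kappa>, only the columns with the powers j + \<alpha> remain. This is used twice. It
  makes the bound O(1/\<lambda>) uniform, because the divided systems depend continuously on
  1/\<kappa> in a compact interval that contains 0. It also shows that the polynomial coefficients
  of every solution lie in the domain of the operator, although the problem itself places only the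
  fractional integrals at the nodes there.

  The obstacle to uniqueness is that the operator is not symmetric: orthonormality of the
  eigenfunctions does not by itself tell how the operator acts on the coefficients of a general
  element of its domain.\<close>

section \<open>Positivity of collocation determinants\<close>

text \<open>Rolle's theorem between neighbouring zeros, with the largest zero removed in each step
  of the induction. The bound \<open>y < Max Z\<close> carries the induction: it separates the zeros
  found to the left of the second largest point from the new one found to the right of it.\<close>

lemma rolle_zeros_count:
  fixes g g' :: "real \<Rightarrow> real"
  assumes "finite Z" "card Z = Suc k" "\<And>z. z \<in> Z \<Longrightarrow> 0 < z \<and> g z = 0"
    and der: "\<And>y. 0 < y \<Longrightarrow> (g has_real_derivative g' y) (at y)"
  shows "\<exists>Y. finite Y \<and> card Y = k \<and> (\<forall>y\<in>Y. 0 < y \<and> y < Max Z \<and> g' y = 0)"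
  using assms(1-3)
proof (induction k arbitrary: Z)
  case 0
  then show ?case by (intro exI[of _ "{}"]) auto
next
  case (Suc k)
  define b where "b = Max Z"
  define Z' where "Z' = Z - {b}"
  have ne: "Z \<noteq> {}" using Suc.prems by auto
  have bZ: "b \<in> Z" using Max_in ne Suc.prems b_def by auto
  have c': "card Z' = Suc k" using Suc.prems bZ Z'_def by auto
  have f': "finite Z'" using Suc.prems Z'_def by auto
  obtain Y where Y: "finite Y" "card Y = k" "\<forall>y\<in>Y. 0 < y \<and> y < Max Z' \<and> g' y = 0"
    using Suc.IH[of Z'] c' f' Suc.prems Z'_def by auto
  define a where "a = Max Z'"
  have "Z' \<noteq> {}" using c' by auto
  then have aZ: "a \<in> Z'" using Max_in[OF f'] a_def by auto
  have ab: "a < b"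
    using aZ Max_ge[OF Suc.prems(1), of a] unfolding Z'_def b_def[symmetric] by auto
  have a0: "0 < a" "g a = 0" using aZ Suc.prems Z'_def by auto
  have b0: "g b = 0" using bZ Suc.prems by auto
  obtain z where z: "a < z" "z < b" "g' z = 0"
  proof -
    have "\<exists>z. a < z \<and> z < b \<and> g b - g a = (b - a) * g' z"
      using ab a0 der by (intro MVT2) auto
    then show ?thesis using that a0 b0 ab by auto
  qed
  have "z \<notin> Y" using z Y a_def by auto
  then show ?case
    using z Y a0 ab unfolding b_def[symmetric] a_def[symmetric]
    by (intro exI[of _ "insert z Y"]) (auto simp: a_def[symmetric])
qed

text \<open>Dividing by \<open>z powr e0\<close> turns one term into a constant without moving the
  positive zeros, and differentiation removes it, at the cost of at most one zero. Taking
  \<open>e0\<close> different from \<open>e1\<close> keeps a nonzero coefficient alive. Coefficients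
  are indexed by the exponents themselves, so that shifting the exponents is taking an image of
  \<open>E\<close>.\<close>

lemma powr_sum_zeros_less_card:
  fixes c :: "real \<Rightarrow> real"
  assumes "finite E" "e1 \<in> E" "c e1 \<noteq> 0" "finite Z"
    and "\<And>z. z \<in> Z \<Longrightarrow> 0 < z \<and> (\<Sum>e\<in>E. c e * z powr e) = 0"
  shows "card Z < card E"
  using assms
proof (induction "card E" arbitrary: E c e1 Z)
  case 0
  then show ?case by auto
next
  case (Suc n)
  show ?case
  proof (cases "E = {e1}")
    case True
    have "Z = {}"
    proof (rule ccontr)
      assume "Z \<noteq> {}"
      then obtain z where "z \<in> Z" by auto
      then have "0 < z" "c e1 * z powr e1 = 0" using Suc.prems True by auto
      then show False using Suc.prems by auto
    qed
    then show ?thesis using True by auto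
  next
    case False
    then obtain e0 where e0: "e0 \<in> E" "e0 \<noteq> e1" using Suc.prems by auto
    define g where "g z = (\<Sum>e\<in>E. c e * z powr (e - e0))" for z :: real
    \<comment> \<open>An exponent \<open>e\<close> of the derivative stems from
      \<open>e + 1 + e0\<close> in \<open>E\<close>; after the division it was \<open>e + 1\<close>,
      which comes down as a factor.\<close>
    define d where "d e = c (e + 1 + e0) * (e + 1)" for e
    define E' where "E' = (\<lambda>e. e - e0 - 1) ` (E - {e0})"
    have inj: "inj_on (\<lambda>e. e - e0 - 1) (E - {e0})" by (auto simp: inj_on_def)
    have fE': "finite E'" using Suc.prems E'_def by auto
    have cE': "card E' = n" using Suc e0 unfolding E'_def card_image[OF inj] by auto
    have der: "(g has_real_derivative (\<Sum>e\<in>E'. d e * y powr e)) (at y)" if "0 < y" for y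
    proof -
      have "(g has_real_derivative (\<Sum>e\<in>E. c e * ((e - e0) * y powr (e - e0 - 1)))) (at y)"
        unfolding g_def using that
        by (intro DERIV_sum DERIV_cmult has_real_derivative_powr)
      also have "(\<Sum>e\<in>E. c e * ((e - e0) * y powr (e - e0 - 1))) =
          (\<Sum>e\<in>E - {e0}. c e * ((e - e0) * y powr (e - e0 - 1)))"
        using Suc.prems e0 by (intro sum.mono_neutral_right) auto
      also have "\<dots> = (\<Sum>e\<in>E'. d e * y powr e)"
        unfolding E'_def by (subst sum.reindex[OF inj]) (auto simp: d_def mult_ac)
      finally show ?thesis .
    qed
    have gz: "0 < z \<and> g z = 0" if "z \<in> Z" for z
    proof -
      have "g z = (\<Sum>e\<in>E. c e * z powr e) * z powr (- e0)"
        unfolding g_def sum_distrib_right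
        by (intro sum.cong) (auto simp: powr_add[symmetric] algebra_simps)
      then show ?thesis using Suc.prems that by auto
    qed
    show ?thesis
    proof (cases "card Z")
      case 0
      then show ?thesis using Suc by auto
    next
      case (Suc k)
      obtain Y where Y: "finite Y" "card Y = k"
          "\<forall>y\<in>Y. 0 < y \<and> y < Max Z \<and> (\<Sum>e\<in>E'. d e * y powr e) = 0"
        using rolle_zeros_count[OF \<open>finite Z\<close> Suc gz der] by blast
      have "card Y < card E'"
      proof (rule Suc.hyps(1))
        show "e1 - e0 - 1 \<in> E'" using e0 Suc.prems E'_def by auto
        show "d (e1 - e0 - 1) \<noteq> 0" using e0 Suc.prems d_def by auto
      qed (use cE' fE' Y in auto)
      then show ?thesis using Suc Y cE' \<open>Suc n = card E\<close> by auto
    qed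
  qed
qed

text \<open>Laplace expansion along column \<open>k\<close>: its cofactors do not see that column,
  so those of \<open>A (\<lambda>_. 0)\<close> serve for every choice of the column.\<close>

lemma det_column_linear:
  fixes u v :: "nat \<Rightarrow> 'a::comm_ring_1"
  assumes "k < n"
  shows "det (Matrix.mat n n (\<lambda>(i, j). if j = k then p * u i + q * v i else f i j)) =
    p * det (Matrix.mat n n (\<lambda>(i, j). if j = k then u i else f i j)) +
    q * det (Matrix.mat n n (\<lambda>(i, j). if j = k then v i else f i j))"
proof -
  define A where "A w = Matrix.mat n n (\<lambda>(i, j). if j = k then w i else f i j)" for w :: "nat \<Rightarrow> 'a"
  have A: "det (A w) = (\<Sum>i<n. w i * cofactor (A (\<lambda>_. 0)) i k)" for w
  proof -
    have "cofactor (A w) i k = cofactor (A (\<lambda>_. 0)) i k" if "i < n" for i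
    proof -
      have "mat_delete (A w) i k = mat_delete (A (\<lambda>_. 0)) i k"
        unfolding mat_delete_def A_def using that assms
        by (intro cong_mat) auto
      then show ?thesis by (simp add: cofactor_def)
    qed
    moreover have "det (A w) = (\<Sum>i<n. A w $$ (i, k) * cofactor (A w) i k)"
      by (rule laplace_expansion_column) (auto simp: A_def assms)
    ultimately show ?thesis by (simp add: A_def assms)
  qed
  show ?thesis
    using A[of "\<lambda>i. p * u i + q * v i"] A[of u] A[of v]
    by (simp add: A_def[symmetric] sum.distrib sum_distrib_left algebra_simps)
qed

text \<open>The last node becomes a variable \<open>y\<close>. The determinant is then a sum
  \<open>h y\<close> of n + 1 powers which vanishes at the n earlier nodes, so it has no zero from
  \<open>x n\<close> on. Its sign there is that of its leading coefficient, the cofactor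
  \<open>C n\<close>, which is the determinant of size n and positive by induction.\<close>

lemma det_generalized_vandermonde_pos:
  fixes x a :: "nat \<Rightarrow> real"
  assumes "\<And>i. i < n \<Longrightarrow> 0 < x i" "strict_mono_on {..<n} x" "strict_mono_on {..<n} a"
  shows "0 < det (Matrix.mat n n (\<lambda>(i, j). x i powr a j))"
  using assms
proof (induction n)
  case 0
  then show ?case by simp
next
  case (Suc n)
  define A where "A y = Matrix.mat (Suc n) (Suc n) (\<lambda>(i, j). (if i = n then y else x i) powr a j)" for y
  define C where "C = cofactor (A 0) n"
  define h where "h y = (\<Sum>j<Suc n. y powr a j * C j)" for y
  have A: "A y \<in> carrier_mat (Suc n) (Suc n)" for y by (simp add: A_def)
  have detA: "det (A y) = h y" for y
  proof -
    have "mat_delete (A y) n j = mat_delete (A 0) n j" for j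
      unfolding mat_delete_def A_def by (intro cong_mat) auto
    then have "cofactor (A y) n j = C j" for j by (simp add: C_def cofactor_def)
    moreover have "det (A y) = (\<Sum>j<Suc n. A y $$ (n, j) * cofactor (A y) n j)"
      using laplace_expansion_row[OF A, of n] by simp
    ultimately show ?thesis unfolding h_def by (simp add: A_def)
  qed
  have Cn: "0 < C n"
  proof -
    have "mat_delete (A 0) n n = Matrix.mat n n (\<lambda>(i, j). x i powr a j)"
      unfolding mat_delete_def A_def by (intro eq_matI) auto
    moreover have "0 < det (Matrix.mat n n (\<lambda>(i, j). x i powr a j))"
      using Suc.prems by (intro Suc.IH) (auto simp: monotone_on_def)
    ultimately show ?thesis by (simp add: C_def cofactor_def)
  qed
  have hx: "h (x i) = 0" if "i < n" for i
  proof -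
    have "det (A (x i)) = 0"
      by (rule det_identical_rows[OF A, of i n]) (use that in \<open>auto simp: A_def\<close>)
    then show ?thesis by (simp add: detA)
  qed
  have inja: "inj_on a {..<Suc n}"
    using Suc.prems(3) by (rule strict_mono_on_imp_inj_on)
  have injx: "inj_on x {..<Suc n}"
    using Suc.prems(2) by (rule strict_mono_on_imp_inj_on)
  \<comment> \<open>Together with the n earlier nodes, \<open>y\<close> would be the zero number n +
    1 of a combination of n + 1 powers. The function \<open>b\<close> below recovers the index of an
    exponent, as the zero count indexes coefficients by exponents.\<close>
  have nz: "h y \<noteq> 0" if y: "x n \<le> y" for y
  proof
    assume h0: "h y = 0"
    define b where "b = inv_into {..<Suc n} a"
    have b: "b (a j) = j" if "j < Suc n" for j
      unfolding b_def using inja that by (intro inv_into_f_f) auto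
    have heq: "h z = (\<Sum>e\<in>a ` {..<Suc n}. C (b e) * z powr e)" for z
      unfolding h_def by (subst sum.reindex[OF inja]) (auto simp: b mult_ac intro!: sum.cong)
    have "0 < x n" using Suc.prems(1) by simp
    then have y0: "0 < y" using y by linarith
    have lt: "x i < x n" if "i < n" for i
      using Suc.prems(2) that by (auto simp: monotone_on_def)
    have "card (insert y (x ` {..<n})) < card (a ` {..<Suc n})"
    proof (rule powr_sum_zeros_less_card)
      show "a n \<in> a ` {..<Suc n}" by auto
      show "C (b (a n)) \<noteq> 0" using Cn b by auto
      show "0 < z \<and> (\<Sum>e\<in>a ` {..<Suc n}. C (b e) * z powr e) = 0" if "z \<in> insert y (x ` {..<n})" for z
        using that h0 hx y0 Suc.prems(1) unfolding heq[symmetric] by auto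
    qed auto
    moreover have "y \<notin> x ` {..<n}" using lt y by fastforce
    moreover have "card (x ` {..<n}) = n"
      using injx by (subst card_image) (auto simp: inj_on_def)
    ultimately show False by (simp add: card_image[OF inja])
  qed
  have "0 < h (x n)"
  proof (rule ccontr)
    assume neg: "\<not> 0 < h (x n)"
    \<comment> \<open>After division by \<open>y powr a n\<close> only the term j = n survives for
      large \<open>y\<close>. Hence \<open>h\<close> is positive somewhere to the right of
      \<open>x n\<close>, and a nonpositive value at \<open>x n\<close> would force a zero in
      between.\<close>
    have lim: "((\<lambda>y. \<Sum>j<Suc n. y powr (a j - a n) * C j) \<longlongrightarrow> (\<Sum>j<Suc n. (if j = n then 1 else 0) * C j)) at_top"
    proof (intro tendsto_sum tendsto_mult tendsto_const)
      fix j assume j: "j \<in> {..<Suc n}"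
      show "((\<lambda>y. y powr (a j - a n)) \<longlongrightarrow> (if j = n then 1 else 0)) at_top"
      proof (cases "j = n")
        case True
        have "((\<lambda>y::real. 1) \<longlongrightarrow> (1::real)) at_top" by simp
        moreover have "\<forall>\<^sub>F y::real in at_top. y powr (a j - a n) = 1"
          using eventually_gt_at_top[of 0] by eventually_elim (auto simp: True)
        ultimately show ?thesis by (simp add: True tendsto_cong)
      next
        case False
        then have "a j < a n" using Suc.prems(3) j by (auto simp: monotone_on_def)
        then show ?thesis using False tendsto_neg_powr[of "a j - a n" "\<lambda>y. y" at_top]
          by (auto simp: filterlim_ident)
      qed
    qed
    moreover have "(\<Sum>j<Suc n. (if j = n then 1 else 0) * C j) = C n"
      by (simp add: sum.lessThan_Suc)
    ultimately have "\<forall>\<^sub>F y in at_top. 0 < (\<Sum>j<Suc n. y powr (a j - a n) * C j)"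
      using Cn order_tendstoD(1) by fastforce
    then have "\<forall>\<^sub>F y in at_top. 0 < h y \<and> x n \<le> y"
      using eventually_ge_at_top[of "x n"]
    proof eventually_elim
      case (elim y)
      have y: "0 < y" using elim Suc.prems(1)[of n] by auto
      have "h y = y powr (a n) * (\<Sum>j<Suc n. y powr (a j - a n) * C j)"
        unfolding h_def sum_distrib_left using y
        by (intro sum.cong) (auto simp: powr_diff)
      then show ?case using elim y by auto
    qed
    then have "\<exists>Y. 0 < h Y \<and> x n \<le> Y"
      by (rule eventually_happens'[OF trivial_limit_at_top_linorder])
    then obtain Y where Y: "0 < h Y" "x n \<le> Y" by blast
    have "continuous_on {x n..Y} h"
      unfolding h_def using Suc.prems(1)[of n] by (intro continuous_intros) auto
    then obtain z where "x n \<le> z" "h z = 0"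
      using IVT'[of h "x n" 0 Y] neg Y by (auto simp: not_less)
    then show False using nz by auto
  qed
  moreover have "Matrix.mat (Suc n) (Suc n) (\<lambda>(i, j). x i powr a j) = A (x n)"
    unfolding A_def by (intro cong_mat) auto
  ultimately show ?case by (simp add: detA)
qed

lemma det_mixed_vandermonde_pos:
  fixes x p q :: "nat \<Rightarrow> real"
  assumes x: "\<And>i. i < n \<Longrightarrow> 0 < x i" "strict_mono_on {..<n} x"
    and \<alpha>: "0 < \<alpha>" "\<alpha> < 1"
    and pq: "\<And>j. j < n \<Longrightarrow> 0 \<le> p j \<and> 0 \<le> q j \<and> 0 < p j + q j"
  shows "0 < det (Matrix.mat n n (\<lambda>(i, j). p j * x i ^ j + q j * x i powr (real j + \<alpha>)))"
proof -
  \<comment> \<open>Induction on the number \<open>k\<close> of mixed columns, the others holding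
    one pure power each. The choice \<open>a\<close> of these powers stays arbitrary, because
    splitting column \<open>k\<close> calls the induction hypothesis for both possible values of
    \<open>a k\<close>.\<close>
  have *: "0 < det (Matrix.mat n n (\<lambda>(i, j).
      if j < k then p j * x i ^ j + q j * x i powr (real j + \<alpha>) else x i powr a j))"
    if "k \<le> n" "\<And>j. a j \<in> {real j, real j + \<alpha>}" for k a
    using that
  proof (induction k arbitrary: a)
    case 0
    have "strict_mono_on {..<n} a"
    proof (rule monotone_onI)
      fix i j :: nat assume "i < j"
      then have "real i + 1 \<le> real j" by linarith
      then show "a i < a j" using 0(2)[of i] 0(2)[of j] \<alpha> by auto
    qed
    then show ?case using det_generalized_vandermonde_pos[OF x] by simp
  next
    case (Suc k)
    have k: "k < n" using Suc.prems by auto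
    define f where "f i j = (if j < k then p j * x i ^ j + q j * x i powr (real j + \<alpha>) else x i powr a j)" for i j
    have e: "Matrix.mat n n (\<lambda>(i, j). if j < k then p j * x i ^ j + q j * x i powr (real j + \<alpha>) else x i powr (a(k := r)) j)
        = Matrix.mat n n (\<lambda>(i, j). if j = k then x i powr r else f i j)" for r
      unfolding f_def by (intro cong_mat) auto
    have pos: "0 < det (Matrix.mat n n (\<lambda>(i, j). if j = k then x i powr r else f i j))"
      if "r \<in> {real k, real k + \<alpha>}" for r
      unfolding e[symmetric] using Suc.IH[of "a(k := r)"] Suc.prems that k by auto
    have "Matrix.mat n n (\<lambda>(i, j).
      if j < Suc k then p j * x i ^ j + q j * x i powr (real j + \<alpha>) else x i powr a j)
      = Matrix.mat n n (\<lambda>(i, j). if j = k then p k * x i powr real k + q k * x i powr (real k + \<alpha>) else f i j)"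
      unfolding f_def using x by (intro cong_mat) (auto simp: powr_realpow)
    then have "det (Matrix.mat n n (\<lambda>(i, j).
        if j < Suc k then p j * x i ^ j + q j * x i powr (real j + \<alpha>) else x i powr a j)) =
      p k * det (Matrix.mat n n (\<lambda>(i, j). if j = k then x i powr real k else f i j)) +
      q k * det (Matrix.mat n n (\<lambda>(i, j). if j = k then x i powr (real k + \<alpha>) else f i j))"
      by (simp add: det_column_linear[OF k])
    moreover have "0 < p k * det (Matrix.mat n n (\<lambda>(i, j). if j = k then x i powr real k else f i j)) +
      q k * det (Matrix.mat n n (\<lambda>(i, j). if j = k then x i powr (real k + \<alpha>) else f i j))"
      using pos[of "real k"] pos[of "real k + \<alpha>"] pq[OF k]
      by (cases "p k = 0") (auto intro: add_pos_nonneg add_nonneg_pos)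
    ultimately show ?case by simp
  qed
  have "Matrix.mat n n (\<lambda>(i, j). p j * x i ^ j + q j * x i powr (real j + \<alpha>)) =
    Matrix.mat n n (\<lambda>(i, j).
      if j < n then p j * x i ^ j + q j * x i powr (real j + \<alpha>) else x i powr real j)"
    by (intro cong_mat) auto
  then show ?thesis using *[of n real] by simp
qed

section \<open>Linear systems and bounds on inverses that depend on a parameter\<close>

lemma linear_system_unique:
  fixes A :: "nat \<Rightarrow> nat \<Rightarrow> real"
  assumes "det (Matrix.mat n n (\<lambda>(i, j). A i j)) \<noteq> 0" "\<And>i. i < n \<Longrightarrow> (\<Sum>j<n. A i j * v j) = 0" "j < n"
  shows "v j = 0"
proof (rule ccontr)
  assume "v j \<noteq> 0"
  define M where "M = Matrix.mat n n (\<lambda>(i, j). A i j)"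
  have M: "M \<in> carrier_mat n n" by (simp add: M_def)
  have "Matrix.vec n v \<noteq> 0\<^sub>v n" using \<open>v j \<noteq> 0\<close> assms(3)
    by (metis index_vec index_zero_vec(1))
  moreover have "M *\<^sub>v Matrix.vec n v = 0\<^sub>v n"
    using assms(2) by (intro eq_vecI) (auto simp: M_def scalar_prod_def atLeast0LessThan)
  ultimately show False
    using det_0_iff_vec_prod_zero[OF M] assms(1) M_def by (metis vec_carrier)
qed

text \<open>The inverse is the adjugate over the determinant. It is stated by scalar sums rather
  than matrix products because the systems are later applied to functions on the domain, point by
  point.\<close>

lemma linear_system_inverse:
  fixes A :: "nat \<Rightarrow> nat \<Rightarrow> real"
  assumes "det (Matrix.mat n n (\<lambda>(i, j). A i j)) \<noteq> 0"
  shows "\<exists>B. \<forall>i<n. \<forall>k<n. (\<Sum>j<n. A i j * B j k) = (if i = k then 1 else 0)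
    \<and> (\<Sum>j<n. B i j * A j k) = (if i = k then 1 else 0)"
proof -
  define M where "M = Matrix.mat n n (\<lambda>(i, j). A i j)"
  have M: "M \<in> carrier_mat n n" by (simp add: M_def)
  define B where "B j k = adj_mat M $$ (j, k) / det M" for j k
  have "(\<Sum>j<n. A i j * B j k) = (if i = k then 1 else 0)
      \<and> (\<Sum>j<n. B i j * A j k) = (if i = k then 1 else 0)" if "i < n" "k < n" for i k
  proof -
    have "(\<Sum>j<n. A i j * adj_mat M $$ (j, k)) = (M * adj_mat M) $$ (i, k)"
      using that adj_mat(1)[OF M] by (auto simp: M_def scalar_prod_def atLeast0LessThan)
    also have "\<dots> = (if i = k then det M else 0)"
      using that unfolding adj_mat(2)[OF M] by auto
    finally have 1: "(\<Sum>j<n. A i j * adj_mat M $$ (j, k)) = (if i = k then det M else 0)" .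
    have "(\<Sum>j<n. adj_mat M $$ (i, j) * A j k) = (adj_mat M * M) $$ (i, k)"
      using that adj_mat(1)[OF M] by (auto simp: M_def scalar_prod_def atLeast0LessThan)
    also have "\<dots> = (if i = k then det M else 0)"
      using that unfolding adj_mat(3)[OF M] by auto
    finally have 2: "(\<Sum>j<n. adj_mat M $$ (i, j) * A j k) = (if i = k then det M else 0)" .
    show ?thesis
      using 1 2 assms M_def unfolding B_def
      by (auto simp: sum_divide_distrib[symmetric] split: if_splits)
  qed
  then show ?thesis by blast
qed

lemma sum_delta_mult:
  fixes f :: "nat \<Rightarrow> real"
  assumes "i < n"
  shows "(\<Sum>k<n. (if i = k then 1 else 0) * f k) = f i"
proof -
  have "(\<Sum>k<n. (if i = k then 1 else 0) * f k) = (\<Sum>k<n. if i = k then f k else 0)"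
    by (intro sum.cong) auto
  then show ?thesis using assms by simp
qed

lemma linear_system_solution:
  fixes A :: "nat \<Rightarrow> nat \<Rightarrow> real"
  assumes "det (Matrix.mat n n (\<lambda>(i, j). A i j)) \<noteq> 0"
  shows "\<exists>v. \<forall>i<n. (\<Sum>j<n. A i j * v j) = f i"
proof -
  from linear_system_inverse[OF assms] obtain B where
    "\<forall>i<n. \<forall>k<n. (\<Sum>j<n. A i j * B j k) = (if i = k then 1 else 0)
      \<and> (\<Sum>j<n. B i j * A j k) = (if i = k then 1 else 0)" ..
  then have B: "\<And>i k. i < n \<Longrightarrow> k < n \<Longrightarrow> (\<Sum>j<n. A i j * B j k) = (if i = k then 1 else 0)"
    by blast
  have "(\<Sum>j<n. A i j * (\<Sum>k<n. B j k * f k)) = f i" if i: "i < n" for i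
  proof -
    have "(\<Sum>j<n. A i j * (\<Sum>k<n. B j k * f k)) = (\<Sum>j<n. \<Sum>k<n. A i j * B j k * f k)"
      by (simp only: sum_distrib_left mult.assoc)
    also have "\<dots> = (\<Sum>k<n. (\<Sum>j<n. A i j * B j k) * f k)"
      by (subst sum.swap) (simp only: sum_distrib_right)
    also have "\<dots> = (\<Sum>k<n. (if i = k then 1 else 0) * f k)"
      by (intro sum.cong refl) (simp only: B[OF i] lessThan_iff)
    also have "\<dots> = f i"
      by (rule sum_delta_mult[OF i])
    finally show ?thesis .
  qed
  then show ?thesis by (intro exI[of _ "\<lambda>j. \<Sum>k<n. B j k * f k"] allI impI)
qed

lemma continuous_on_det:
  fixes A :: "real \<Rightarrow> real mat"
  assumes "\<And>t. A t \<in> carrier_mat n n"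
    "\<And>i j. i < n \<Longrightarrow> j < n \<Longrightarrow> continuous_on S (\<lambda>t. A t $$ (i, j))"
  shows "continuous_on S (\<lambda>t. det (A t))"
  unfolding det_def'[OF assms(1)] using assms(2)
  by (intro continuous_intros) (auto dest: permutes_in_image[THEN iffD2])

text \<open>By Cramer's rule the entries of the inverse are cofactors over the determinant; they are
  continuous in \<open>t\<close> and therefore bounded on the compact set \<open>S\<close>. The
  constant \<open>C\<close> sums the bounds of all entries.\<close>

lemma uniform_inverse_bound:
  fixes A :: "real \<Rightarrow> nat \<Rightarrow> nat \<Rightarrow> real"
  assumes S: "compact S"
    and cont: "\<And>i j. i < n \<Longrightarrow> j < n \<Longrightarrow> continuous_on S (\<lambda>t. A t i j)"
    and nz: "\<And>t. t \<in> S \<Longrightarrow> det (Matrix.mat n n (\<lambda>(i, j). A t i j)) \<noteq> 0"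
  shows "\<exists>C\<ge>0. \<forall>t\<in>S. \<forall>v. \<forall>j<n. \<bar>v j\<bar> \<le> C * (\<Sum>i<n. \<bar>\<Sum>k<n. A t i k * v k\<bar>)"
proof -
  define M where "M t = Matrix.mat n n (\<lambda>(i, j). A t i j)" for t
  have M: "M t \<in> carrier_mat n n" for t by (simp add: M_def)
  have contadj: "continuous_on S (\<lambda>t. adj_mat (M t) $$ (j, i) / det (M t))" if "i < n" "j < n" for i j
  proof -
    have "continuous_on S (\<lambda>t. det (mat_delete (M t) i j))"
    proof (rule continuous_on_det[of _ "n - 1"])
      show "mat_delete (M t) i j \<in> carrier_mat (n - 1) (n - 1)" for t
        by (rule mat_delete_carrier[OF M])
      fix i' j' assume "i' < n - 1" "j' < n - 1"
      then show "continuous_on S (\<lambda>t. mat_delete (M t) i j $$ (i', j'))"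
        by (auto simp: mat_delete_def M_def intro!: cont)
    qed
    moreover have "continuous_on S (\<lambda>t. det (M t))"
      by (rule continuous_on_det[OF M]) (simp add: M_def cont)
    ultimately show ?thesis
      using nz that by (auto simp: adj_mat_def cofactor_def M_def intro!: continuous_intros)
  qed
  have "\<forall>i\<in>{..<n}. \<forall>j\<in>{..<n}. \<exists>c. \<forall>t\<in>S. \<bar>adj_mat (M t) $$ (j, i) / det (M t)\<bar> \<le> c"
  proof (intro ballI)
    fix i j assume "i \<in> {..<n}" "j \<in> {..<n}"
    then have "compact ((\<lambda>t. adj_mat (M t) $$ (j, i) / det (M t)) ` S)"
      using contadj S by (intro compact_continuous_image) auto
    then show "\<exists>c. \<forall>t\<in>S. \<bar>adj_mat (M t) $$ (j, i) / det (M t)\<bar> \<le> c"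
      using compact_imp_bounded bounded_iff by (metis (no_types, lifting) imageI real_norm_def)
  qed
  then obtain c where c: "\<And>i j t. i < n \<Longrightarrow> j < n \<Longrightarrow> t \<in> S \<Longrightarrow>
      \<bar>adj_mat (M t) $$ (j, i) / det (M t)\<bar> \<le> c i j"
    by (metis lessThan_iff)
  define C where "C = (\<Sum>i<n. \<Sum>j<n. \<bar>c i j\<bar>)"
  have cC: "\<bar>c i j\<bar> \<le> C" if "i < n" "j < n" for i j
  proof -
    have "\<bar>c i j\<bar> \<le> (\<Sum>j<n. \<bar>c i j\<bar>)" using that by (intro member_le_sum) auto
    also have "\<dots> \<le> C" unfolding C_def using that
      by (intro member_le_sum[of i _ "\<lambda>i. \<Sum>j<n. \<bar>c i j\<bar>"]) (auto intro: sum_nonneg)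
    finally show ?thesis .
  qed
  have "\<bar>v j\<bar> \<le> C * (\<Sum>i<n. \<bar>\<Sum>k<n. A t i k * v k\<bar>)" if t: "t \<in> S" and j: "j < n" for t v j
  proof -
    define f where "f i = (\<Sum>k<n. A t i k * v k)" for i
    have d: "det (M t) \<noteq> 0" using nz[OF t] M_def by auto
    have "(\<Sum>i<n. adj_mat (M t) $$ (j, i) * f i) =
        (\<Sum>k<n. (\<Sum>i<n. adj_mat (M t) $$ (j, i) * A t i k) * v k)"
      unfolding f_def sum_distrib_left sum_distrib_right
      by (subst sum.swap) (simp add: mult_ac)
    also have "\<dots> = (\<Sum>k<n. (if j = k then det (M t) else 0) * v k)"
    proof (intro sum.cong refl)
      fix k assume k: "k \<in> {..<n}"
      have "(\<Sum>i<n. adj_mat (M t) $$ (j, i) * A t i k) = (adj_mat (M t) * M t) $$ (j, k)"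
        using j k adj_mat(1)[OF M[of t]] by (auto simp: M_def scalar_prod_def atLeast0LessThan)
      also have "\<dots> = (if j = k then det (M t) else 0)"
        using j k unfolding adj_mat(3)[OF M] by auto
      finally show "(\<Sum>i<n. adj_mat (M t) $$ (j, i) * A t i k) * v k = (if j = k then det (M t) else 0) * v k"
        by simp
    qed
    also have "\<dots> = det (M t) * v j"
      using j by (simp add: if_distrib[of "\<lambda>z. z * _"] cong: if_cong)
    finally have "v j = (\<Sum>i<n. adj_mat (M t) $$ (j, i) / det (M t) * f i)"
      using d by (simp add: sum_divide_distrib[symmetric])
    also have "\<bar>\<dots>\<bar> \<le> (\<Sum>i<n. \<bar>adj_mat (M t) $$ (j, i) / det (M t)\<bar> * \<bar>f i\<bar>)"
      by (rule order_trans[OF sum_abs]) (simp add: abs_mult)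
    also have "\<dots> \<le> (\<Sum>i<n. C * \<bar>f i\<bar>)"
    proof (intro sum_mono mult_right_mono)
      fix i assume "i \<in> {..<n}"
      then show "\<bar>adj_mat (M t) $$ (j, i) / det (M t)\<bar> \<le> C"
        using c[of i j t] cC[of i j] t j by auto
    qed auto
    finally show ?thesis by (simp add: sum_distrib_left f_def)
  qed
  moreover have "0 \<le> C" unfolding C_def by (intro sum_nonneg) auto
  ultimately show ?thesis by blast
qed

section \<open>The space \<open>L\<^sub>2\<close>\<close>

definition L2_norm :: "'a::euclidean_space set \<Rightarrow> ('a \<Rightarrow> real) \<Rightarrow> real" where
  "L2_norm \<Omega> f = sqrt (L2_inner \<Omega> f f)"

lemma L2_mult_integrable:
  assumes "f \<in> L2 \<Omega>" "g \<in> L2 \<Omega>"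
  shows "integrable (lebesgue_on \<Omega>) (\<lambda>x. f x * g x)"
proof (rule Bochner_Integration.integrable_bound)
  show "integrable (lebesgue_on \<Omega>) (\<lambda>x. (f x)\<^sup>2 + (g x)\<^sup>2)"
    using assms by (auto simp: L2_def)
  show "(\<lambda>x. f x * g x) \<in> borel_measurable (lebesgue_on \<Omega>)"
    using assms by (auto simp: L2_def)
  have "\<bar>u * v\<bar> \<le> u\<^sup>2 + v\<^sup>2" for u v :: real
    using sum_squares_bound[of u v] sum_squares_bound[of u "-v"] by (auto simp: abs_le_iff)
  then show "AE x in lebesgue_on \<Omega>. norm (f x * g x) \<le> norm ((f x)\<^sup>2 + (g x)\<^sup>2)"
    by (simp add: abs_le_iff)
qed

lemma L2_measurable: "f \<in> L2 \<Omega> \<Longrightarrow> f \<in> borel_measurable (lebesgue_on \<Omega>)"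
  by (simp add: L2_def)

lemma L2_bounded_mult:
  assumes "f \<in> L2 \<Omega>" "h \<in> borel_measurable (lebesgue_on \<Omega>)" "\<And>x. x \<in> \<Omega> \<Longrightarrow> \<bar>h x\<bar> \<le> C"
  shows "(\<lambda>x. h x * f x) \<in> L2 \<Omega>"
proof -
  have "integrable (lebesgue_on \<Omega>) (\<lambda>x. (h x * f x)\<^sup>2)"
  proof (rule Bochner_Integration.integrable_bound)
    show "integrable (lebesgue_on \<Omega>) (\<lambda>x. C\<^sup>2 * (f x)\<^sup>2)"
      using assms by (auto simp: L2_def)
    have "(h x)\<^sup>2 \<le> C\<^sup>2" if "x \<in> \<Omega>" for x
      using assms(3)[OF that] by (simp add: abs_le_square_iff[symmetric])
    then show "AE x in lebesgue_on \<Omega>. norm ((h x * f x)\<^sup>2) \<le> norm (C\<^sup>2 * (f x)\<^sup>2)"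
      by (intro AE_I2) (auto simp: power_mult_distrib intro!: mult_right_mono)
    show "(\<lambda>x. (h x * f x)\<^sup>2) \<in> borel_measurable (lebesgue_on \<Omega>)"
      using assms by (auto simp: L2_def)
  qed
  then show ?thesis using assms by (auto simp: L2_def)
qed

lemma L2_zero [simp]: "(\<lambda>x. 0) \<in> L2 \<Omega>"
  by (simp add: L2_def)

lemma L2_scale:
  assumes "f \<in> L2 \<Omega>"
  shows "(\<lambda>x. r * f x) \<in> L2 \<Omega>"
  by (rule L2_bounded_mult[OF assms, of _ "\<bar>r\<bar>"]) auto

lemma L2_add:
  assumes "f \<in> L2 \<Omega>" "g \<in> L2 \<Omega>"
  shows "(\<lambda>x. f x + g x) \<in> L2 \<Omega>"
proof -
  have "integrable (lebesgue_on \<Omega>) (\<lambda>x. (f x)\<^sup>2 + (g x)\<^sup>2 + 2 * (f x * g x))"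
    using assms L2_mult_integrable[OF assms] by (intro Bochner_Integration.integrable_add) (auto simp: L2_def)
  then show ?thesis using assms by (auto simp: L2_def power2_sum mult.assoc)
qed

lemma L2_diff:
  assumes "f \<in> L2 \<Omega>" "g \<in> L2 \<Omega>"
  shows "(\<lambda>x. f x - g x) \<in> L2 \<Omega>"
  using L2_add[OF assms(1) L2_scale[OF assms(2), of "-1"]] by simp

lemma L2_sum:
  assumes "\<And>i. i \<in> I \<Longrightarrow> f i \<in> L2 \<Omega>"
  shows "(\<lambda>x. \<Sum>i\<in>I. f i x) \<in> L2 \<Omega>"
  using assms by (induction I rule: infinite_finite_induct) (auto intro: L2_add)

lemma L2_cong:
  assumes "\<And>x. x \<in> \<Omega> \<Longrightarrow> f x = g x" "f \<in> L2 \<Omega>"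
  shows "g \<in> L2 \<Omega>"
proof -
  have "x \<in> space (lebesgue_on \<Omega>) \<Longrightarrow> f x = g x" for x using assms(1) by simp
  then show ?thesis using assms(2) unfolding L2_def mem_Collect_eq
    by (metis (mono_tags, lifting) measurable_cong Bochner_Integration.integrable_cong)
qed

lemma L2_inner_commute: "L2_inner \<Omega> f g = L2_inner \<Omega> g f"
  by (simp add: L2_inner_def mult.commute)

lemma L2_inner_add_left:
  assumes "f \<in> L2 \<Omega>" "g \<in> L2 \<Omega>" "h \<in> L2 \<Omega>"
  shows "L2_inner \<Omega> (\<lambda>x. f x + g x) h = L2_inner \<Omega> f h + L2_inner \<Omega> g h"
  using L2_mult_integrable[OF assms(1,3)] L2_mult_integrable[OF assms(2,3)]
  unfolding L2_inner_def by (simp add: distrib_right)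

lemma L2_inner_scale_left: "L2_inner \<Omega> (\<lambda>x. r * f x) h = r * L2_inner \<Omega> f h"
  unfolding L2_inner_def by (simp add: mult.assoc)

lemma L2_inner_diff_left:
  assumes "f \<in> L2 \<Omega>" "g \<in> L2 \<Omega>" "h \<in> L2 \<Omega>"
  shows "L2_inner \<Omega> (\<lambda>x. f x - g x) h = L2_inner \<Omega> f h - L2_inner \<Omega> g h"
  using L2_mult_integrable[OF assms(1,3)] L2_mult_integrable[OF assms(2,3)]
  unfolding L2_inner_def by (simp add: left_diff_distrib)

lemma L2_inner_sum_left:
  assumes "\<And>i. i \<in> I \<Longrightarrow> f i \<in> L2 \<Omega>" "h \<in> L2 \<Omega>"
  shows "L2_inner \<Omega> (\<lambda>x. \<Sum>i\<in>I. f i x) h = (\<Sum>i\<in>I. L2_inner \<Omega> (f i) h)"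
  unfolding L2_inner_def sum_distrib_right
  by (rule Bochner_Integration.integral_sum) (simp add: L2_mult_integrable assms)

lemma L2_inner_AE_cong:
  assumes "AE x in lebesgue_on \<Omega>. f x = g x" "f \<in> L2 \<Omega>" "g \<in> L2 \<Omega>" "h \<in> L2 \<Omega>"
  shows "L2_inner \<Omega> f h = L2_inner \<Omega> g h"
  unfolding L2_inner_def using assms
  by (intro integral_cong_AE borel_measurable_times) (auto simp: L2_measurable)

lemma L2_inner_self_nonneg: "0 \<le> L2_inner \<Omega> f f"
  unfolding L2_inner_def by (rule integral_nonneg_AE) auto

lemma L2_norm_nonneg [simp]: "0 \<le> L2_norm \<Omega> f"
  by (simp add: L2_norm_def L2_inner_self_nonneg)

lemma L2_norm_power2: "(L2_norm \<Omega> f)\<^sup>2 = L2_inner \<Omega> f f"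
  by (simp add: L2_norm_def L2_inner_self_nonneg)

lemma L2_tendsto_iff_norm:
  "L2_tendsto \<Omega> f g \<longleftrightarrow> (\<lambda>n. L2_norm \<Omega> (\<lambda>x. f n x - g x)) \<longlonglongrightarrow> 0"
proof -
  have *: "(\<lambda>n. \<integral>x. (f n x - g x)\<^sup>2 \<partial>lebesgue_on \<Omega>) = (\<lambda>n. (L2_norm \<Omega> (\<lambda>x. f n x - g x))\<^sup>2)"
    unfolding L2_norm_power2 L2_inner_def by (simp add: power2_eq_square)
  show ?thesis unfolding L2_tendsto_def *
    using tendsto_power[of "\<lambda>n. L2_norm \<Omega> (\<lambda>x. f n x - g x)" 0 sequentially 2]
      tendsto_real_sqrt[of "\<lambda>n. (L2_norm \<Omega> (\<lambda>x. f n x - g x))\<^sup>2" 0 sequentially]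
    by auto
qed

lemma L2_norm_eq_0D:
  assumes "L2_norm \<Omega> f = 0" "f \<in> L2 \<Omega>"
  shows "AE x in lebesgue_on \<Omega>. f x = 0"
proof -
  have "(\<integral>x. (f x)\<^sup>2 \<partial>lebesgue_on \<Omega>) = 0"
    using assms L2_norm_power2[of \<Omega> f] by (simp add: L2_inner_def power2_eq_square)
  then show ?thesis
    using assms integral_nonneg_eq_0_iff_AE[of "lebesgue_on \<Omega>" "\<lambda>x. (f x)\<^sup>2"] by (auto simp: L2_def)
qed

text \<open>The quadratic form of \<open>s * f + t * g\<close> is nonnegative for all
  \<open>s\<close> and \<open>t\<close>. Evaluating it at \<open>s = C\<close>,
  \<open>t = - B\<close> gives \<open>C * (A * C - B\<^sup>2)\<close>, which settles the case of
  positive \<open>C\<close>.\<close>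

lemma L2_Cauchy_Schwarz:
  assumes f: "f \<in> L2 \<Omega>" and g: "g \<in> L2 \<Omega>"
  shows "\<bar>L2_inner \<Omega> f g\<bar> \<le> L2_norm \<Omega> f * L2_norm \<Omega> g"
proof -
  define A where "A = L2_inner \<Omega> f f"
  define B where "B = L2_inner \<Omega> f g"
  define C where "C = L2_inner \<Omega> g g"
  have exp: "L2_inner \<Omega> (\<lambda>x. s * f x + t * g x) (\<lambda>x. s * f x + t * g x) = s\<^sup>2 * A + 2 * s * t * B + t\<^sup>2 * C" for s t
  proof -
    let ?h = "\<lambda>x. s * f x + t * g x"
    have *: "L2_inner \<Omega> ?h h = s * L2_inner \<Omega> f h + t * L2_inner \<Omega> g h" if "h \<in> L2 \<Omega>" for h
      using f g that by (simp add: L2_inner_add_left L2_scale L2_inner_scale_left)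
    have "L2_inner \<Omega> f ?h = s * A + t * B" "L2_inner \<Omega> g ?h = s * B + t * C"
      unfolding L2_inner_commute[of \<Omega> f ?h] L2_inner_commute[of \<Omega> g ?h]
      using *[OF f] *[OF g] by (simp_all add: A_def B_def C_def L2_inner_commute[of \<Omega> g f])
    then show ?thesis
      unfolding *[OF L2_add[OF L2_scale[OF f] L2_scale[OF g]]]
      by (simp add: power2_eq_square algebra_simps)
  qed
  have pos: "0 \<le> s\<^sup>2 * A + 2 * s * t * B + t\<^sup>2 * C" for s t
    unfolding exp[symmetric] by (rule L2_inner_self_nonneg)
  have C0: "0 \<le> C" unfolding C_def by (rule L2_inner_self_nonneg)
  have "B\<^sup>2 \<le> A * C"
  proof (cases "C = 0")
    case True
    have "B = 0"
    proof (rule ccontr)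
      assume "B \<noteq> 0"
      \<comment> \<open>With \<open>C = 0\<close> the form is affine in \<open>t\<close>, and this
        \<open>t\<close> gives it the value -1.\<close>
      then show False using pos[of 1 "- (A + 1) / (2 * B)"] True by (simp add: field_simps)
    qed
    then show ?thesis using True by simp
  next
    case False
    then have "0 < C" using C0 by simp
    moreover have "0 \<le> C * (A * C - B\<^sup>2)"
      using pos[of C "-B"] by (simp add: power2_eq_square algebra_simps)
    ultimately show ?thesis by (simp add: zero_le_mult_iff)
  qed
  then have "sqrt (B\<^sup>2) \<le> sqrt (A * C)" by (rule real_sqrt_le_mono)
  then show ?thesis by (simp add: L2_norm_def A_def B_def C_def real_sqrt_mult)
qed

lemma L2_norm_triangle:
  assumes f: "f \<in> L2 \<Omega>" and g: "g \<in> L2 \<Omega>"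
  shows "L2_norm \<Omega> (\<lambda>x. f x + g x) \<le> L2_norm \<Omega> f + L2_norm \<Omega> g"
proof (rule power2_le_imp_le)
  have "(L2_norm \<Omega> (\<lambda>x. f x + g x))\<^sup>2 = (L2_norm \<Omega> f)\<^sup>2 + 2 * L2_inner \<Omega> f g + (L2_norm \<Omega> g)\<^sup>2"
    unfolding L2_norm_power2 L2_inner_add_left[OF f g L2_add[OF f g]]
      L2_inner_commute[of \<Omega> f "\<lambda>x. f x + g x"] L2_inner_commute[of \<Omega> g "\<lambda>x. f x + g x"]
    using L2_inner_add_left[OF f g f] L2_inner_add_left[OF f g g] L2_inner_commute[of \<Omega> g f] by simp
  also have "\<dots> \<le> (L2_norm \<Omega> f + L2_norm \<Omega> g)\<^sup>2"
    using L2_Cauchy_Schwarz[OF f g] by (simp add: power2_sum)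
  finally show "(L2_norm \<Omega> (\<lambda>x. f x + g x))\<^sup>2 \<le> (L2_norm \<Omega> f + L2_norm \<Omega> g)\<^sup>2" .
qed simp

lemma L2_norm_triangle_diff:
  assumes "f \<in> L2 \<Omega>" "g \<in> L2 \<Omega>" "h \<in> L2 \<Omega>"
  shows "L2_norm \<Omega> (\<lambda>x. f x - h x) \<le> L2_norm \<Omega> (\<lambda>x. f x - g x) + L2_norm \<Omega> (\<lambda>x. g x - h x)"
  using L2_norm_triangle[OF L2_diff[OF assms(1,2)] L2_diff[OF assms(2,3)]] by simp

lemma L2_norm_minus_commute: "L2_norm \<Omega> (\<lambda>x. f x - g x) = L2_norm \<Omega> (\<lambda>x. g x - f x)"
  unfolding L2_norm_def L2_inner_def by (simp add: algebra_simps)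

lemma L2_tendsto_inner:
  assumes "L2_tendsto \<Omega> f g" "\<And>n. f n \<in> L2 \<Omega>" "g \<in> L2 \<Omega>" "h \<in> L2 \<Omega>"
  shows "(\<lambda>n. L2_inner \<Omega> (f n) h) \<longlonglongrightarrow> L2_inner \<Omega> g h"
proof (rule LIM_zero_cancel, rule Lim_null_comparison)
  show "\<forall>\<^sub>F n in sequentially. norm (L2_inner \<Omega> (f n) h - L2_inner \<Omega> g h)
      \<le> L2_norm \<Omega> (\<lambda>x. f n x - g x) * L2_norm \<Omega> h"
    using L2_Cauchy_Schwarz[OF L2_diff assms(4)] assms by (simp add: L2_inner_diff_left)
  show "(\<lambda>n. L2_norm \<Omega> (\<lambda>x. f n x - g x) * L2_norm \<Omega> h) \<longlonglongrightarrow> 0"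
    using assms(1) unfolding L2_tendsto_iff_norm by (rule tendsto_mult_left_zero)
qed

lemma L2_tendsto_unique:
  assumes "L2_tendsto \<Omega> f g" "L2_tendsto \<Omega> f h" "\<And>n. f n \<in> L2 \<Omega>" "g \<in> L2 \<Omega>" "h \<in> L2 \<Omega>"
  shows "AE x in lebesgue_on \<Omega>. g x = h x"
proof -
  have "(\<lambda>n. L2_norm \<Omega> (\<lambda>x. f n x - g x) + L2_norm \<Omega> (\<lambda>x. f n x - h x)) \<longlonglongrightarrow> 0 + 0"
    using assms(1,2) unfolding L2_tendsto_iff_norm by (rule tendsto_add)
  moreover have "L2_norm \<Omega> (\<lambda>x. g x - h x) \<le> L2_norm \<Omega> (\<lambda>x. f n x - g x) + L2_norm \<Omega> (\<lambda>x. f n x - h x)" for n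
    using L2_norm_triangle_diff[OF assms(4,3,5), of n] L2_norm_minus_commute[of \<Omega> g] by simp
  ultimately have "L2_norm \<Omega> (\<lambda>x. g x - h x) \<le> 0 + 0"
    by (intro LIMSEQ_le_const) auto
  then have "L2_norm \<Omega> (\<lambda>x. g x - h x) = 0" using L2_norm_nonneg[of \<Omega> "\<lambda>x. g x - h x"] by linarith
  from L2_norm_eq_0D[OF this L2_diff[OF assms(4,5)]] show ?thesis by simp
qed

text \<open>Riesz-Fischer. On a domain of finite measure, Cauchy-Schwarz against the constant 1
  bounds L1 norms by L2 norms, so a rapidly converging subsequence has summable increments almost
  everywhere. Fatou's lemma then carries the L2 estimates over to the pointwise limit.\<close>

lemma L2_complete:
  assumes fin: "\<Omega> \<in> lmeasurable"
    and f: "\<And>n. f n \<in> L2 \<Omega>"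
    and cauchy: "\<And>e. 0 < e \<Longrightarrow> \<exists>N. \<forall>m\<ge>N. \<forall>n\<ge>N. L2_norm \<Omega> (\<lambda>x. f m x - f n x) < e"
  shows "\<exists>g\<in>L2 \<Omega>. L2_tendsto \<Omega> f g"
proof -
  let ?M = "lebesgue_on \<Omega>"
  have one: "(\<lambda>x. 1) \<in> L2 \<Omega>"
    unfolding L2_def using fin by (auto simp: integrable_restrict_space fmeasurable_def emeasure_restrict_space)
  \<comment> \<open>From index \<open>r k\<close> on, all mutual distances are below
    \<open>(1/2) ^ k\<close>. Each choice is forced to be larger than the previous one, so that
    \<open>r\<close> selects a subsequence.\<close>
  define r :: "nat \<Rightarrow> nat" where "r = rec_nat
    (SOME N. \<forall>m\<ge>N. \<forall>n\<ge>N. L2_norm \<Omega> (\<lambda>x. f m x - f n x) < 1)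
    (\<lambda>k N0. SOME N. N0 < N \<and> (\<forall>m\<ge>N. \<forall>n\<ge>N. L2_norm \<Omega> (\<lambda>x. f m x - f n x) < (1/2) ^ Suc k))"
  have r0: "\<forall>m\<ge>r 0. \<forall>n\<ge>r 0. L2_norm \<Omega> (\<lambda>x. f m x - f n x) < 1"
    unfolding r_def using someI_ex[OF cauchy[of 1]] by simp
  have rS: "r k < r (Suc k) \<and> (\<forall>m\<ge>r (Suc k). \<forall>n\<ge>r (Suc k). L2_norm \<Omega> (\<lambda>x. f m x - f n x) < (1/2) ^ Suc k)" for k
  proof -
    obtain N where N: "\<forall>m\<ge>N. \<forall>n\<ge>N. L2_norm \<Omega> (\<lambda>x. f m x - f n x) < (1/2) ^ Suc k"
      using cauchy[of "(1/2) ^ Suc k"] by auto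
    then have "\<exists>N. r k < N \<and> (\<forall>m\<ge>N. \<forall>n\<ge>N. L2_norm \<Omega> (\<lambda>x. f m x - f n x) < (1/2) ^ Suc k)"
      by (intro exI[of _ "max N (Suc (r k))"]) auto
    from someI_ex[OF this] show ?thesis unfolding r_def by simp
  qed
  have r: "L2_norm \<Omega> (\<lambda>x. f m x - f n x) < (1/2) ^ k" if "r k \<le> m" "r k \<le> n" for k m n
    using r0 rS that by (cases k) auto
  have mono: "strict_mono r" using rS by (simp add: strict_mono_Suc_iff)
  define h where "h k x = f (r (Suc k)) x - f (r k) x" for k x
  have h: "h k \<in> L2 \<Omega>" for k unfolding h_def using f by (intro L2_diff)
  have hm [measurable]: "h k \<in> borel_measurable ?M" for k using h by (rule L2_measurable)
  have fm [measurable]: "f k \<in> borel_measurable ?M" for k using f by (rule L2_measurable)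
  have hint: "integrable ?M (\<lambda>x. \<bar>h k x\<bar>)" for k
    using L2_mult_integrable[OF h one, of k] by simp
  have absL2: "(\<lambda>x. \<bar>h k x\<bar>) \<in> L2 \<Omega>" for k using h[of k] by (simp add: L2_def)
  have hbound: "(\<integral>x. \<bar>h k x\<bar> \<partial>?M) \<le> (1/2) ^ k * L2_norm \<Omega> (\<lambda>x. 1)" for k
  proof -
    have "(\<integral>x. \<bar>h k x\<bar> \<partial>?M) = L2_inner \<Omega> (\<lambda>x. \<bar>h k x\<bar>) (\<lambda>x. 1)" by (simp add: L2_inner_def)
    also have "\<dots> \<le> L2_norm \<Omega> (\<lambda>x. \<bar>h k x\<bar>) * L2_norm \<Omega> (\<lambda>x. 1)"
      using L2_Cauchy_Schwarz[OF absL2 one, of k] by simp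
    also have "L2_norm \<Omega> (\<lambda>x. \<bar>h k x\<bar>) = L2_norm \<Omega> (h k)"
      by (simp add: L2_norm_def L2_inner_def)
    also have "L2_norm \<Omega> (h k) \<le> (1/2) ^ k"
      unfolding h_def using r[of k "r (Suc k)" "r k"] mono by (simp add: less_imp_le strict_mono_less_eq)
    finally show ?thesis by (simp add: mult_right_mono)
  qed
  have "summable (\<lambda>k. \<integral>x. \<bar>h k x\<bar> \<partial>?M)"
  proof (rule summable_comparison_test')
    show "summable (\<lambda>k. (1/2) ^ k * L2_norm \<Omega> (\<lambda>x. 1))"
      by (intro summable_mult2 summable_geometric) auto
  qed (use hbound in auto)
  then have "(\<Sum>k. ennreal (\<integral>x. \<bar>h k x\<bar> \<partial>?M)) \<noteq> Orderings.top"
    by (intro ennreal_suminf_neq_top) auto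
  moreover have "(\<integral>\<^sup>+x. (\<Sum>k. ennreal \<bar>h k x\<bar>) \<partial>?M) = (\<Sum>k. ennreal (\<integral>x. \<bar>h k x\<bar> \<partial>?M))"
  proof -
    have "(\<integral>\<^sup>+x. ennreal \<bar>h k x\<bar> \<partial>?M) = ennreal (\<integral>x. \<bar>h k x\<bar> \<partial>?M)" for k
      by (rule nn_integral_eq_integral[OF hint]) auto
    then show ?thesis by (simp add: nn_integral_suminf)
  qed
  ultimately have "AE x in ?M. (\<Sum>k. ennreal \<bar>h k x\<bar>) \<noteq> \<infinity>"
    by (intro nn_integral_PInf_AE) auto
  then have summ: "AE x in ?M. summable (\<lambda>k. h k x)"
  proof eventually_elim
    case (elim x)
    have "summable (\<lambda>k. \<bar>h k x\<bar>)" using elim by (intro summable_suminf_not_top) auto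
    then show ?case by (rule summable_rabs_cancel)
  qed
  \<comment> \<open>The limit of the subsequence, written as a telescoping series. Where the series
    diverges its sum is an unspecified value, but only on a null set.\<close>
  define g where "g x = f (r 0) x + (\<Sum>k. h k x)" for x
  have gm [measurable]: "g \<in> borel_measurable ?M"
    unfolding g_def by measurable
  have conv: "AE x in ?M. (\<lambda>k. f (r k) x) \<longlonglongrightarrow> g x"
    using summ
  proof eventually_elim
    case (elim x)
    then have "(\<lambda>k. f (r 0) x + (\<Sum>i<k. h i x)) \<longlonglongrightarrow> g x"
      unfolding g_def by (intro tendsto_add tendsto_const summable_LIMSEQ)
    moreover have "f (r 0) x + (\<Sum>i<k. h i x) = f (r k) x" for k
      unfolding h_def by (subst sum_lessThan_telescope) simp
    ultimately show ?case by simp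
  qed
  \<comment> \<open>Fatou's lemma for \<open>f n - f (r i)\<close> as \<open>i\<close> grows, with
    \<open>n\<close> fixed. Membership of the difference in \<open>L2\<close> comes out of the same
    estimate, and that of \<open>g\<close> follows from it.\<close>
  have key: "(\<lambda>x. f n x - g x) \<in> L2 \<Omega> \<and> L2_norm \<Omega> (\<lambda>x. f n x - g x) \<le> (1/2) ^ k" if n: "r k \<le> n" for n k
  proof -
    have "(\<integral>\<^sup>+x. ennreal ((f n x - g x)\<^sup>2) \<partial>?M) = (\<integral>\<^sup>+x. liminf (\<lambda>i. ennreal ((f n x - f (r i) x)\<^sup>2)) \<partial>?M)"
    proof (rule nn_integral_cong_AE)
      show "AE x in ?M. ennreal ((f n x - g x)\<^sup>2) = liminf (\<lambda>i. ennreal ((f n x - f (r i) x)\<^sup>2))"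
        using conv
      proof eventually_elim
        case (elim x)
        then have "(\<lambda>i. ennreal ((f n x - f (r i) x)\<^sup>2)) \<longlonglongrightarrow> ennreal ((f n x - g x)\<^sup>2)"
          by (intro tendsto_ennrealI tendsto_intros)
        then show ?case by (rule lim_imp_Liminf[OF trivial_limit_sequentially, symmetric])
      qed
    qed
    also have "\<dots> \<le> liminf (\<lambda>i. \<integral>\<^sup>+x. ennreal ((f n x - f (r i) x)\<^sup>2) \<partial>?M)"
      by (rule nn_integral_liminf) measurable
    also have "\<dots> \<le> liminf (\<lambda>i. ennreal (((1/2) ^ k)\<^sup>2))"
    proof (rule Liminf_mono)
      show "\<forall>\<^sub>F i in sequentially. (\<integral>\<^sup>+x. ennreal ((f n x - f (r i) x)\<^sup>2) \<partial>?M) \<le> ennreal (((1/2) ^ k)\<^sup>2)"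
        using eventually_ge_at_top[of k]
      proof eventually_elim
        case (elim i)
        then have ri: "r k \<le> r i" using mono by (simp add: strict_mono_less_eq)
        have "integrable ?M (\<lambda>x. (f n x - f (r i) x)\<^sup>2)"
          using L2_diff[OF f f, of n "r i"] by (simp add: L2_def)
        then have "(\<integral>\<^sup>+x. ennreal ((f n x - f (r i) x)\<^sup>2) \<partial>?M) = ennreal (\<integral>x. (f n x - f (r i) x)\<^sup>2 \<partial>?M)"
          by (intro nn_integral_eq_integral) auto
        also have "(\<integral>x. (f n x - f (r i) x)\<^sup>2 \<partial>?M) = (L2_norm \<Omega> (\<lambda>x. f n x - f (r i) x))\<^sup>2"
          unfolding L2_norm_power2 L2_inner_def by (simp add: power2_eq_square)
        also have "ennreal \<dots> \<le> ennreal (((1/2) ^ k)\<^sup>2)"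
          using r[OF n ri] by (intro ennreal_leI power_mono) auto
        finally show ?case .
      qed
    qed
    also have "\<dots> = ennreal (((1/2) ^ k)\<^sup>2)" by (intro lim_imp_Liminf) auto
    finally have le: "(\<integral>\<^sup>+x. ennreal ((f n x - g x)\<^sup>2) \<partial>?M) \<le> ennreal (((1/2) ^ k)\<^sup>2)" .
    have int: "integrable ?M (\<lambda>x. (f n x - g x)\<^sup>2)"
      using le by (intro integrableI_bounded) (auto simp: le_less_trans)
    have "(\<integral>x. (f n x - g x)\<^sup>2 \<partial>?M) \<le> ((1/2) ^ k)\<^sup>2"
      using le by (subst (asm) nn_integral_eq_integral[OF int]) auto
    then have "(L2_norm \<Omega> (\<lambda>x. f n x - g x))\<^sup>2 \<le> ((1/2) ^ k)\<^sup>2"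
      unfolding L2_norm_power2 L2_inner_def by (simp add: power2_eq_square)
    then have "L2_norm \<Omega> (\<lambda>x. f n x - g x) \<le> (1/2) ^ k"
      by (rule power2_le_imp_le) simp
    then show ?thesis using int by (simp add: L2_def)
  qed
  have "(\<lambda>x. f (r 0) x - (f (r 0) x - g x)) \<in> L2 \<Omega>"
    by (rule L2_diff[OF f]) (use key[of 0 "r 0"] in simp)
  then have gL2: "g \<in> L2 \<Omega>" by simp
  have "L2_tendsto \<Omega> f g"
    unfolding L2_tendsto_iff_norm
  proof (rule LIMSEQ_I)
    fix e :: real assume "0 < e"
    then obtain k where k: "(1/2) ^ k < e" using real_arch_pow_inv[of e "1/2"] by auto
    then have "norm (L2_norm \<Omega> (\<lambda>x. f n x - g x) - 0) < e" if "r k \<le> n" for n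
      using key[OF that] by auto
    then show "\<exists>N. \<forall>n\<ge>N. norm (L2_norm \<Omega> (\<lambda>x. f n x - g x) - 0) < e" by blast
  qed
  then show ?thesis using gL2 by blast
qed

lemma L2_tendsto_Cauchy:
  assumes "L2_tendsto \<Omega> f g" "\<And>n. f n \<in> L2 \<Omega>" "g \<in> L2 \<Omega>" "0 < e"
  shows "\<exists>N. \<forall>m\<ge>N. \<forall>n\<ge>N. L2_norm \<Omega> (\<lambda>x. f m x - f n x) < e"
proof -
  have "\<forall>\<^sub>F n in sequentially. L2_norm \<Omega> (\<lambda>x. f n x - g x) < e / 2"
    using assms unfolding L2_tendsto_iff_norm by (intro order_tendstoD(2)) auto
  then obtain N where N: "\<And>n. n \<ge> N \<Longrightarrow> L2_norm \<Omega> (\<lambda>x. f n x - g x) < e / 2"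
    unfolding eventually_sequentially by blast
  have "L2_norm \<Omega> (\<lambda>x. f m x - f n x) < e" if "m \<ge> N" "n \<ge> N" for m n
    using N[OF that(1)] N[OF that(2)] L2_norm_triangle_diff[OF assms(2,3,2), of m n]
      L2_norm_minus_commute[of \<Omega> g "f n"] by linarith
  then show ?thesis by blast
qed

section \<open>Orthonormal expansions\<close>

context
  fixes \<Omega> :: "'a::euclidean_space set" and \<psi> :: "nat \<Rightarrow> 'a \<Rightarrow> real"
  assumes basis: "L2_orthonormal_basis \<Omega> \<psi>"
begin

lemma basis_L2: "\<psi> n \<in> L2 \<Omega>"
  using basis by (simp add: L2_orthonormal_basis_def)

lemma basis_orthonormal: "L2_inner \<Omega> (\<psi> i) (\<psi> j) = (if i = j then 1 else 0)"
  using basis by (simp add: L2_orthonormal_basis_def)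

lemma basis_comb_L2: "(\<lambda>x. \<Sum>n\<in>I. \<beta> n * \<psi> n x) \<in> L2 \<Omega>"
  by (intro L2_sum L2_scale basis_L2)

lemma basis_comb_inner:
  assumes "finite I"
  shows "L2_inner \<Omega> (\<lambda>x. \<Sum>n\<in>I. \<beta> n * \<psi> n x) (\<psi> k) = (if k \<in> I then \<beta> k else 0)"
  using assms
  by (subst L2_inner_sum_left)
    (auto simp: L2_scale basis_L2 L2_inner_scale_left basis_orthonormal if_distrib cong: if_cong)

lemma basis_comb_inner_right:
  assumes "finite I" "f \<in> L2 \<Omega>"
  shows "L2_inner \<Omega> f (\<lambda>x. \<Sum>n\<in>I. \<beta> n * \<psi> n x) = (\<Sum>n\<in>I. \<beta> n * L2_inner \<Omega> f (\<psi> n))"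
  unfolding L2_inner_commute[of \<Omega> f "\<lambda>x. \<Sum>n\<in>I. \<beta> n * \<psi> n x"] L2_inner_commute[of \<Omega> f "\<psi> _"]
  by (subst L2_inner_sum_left) (auto simp: assms L2_scale basis_L2 L2_inner_scale_left)

lemma basis_comb_norm:
  assumes "finite I"
  shows "(L2_norm \<Omega> (\<lambda>x. \<Sum>n\<in>I. \<beta> n * \<psi> n x))\<^sup>2 = (\<Sum>n\<in>I. (\<beta> n)\<^sup>2)"
  unfolding L2_norm_power2
  using basis_comb_inner_right[OF assms basis_comb_L2, of \<beta> I \<beta>] basis_comb_inner[OF assms]
  by (simp add: power2_eq_square)

text \<open>The basis property provides some coefficients; they are the Fourier coefficients, since
  the inner product of a partial sum with \<open>\<psi> k\<close> is constantly
  \<open>\<beta> k\<close> once \<open>k < N\<close>, and inner products pass to the L2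
  limit.\<close>

lemma basis_coefficients:
  assumes "L2_tendsto \<Omega> (\<lambda>N x. \<Sum>n<N. \<beta> n * \<psi> n x) f" "f \<in> L2 \<Omega>"
  shows "L2_inner \<Omega> f (\<psi> k) = \<beta> k"
proof (rule LIMSEQ_unique)
  show "(\<lambda>N. L2_inner \<Omega> (\<lambda>x. \<Sum>n<N. \<beta> n * \<psi> n x) (\<psi> k)) \<longlonglongrightarrow> L2_inner \<Omega> f (\<psi> k)"
    by (rule L2_tendsto_inner[OF assms(1) basis_comb_L2 assms(2) basis_L2])
  show "(\<lambda>N. L2_inner \<Omega> (\<lambda>x. \<Sum>n<N. \<beta> n * \<psi> n x) (\<psi> k)) \<longlonglongrightarrow> \<beta> k"
    by (rule tendsto_eventually)
      (use eventually_gt_at_top[of k] in \<open>eventually_elim, simp add: basis_comb_inner\<close>)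
qed

lemma basis_expansion:
  assumes "f \<in> L2 \<Omega>"
  shows "L2_tendsto \<Omega> (\<lambda>N x. \<Sum>n<N. L2_inner \<Omega> f (\<psi> n) * \<psi> n x) f"
proof -
  obtain \<beta> where \<beta>: "L2_tendsto \<Omega> (\<lambda>N x. \<Sum>n<N. \<beta> n * \<psi> n x) f"
    using basis assms unfolding L2_orthonormal_basis_def by blast
  then show ?thesis using basis_coefficients[OF \<beta> assms] by simp
qed

text \<open>Both functions are L2 limits of the same partial sums. This is how identities between L2
  functions are reduced to identities between numbers.\<close>

lemma basis_coefficients_eq_imp_AE_eq:
  assumes "f \<in> L2 \<Omega>" "g \<in> L2 \<Omega>" "\<And>n. L2_inner \<Omega> f (\<psi> n) = L2_inner \<Omega> g (\<psi> n)"
  shows "AE x in lebesgue_on \<Omega>. f x = g x"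
  using L2_tendsto_unique[OF basis_expansion[OF assms(1)] _ basis_comb_L2 assms(1,2)]
    basis_expansion[OF assms(2)] assms(3) by simp

text \<open>Bessel's inequality. With the partial sum \<open>?s\<close> of \<open>f\<close>, the
  number \<open>?S\<close> is both the inner product of \<open>f\<close> with \<open>?s\<close> and
  the squared norm of \<open>?s\<close>, so Cauchy-Schwarz bounds it by the norm of \<open>f\<close>
  times its own square root, which cancels.\<close>

lemma bessel_summable:
  assumes f: "f \<in> L2 \<Omega>"
  shows "summable (\<lambda>n. (L2_inner \<Omega> f (\<psi> n))\<^sup>2)"
proof (rule bounded_imp_summable)
  fix N
  let ?s = "\<lambda>x. \<Sum>n\<le>N. L2_inner \<Omega> f (\<psi> n) * \<psi> n x"
  let ?S = "\<Sum>n\<le>N. (L2_inner \<Omega> f (\<psi> n))\<^sup>2"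
  have s: "?s \<in> L2 \<Omega>" by (rule basis_comb_L2)
  have inner: "L2_inner \<Omega> f ?s = ?S"
    by (subst basis_comb_inner_right) (auto simp: f power2_eq_square)
  have norm: "L2_norm \<Omega> ?s = sqrt ?S"
    by (rule real_sqrt_unique[OF basis_comb_norm L2_norm_nonneg, symmetric]) simp
  have "?S \<le> L2_norm \<Omega> f * sqrt ?S"
    using L2_Cauchy_Schwarz[OF f s] unfolding inner norm by linarith
  then have *: "sqrt ?S * sqrt ?S \<le> L2_norm \<Omega> f * sqrt ?S" by (simp add: sum_nonneg)
  have "sqrt ?S \<le> L2_norm \<Omega> f"
  proof (cases "sqrt ?S = 0")
    case False
    then have "0 < sqrt ?S" by (simp add: sum_nonneg less_le)
    then show ?thesis using * by (simp only: mult_le_cancel_right_pos)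
  qed (simp only: L2_norm_nonneg)
  then show "?S \<le> (L2_norm \<Omega> f)\<^sup>2"
    using real_le_lsqrt sqrt_le_D by blast
qed simp

text \<open>By Pythagoras, the Cauchy criterion for the series of squares is the Cauchy criterion in
  L2 for the partial sums.\<close>

lemma basis_synthesis:
  assumes fin: "\<Omega> \<in> lmeasurable" and \<beta>: "summable (\<lambda>n. (\<beta> n)\<^sup>2)"
  shows "\<exists>f\<in>L2 \<Omega>. L2_tendsto \<Omega> (\<lambda>N x. \<Sum>n<N. \<beta> n * \<psi> n x) f"
proof (rule L2_complete[OF fin basis_comb_L2])
  fix e :: real assume e: "0 < e"
  obtain N where N: "\<And>m n. N \<le> m \<Longrightarrow> norm (\<Sum>i=m..<n. (\<beta> i)\<^sup>2) < e\<^sup>2"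
    using \<beta> e unfolding summable_Cauchy by (metis zero_less_power)
  have *: "L2_norm \<Omega> (\<lambda>x. (\<Sum>i<n. \<beta> i * \<psi> i x) - (\<Sum>i<m. \<beta> i * \<psi> i x)) < e" if "N \<le> m" "m \<le> n" for m n
  proof -
    have "(\<lambda>x. (\<Sum>i<n. \<beta> i * \<psi> i x) - (\<Sum>i<m. \<beta> i * \<psi> i x)) = (\<lambda>x. \<Sum>i=m..<n. \<beta> i * \<psi> i x)"
      using that by (auto simp: lessThan_atLeast0 sum_diff_nat_ivl)
    then have "(L2_norm \<Omega> (\<lambda>x. (\<Sum>i<n. \<beta> i * \<psi> i x) - (\<Sum>i<m. \<beta> i * \<psi> i x)))\<^sup>2 < e\<^sup>2"
      using N[OF that(1), of n] basis_comb_norm[of "{m..<n}" \<beta>] by simp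
    then show ?thesis by (rule power2_less_imp_less) (use e in simp)
  qed
  have "L2_norm \<Omega> (\<lambda>x. (\<Sum>i<n. \<beta> i * \<psi> i x) - (\<Sum>i<m. \<beta> i * \<psi> i x)) < e" if "N \<le> m" "N \<le> n" for m n
  proof (cases "m \<le> n")
    case True
    then show ?thesis using * that by auto
  next
    case False
    then show ?thesis using *[of n m] that by (subst L2_norm_minus_commute) auto
  qed
  then show "\<exists>N. \<forall>m\<ge>N. \<forall>n\<ge>N. L2_norm \<Omega> (\<lambda>x. (\<Sum>i<m. \<beta> i * \<psi> i x) - (\<Sum>i<n. \<beta> i * \<psi> i x)) < e"
    by blast
qed

end

section \<open>The weak form of the elliptic operator\<close>

lemma L2_tendsto_lincomb:
  assumes "L2_tendsto \<Omega> f f'" "L2_tendsto \<Omega> g g'"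
    and "\<And>n. f n \<in> L2 \<Omega>" "f' \<in> L2 \<Omega>" "\<And>n. g n \<in> L2 \<Omega>" "g' \<in> L2 \<Omega>"
  shows "L2_tendsto \<Omega> (\<lambda>n x. r * f n x + s * g n x) (\<lambda>x. r * f' x + s * g' x)"
proof -
  have scale: "L2_norm \<Omega> (\<lambda>x. q * h x) = \<bar>q\<bar> * L2_norm \<Omega> h" for q h
    unfolding L2_norm_def
    by (simp add: L2_inner_scale_left L2_inner_commute[of \<Omega> h "\<lambda>x. q * h x"] real_sqrt_mult mult.assoc[symmetric])
  let ?d = "\<lambda>n. L2_norm \<Omega> (\<lambda>x. (r * f n x + s * g n x) - (r * f' x + s * g' x))"
  let ?e = "\<lambda>n. \<bar>r\<bar> * L2_norm \<Omega> (\<lambda>x. f n x - f' x) + \<bar>s\<bar> * L2_norm \<Omega> (\<lambda>x. g n x - g' x)"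
  have le: "?d n \<le> ?e n" for n
  proof -
    have "(\<lambda>x. (r * f n x + s * g n x) - (r * f' x + s * g' x)) =
        (\<lambda>x. r * (f n x - f' x) + s * (g n x - g' x))"
      by (simp add: algebra_simps)
    then show ?thesis
      using L2_norm_triangle[OF L2_scale[OF L2_diff[OF assms(3,4)]] L2_scale[OF L2_diff[OF assms(5,6)]], of r n s n]
      by (simp only: scale)
  qed
  have "?e \<longlonglongrightarrow> \<bar>r\<bar> * 0 + \<bar>s\<bar> * 0"
    using assms(1,2) unfolding L2_tendsto_iff_norm by (intro tendsto_intros)
  then have lim: "?e \<longlonglongrightarrow> 0" by simp
  show ?thesis
    unfolding L2_tendsto_iff_norm
  proof (rule Lim_null_comparison[OF _ lim])
    show "\<forall>\<^sub>F n in sequentially. norm (?d n) \<le> ?e n"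
      unfolding real_norm_def abs_of_nonneg[OF L2_norm_nonneg] using le by (rule always_eventually[OF allI])
  qed
qed

lemma partial_lincomb:
  assumes "\<And>x. f differentiable (at x)" "\<And>x. g differentiable (at x)"
  shows "partial k (\<lambda>x. r * f x + s * g x) x = r * partial k f x + s * partial k g x"
proof -
  have "(f has_derivative frechet_derivative f (at x)) (at x)"
    "(g has_derivative frechet_derivative g (at x)) (at x)"
    using assms by (auto simp: frechet_derivative_works[symmetric])
  then have "((\<lambda>x. r * f x + s * g x) has_derivative
      (\<lambda>h. r * frechet_derivative f (at x) h + s * frechet_derivative g (at x) h)) (at x)"
    by (intro derivative_intros)
  from frechet_derivative_at[OF this] show ?thesis by metis
qed

lemma C_k_lincomb:
  assumes "C_k n f" "C_k n g"
  shows "C_k n (\<lambda>x. r * f x + s * g x)"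
  using assms
proof (induction n arbitrary: f g)
  case 0
  then show ?case by (auto intro!: continuous_intros)
next
  case (Suc n)
  have "partial k (\<lambda>x. r * f x + s * g x) = (\<lambda>x. r * partial k f x + s * partial k g x)" for k
    using Suc.prems by (intro ext partial_lincomb) auto
  moreover have "(\<lambda>x. r * f x + s * g x) differentiable (at x)" for x
    using Suc.prems by (intro derivative_intros) auto
  ultimately show ?case using Suc by auto
qed

lemma C_k_zero: "C_k n (\<lambda>x. 0)"
  by (induction n) (auto simp: frechet_derivative_const)

lemma test_functions_zero: "(\<lambda>x. 0) \<in> test_functions \<Omega>"
  by (simp add: test_functions_def C_k_zero)

lemma test_functions_lincomb:
  assumes "f \<in> test_functions \<Omega>" "g \<in> test_functions \<Omega>"
  shows "(\<lambda>x. r * f x + s * g x) \<in> test_functions \<Omega>"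
proof -
  let ?S = "\<lambda>f. closure {x. f x \<noteq> (0::real)}"
  have "?S (\<lambda>x. r * f x + s * g x) \<subseteq> ?S f \<union> ?S g"
    unfolding closure_Un[symmetric] by (rule closure_mono) auto
  moreover have "compact (?S f \<union> ?S g)" "?S f \<union> ?S g \<subseteq> \<Omega>"
    using assms by (auto simp: test_functions_def)
  moreover from this have "compact (?S (\<lambda>x. r * f x + s * g x) \<inter> (?S f \<union> ?S g))"
    by (intro closed_Int_compact closed_closure)
  ultimately have "compact (?S (\<lambda>x. r * f x + s * g x))" "?S (\<lambda>x. r * f x + s * g x) \<subseteq> \<Omega>"
    by (simp_all only: Int_absorb2 subset_trans)
  then show ?thesis using assms unfolding test_functions_def by (blast intro: C_k_lincomb)
qed

lemma test_functions_differentiable: "\<phi> \<in> test_functions \<Omega> \<Longrightarrow> \<phi> differentiable (at x)"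
  using C_k.simps(2)[of 0 \<phi>] by (auto simp: test_functions_def simp del: C_k.simps)

locale elliptic_coefficients =
  fixes \<Omega> :: "'a::euclidean_space set" and a b :: "'a \<Rightarrow> 'a \<Rightarrow> real" and c :: "'a \<Rightarrow> real"
  assumes open_dom: "open \<Omega>" and bounded_dom: "bounded \<Omega>"
    and coeffs: "admissible_coefficients \<Omega> a b c"
begin

lemma dom_lmeasurable: "\<Omega> \<in> lmeasurable"
  using open_dom bounded_dom by (rule lmeasurable_open[rotated])

lemma continuous_bounded_dom:
  fixes h :: "'a \<Rightarrow> real"
  assumes "continuous_on (closure \<Omega>) h"
  shows "\<exists>C. \<forall>x\<in>\<Omega>. \<bar>h x\<bar> \<le> C"
proof -
  have "compact (h ` closure \<Omega>)"
    using assms bounded_dom by (intro compact_continuous_image) auto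
  then obtain C where "\<forall>y\<in>h ` closure \<Omega>. norm y \<le> C"
    using compact_imp_bounded bounded_iff by blast
  then show ?thesis using closure_subset by force
qed

lemma continuous_measurable_dom:
  fixes h :: "'a \<Rightarrow> real"
  assumes "continuous_on (closure \<Omega>) h"
  shows "h \<in> borel_measurable (lebesgue_on \<Omega>)"
  using continuous_on_subset[OF assms closure_subset] open_dom
  by (intro continuous_imp_measurable_on_sets_lebesgue) auto

lemma L2_continuous_mult:
  assumes "continuous_on (closure \<Omega>) h" "f \<in> L2 \<Omega>"
  shows "(\<lambda>x. h x * f x) \<in> L2 \<Omega>"
  using continuous_bounded_dom[OF assms(1)] L2_bounded_mult[OF assms(2) continuous_measurable_dom[OF assms(1)]]
  by blast

lemma one_L2: "(\<lambda>x. 1) \<in> L2 \<Omega>"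
  unfolding L2_def using dom_lmeasurable
  by (auto simp: integrable_restrict_space fmeasurable_def emeasure_restrict_space)

lemma continuous_L2: "continuous_on UNIV h \<Longrightarrow> h \<in> L2 \<Omega>"
  using L2_continuous_mult[OF _ one_L2, of h] continuous_on_subset[of UNIV h] by simp

lemma test_function_L2: "\<phi> \<in> test_functions \<Omega> \<Longrightarrow> \<phi> \<in> L2 \<Omega>"
  using C_k.simps(1)[of \<phi>] by (auto simp: test_functions_def continuous_L2 simp del: C_k.simps)

lemma test_function_partial_L2:
  assumes "\<phi> \<in> test_functions \<Omega>" "k \<in> Basis"
  shows "partial k \<phi> \<in> L2 \<Omega>"
proof -
  have "C_k (Suc 0) \<phi>" using assms by (simp only: test_functions_def mem_Collect_eq)
  then have "continuous_on UNIV (partial k \<phi>)" using assms by auto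
  then show ?thesis by (rule continuous_L2)
qed

lemma a_cont: "k \<in> Basis \<Longrightarrow> continuous_on (closure \<Omega>) (a k)"
  and b_cont: "k \<in> Basis \<Longrightarrow> continuous_on (closure \<Omega>) (b k)"
  and c_cont: "continuous_on (closure \<Omega>) c"
  using coeffs by (auto simp: admissible_coefficients_def C1_closure_def)

text \<open>Ellipticity is uniform because \<open>1 / a k\<close> is continuous on the compact
  closure. One constant for all coefficients lets the constants of the Garding inequality be written
  in terms of \<open>B\<close> alone.\<close>

lemma coefficient_bounds:
  "\<exists>B>0. (\<forall>k\<in>Basis. \<forall>x\<in>\<Omega>. 1 / B \<le> a k x \<and> \<bar>b k x\<bar> \<le> B) \<and> (\<forall>x\<in>\<Omega>. \<bar>c x\<bar> \<le> B)"
proof -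
  have apos: "0 < a k x" if "k \<in> Basis" "x \<in> closure \<Omega>" for k x
    using coeffs that by (auto simp: admissible_coefficients_def)
  have "\<forall>k\<in>Basis. \<exists>C. \<forall>x\<in>\<Omega>. \<bar>1 / a k x\<bar> \<le> C"
  proof
    fix k :: 'a assume k: "k \<in> Basis"
    have "a k x \<noteq> 0" if "x \<in> closure \<Omega>" for x using apos[OF k that] by simp
    then show "\<exists>C. \<forall>x\<in>\<Omega>. \<bar>1 / a k x\<bar> \<le> C"
      using a_cont[OF k] by (intro continuous_bounded_dom continuous_intros) auto
  qed
  then obtain A where A: "\<And>k x. k \<in> Basis \<Longrightarrow> x \<in> \<Omega> \<Longrightarrow> \<bar>1 / a k x\<bar> \<le> A k"
    by metis
  obtain D where D: "\<And>k x. k \<in> Basis \<Longrightarrow> x \<in> \<Omega> \<Longrightarrow> \<bar>b k x\<bar> \<le> D k"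
    using continuous_bounded_dom[OF b_cont] by metis
  obtain E where E: "\<And>x. x \<in> \<Omega> \<Longrightarrow> \<bar>c x\<bar> \<le> E"
    using continuous_bounded_dom[OF c_cont] by metis
  define B where "B = 1 + \<bar>E\<bar> + (\<Sum>k\<in>Basis. \<bar>A k\<bar> + \<bar>D k\<bar>)"
  have S0: "0 \<le> (\<Sum>k\<in>Basis. \<bar>A k\<bar> + \<bar>D k\<bar>)" by (intro sum_nonneg) auto
  have S: "\<bar>A k\<bar> + \<bar>D k\<bar> \<le> (\<Sum>k\<in>Basis. \<bar>A k\<bar> + \<bar>D k\<bar>)" if "k \<in> Basis" for k
    using that by (intro member_le_sum[of k Basis "\<lambda>k. \<bar>A k\<bar> + \<bar>D k\<bar>"]) auto
  have B: "0 < B" using S0 by (simp add: B_def)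
  have "1 / B \<le> a k x \<and> \<bar>b k x\<bar> \<le> B" if k: "k \<in> Basis" and x: "x \<in> \<Omega>" for k x
  proof
    have ap: "0 < a k x" using apos[OF k] x closure_subset by blast
    have "1 / a k x \<le> B" using A[OF k x] S[OF k] ap unfolding B_def by linarith
    then show "1 / B \<le> a k x" using ap B by (simp add: field_simps)
    show "\<bar>b k x\<bar> \<le> B" using D[OF k x] S[OF k] unfolding B_def by linarith
  qed
  moreover have "\<bar>c x\<bar> \<le> B" if "x \<in> \<Omega>" for x using E[OF that] S0 unfolding B_def by linarith
  ultimately show ?thesis using B by blast
qed

text \<open>The gradients \<open>g\<close> of \<open>u\<close> and \<open>h\<close> of
  \<open>v\<close> are separate arguments, since a weak gradient is fixed only up to null sets. This
  also allows one form for test functions with classical partial derivatives and for H10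
  functions.\<close>

definition elliptic_form :: "('a \<Rightarrow> real) \<Rightarrow> ('a \<Rightarrow> 'a \<Rightarrow> real) \<Rightarrow> ('a \<Rightarrow> real) \<Rightarrow> ('a \<Rightarrow> 'a \<Rightarrow> real) \<Rightarrow> real" where
  "elliptic_form u g v h = (\<integral>x. (\<Sum>k\<in>Basis. a k x * g k x * h k x + b k x * g k x * v x)
      + c x * u x * v x \<partial>lebesgue_on \<Omega>)"

text \<open>Writes the form through L2 inner products, which turns linearity and passage to L2
  limits into term-by-term facts.\<close>

lemma elliptic_form_eq:
  assumes u: "u \<in> L2 \<Omega>" and v: "v \<in> L2 \<Omega>"
    and g: "\<And>k. k \<in> Basis \<Longrightarrow> g k \<in> L2 \<Omega>" and h: "\<And>k. k \<in> Basis \<Longrightarrow> h k \<in> L2 \<Omega>"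
  shows "elliptic_form u g v h =
    (\<Sum>k\<in>Basis. L2_inner \<Omega> (\<lambda>x. a k x * g k x) (h k) + L2_inner \<Omega> (\<lambda>x. b k x * g k x) v)
    + L2_inner \<Omega> (\<lambda>x. c x * u x) v"
proof -
  note [simp] = L2_mult_integrable[OF L2_continuous_mult[OF a_cont g] h]
    L2_mult_integrable[OF L2_continuous_mult[OF b_cont g] v]
    L2_mult_integrable[OF L2_continuous_mult[OF c_cont u] v]
  show ?thesis
    unfolding elliptic_form_def L2_inner_def
    by (simp add: Bochner_Integration.integral_sum Bochner_Integration.integral_add
        Bochner_Integration.integrable_sum Bochner_Integration.integrable_add)
qed

lemma H10_gradientD:
  assumes "H10_gradient \<Omega> u g"
  shows "u \<in> L2 \<Omega>" "k \<in> Basis \<Longrightarrow> g k \<in> L2 \<Omega>"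
  using assms by (auto simp: H10_gradient_def)

lemma H10_gradient_lincomb:
  assumes u: "H10_gradient \<Omega> u g" and v: "H10_gradient \<Omega> v h"
  shows "H10_gradient \<Omega> (\<lambda>x. r * u x + s * v x) (\<lambda>k x. r * g k x + s * h k x)"
proof -
  note L2 = H10_gradientD[OF u] H10_gradientD[OF v]
  have "weak_gradient \<Omega> (\<lambda>x. r * u x + s * v x) (\<lambda>k x. r * g k x + s * h k x)"
    unfolding weak_gradient_def
  proof (intro ballI)
    fix k :: 'a and \<phi> assume k: "k \<in> Basis" and \<phi>: "\<phi> \<in> test_functions \<Omega>"
    have "L2_inner \<Omega> u (partial k \<phi>) = - L2_inner \<Omega> (g k) \<phi>"
      "L2_inner \<Omega> v (partial k \<phi>) = - L2_inner \<Omega> (h k) \<phi>"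
      using u v k \<phi> by (auto simp: H10_gradient_def weak_gradient_def)
    then show "L2_inner \<Omega> (\<lambda>x. r * u x + s * v x) (partial k \<phi>) = - L2_inner \<Omega> (\<lambda>x. r * g k x + s * h k x) \<phi>"
      using L2 k test_function_L2[OF \<phi>] test_function_partial_L2[OF \<phi> k]
      by (simp add: L2_inner_add_left L2_scale L2_inner_scale_left)
  qed
  moreover
  obtain f where f: "\<And>n. f n \<in> test_functions \<Omega>" "L2_tendsto \<Omega> f u"
      "\<And>k. k \<in> Basis \<Longrightarrow> L2_tendsto \<Omega> (\<lambda>n. partial k (f n)) (g k)"
    using u by (auto simp: H10_gradient_def)
  obtain f' where f': "\<And>n. f' n \<in> test_functions \<Omega>" "L2_tendsto \<Omega> f' v"
      "\<And>k. k \<in> Basis \<Longrightarrow> L2_tendsto \<Omega> (\<lambda>n. partial k (f' n)) (h k)"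
    using v by (auto simp: H10_gradient_def)
  have "L2_tendsto \<Omega> (\<lambda>n. partial k (\<lambda>x. r * f n x + s * f' n x)) (\<lambda>x. r * g k x + s * h k x)"
    if k: "k \<in> Basis" for k
    unfolding partial_lincomb[OF test_functions_differentiable[OF f(1)] test_functions_differentiable[OF f'(1)]]
    using L2_tendsto_lincomb[OF f(3)[OF k] f'(3)[OF k]] L2 k test_function_partial_L2[OF f(1) k]
      test_function_partial_L2[OF f'(1) k] by blast
  moreover have "L2_tendsto \<Omega> (\<lambda>n x. r * f n x + s * f' n x) (\<lambda>x. r * u x + s * v x)"
    using L2_tendsto_lincomb[OF f(2) f'(2)] L2 test_function_L2[OF f(1)] test_function_L2[OF f'(1)] by blast
  ultimately show ?thesis
    unfolding H10_gradient_def using L2 test_functions_lincomb[OF f(1) f'(1)]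
    by (intro conjI ballI L2_add L2_scale exI[of _ "\<lambda>n x. r * f n x + s * f' n x"] allI) auto
qed

text \<open>\<open>elliptic_op\<close> with its gradient made explicit, because the energy estimate
  below bounds that gradient.\<close>

definition weak_solution :: "('a \<Rightarrow> real) \<Rightarrow> ('a \<Rightarrow> 'a \<Rightarrow> real) \<Rightarrow> ('a \<Rightarrow> real) \<Rightarrow> bool" where
  "weak_solution u g w \<longleftrightarrow> w \<in> L2 \<Omega> \<and> H10_gradient \<Omega> u g \<and>
     (\<forall>\<phi>\<in>test_functions \<Omega>. elliptic_form u g \<phi> (\<lambda>k. partial k \<phi>) = L2_inner \<Omega> w \<phi>)"

lemma elliptic_op_iff: "elliptic_op \<Omega> a b c u w \<longleftrightarrow> (\<exists>g. weak_solution u g w)"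
  unfolding elliptic_op_def weak_solution_def elliptic_form_def by auto

lemma weak_solution_lincomb:
  assumes u: "weak_solution u g w" and v: "weak_solution v h z"
  shows "weak_solution (\<lambda>x. r * u x + s * v x) (\<lambda>k x. r * g k x + s * h k x) (\<lambda>x. r * w x + s * z x)"
proof -
  have Hu: "H10_gradient \<Omega> u g" and Hv: "H10_gradient \<Omega> v h" and wz: "w \<in> L2 \<Omega>" "z \<in> L2 \<Omega>"
    using u v by (auto simp: weak_solution_def)
  note L2 = H10_gradientD[OF Hu] H10_gradientD[OF Hv]
  note H = H10_gradient_lincomb[OF Hu Hv, of r s]
  have "elliptic_form (\<lambda>x. r * u x + s * v x) (\<lambda>k x. r * g k x + s * h k x) \<phi> (\<lambda>k. partial k \<phi>) =
      L2_inner \<Omega> (\<lambda>x. r * w x + s * z x) \<phi>" if \<phi>: "\<phi> \<in> test_functions \<Omega>" for \<phi>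
  proof -
    note p = test_function_L2[OF \<phi>] test_function_partial_L2[OF \<phi>]
    have comb: "L2_inner \<Omega> (\<lambda>x. q x * (r * f x + s * f' x)) p =
        r * L2_inner \<Omega> (\<lambda>x. q x * f x) p + s * L2_inner \<Omega> (\<lambda>x. q x * f' x) p"
      if "continuous_on (closure \<Omega>) q" "f \<in> L2 \<Omega>" "f' \<in> L2 \<Omega>" "p \<in> L2 \<Omega>" for q f f' p
    proof -
      have "(\<lambda>x. q x * (r * f x + s * f' x)) = (\<lambda>x. r * (q x * f x) + s * (q x * f' x))"
        by (simp add: algebra_simps)
      then show ?thesis using that
        by (simp add: L2_inner_add_left L2_scale L2_continuous_mult L2_inner_scale_left)
    qed
    have "elliptic_form (\<lambda>x. r * u x + s * v x) (\<lambda>k x. r * g k x + s * h k x) \<phi> (\<lambda>k. partial k \<phi>) =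
        r * elliptic_form u g \<phi> (\<lambda>k. partial k \<phi>) + s * elliptic_form v h \<phi> (\<lambda>k. partial k \<phi>)"
      using L2 p by (simp add: elliptic_form_eq H10_gradientD[OF H] comb a_cont b_cont c_cont,
          simp add: sum.distrib sum_distrib_left distrib_left)
    also have "\<dots> = L2_inner \<Omega> (\<lambda>x. r * w x + s * z x) \<phi>"
      using u v \<phi> wz p by (simp add: weak_solution_def L2_inner_add_left L2_scale L2_inner_scale_left)
    finally show ?thesis .
  qed
  then show ?thesis using H wz by (auto simp: weak_solution_def intro!: L2_add L2_scale)
qed

lemma elliptic_op_lincomb:
  assumes "elliptic_op \<Omega> a b c u w" "elliptic_op \<Omega> a b c v z"
  shows "elliptic_op \<Omega> a b c (\<lambda>x. r * u x + s * v x) (\<lambda>x. r * w x + s * z x)"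
  using assms weak_solution_lincomb unfolding elliptic_op_iff by blast

lemma elliptic_op_zero: "elliptic_op \<Omega> a b c (\<lambda>x. 0) (\<lambda>x. 0)"
proof -
  have "H10_gradient \<Omega> (\<lambda>x. 0) (\<lambda>k x. 0)"
    unfolding H10_gradient_def weak_gradient_def L2_inner_def L2_tendsto_def
    by (auto intro!: exI[of _ "\<lambda>n x. 0"] test_functions_zero simp: frechet_derivative_const)
  then have "weak_solution (\<lambda>x. 0) (\<lambda>k x. 0) (\<lambda>x. 0)"
    by (simp add: weak_solution_def elliptic_form_def L2_inner_def)
  then show ?thesis unfolding elliptic_op_iff by blast
qed

lemma elliptic_op_sum:
  assumes "\<And>i. i \<in> I \<Longrightarrow> elliptic_op \<Omega> a b c (u i) (w i)"
  shows "elliptic_op \<Omega> a b c (\<lambda>x. \<Sum>i\<in>I. r i * u i x) (\<lambda>x. \<Sum>i\<in>I. r i * w i x)"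
  using assms
proof (induction I rule: infinite_finite_induct)
  case (insert i I)
  then show ?case using elliptic_op_lincomb[of "u i" "w i" "\<lambda>x. \<Sum>i\<in>I. r i * u i x" "\<lambda>x. \<Sum>i\<in>I. r i * w i x" "r i" 1]
    by simp
qed (auto intro: elliptic_op_zero)

lemma elliptic_op_L2: "elliptic_op \<Omega> a b c u w \<Longrightarrow> u \<in> L2 \<Omega>" "elliptic_op \<Omega> a b c u w \<Longrightarrow> w \<in> L2 \<Omega>"
  by (auto simp: elliptic_op_def H10_gradient_def)

lemma elliptic_op_H10: "elliptic_op \<Omega> a b c u w \<Longrightarrow> u \<in> H10 \<Omega>"
  by (auto simp: elliptic_op_def H10_def)

text \<open>Functions are defined on the whole space, but \<open>u\<close> enters only through
  integrals over the domain and through membership in \<open>L2\<close>. This is needed because the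
  polynomial form of a collocation solution is prescribed for points of the domain only.\<close>

lemma elliptic_op_cong:
  assumes eq: "\<And>x. x \<in> \<Omega> \<Longrightarrow> u x = v x" and u: "elliptic_op \<Omega> a b c u w"
  shows "elliptic_op \<Omega> a b c v w"
proof -
  obtain g where g: "weak_solution u g w" using u elliptic_op_iff by blast
  have int: "(\<integral>x. F x (u x) \<partial>lebesgue_on \<Omega>) = (\<integral>x. F x (v x) \<partial>lebesgue_on \<Omega>)" for F :: "'a \<Rightarrow> real \<Rightarrow> real"
    by (intro Bochner_Integration.integral_cong) (auto simp: eq)
  have "L2_inner \<Omega> u f = L2_inner \<Omega> v f" for f
    unfolding L2_inner_def by (rule int)
  moreover have "L2_tendsto \<Omega> f u \<longleftrightarrow> L2_tendsto \<Omega> f v" for f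
    unfolding L2_tendsto_def by (subst int) simp
  moreover have "elliptic_form u g f h = elliptic_form v g f h" for f h
    unfolding elliptic_form_def by (rule int)
  moreover have "v \<in> L2 \<Omega>" using L2_cong[OF eq elliptic_op_L2(1)[OF u]] .
  ultimately have "weak_solution v g w"
    using g by (auto simp: weak_solution_def H10_gradient_def weak_gradient_def)
  then show ?thesis using elliptic_op_iff by blast
qed

section \<open>Energy estimate and closedness of the operator\<close>

text \<open>Test functions are dense in H10 by definition, and both sides are continuous in the test
  function and its gradient. The purpose is to test the equation with its own solution
  \<open>u\<close>.\<close>

lemma weak_solution_test_H10:
  assumes u: "weak_solution u g w" and v: "H10_gradient \<Omega> v h"
  shows "elliptic_form u g v h = L2_inner \<Omega> w v"
proof -
  have Hu: "H10_gradient \<Omega> u g" and w: "w \<in> L2 \<Omega>" using u by (auto simp: weak_solution_def)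
  note L2 = H10_gradientD[OF Hu] H10_gradientD[OF v]
  obtain f where f: "\<And>n. f n \<in> test_functions \<Omega>" "L2_tendsto \<Omega> f v"
      "\<And>k. k \<in> Basis \<Longrightarrow> L2_tendsto \<Omega> (\<lambda>n. partial k (f n)) (h k)"
    using v by (auto simp: H10_gradient_def)
  note fL2 = test_function_L2[OF f(1)] test_function_partial_L2[OF f(1)]
  have lim: "(\<lambda>n. L2_inner \<Omega> p (f n)) \<longlonglongrightarrow> L2_inner \<Omega> p v" if "p \<in> L2 \<Omega>" for p
    using L2_tendsto_inner[OF f(2) fL2(1) L2(3) that] by (simp only: L2_inner_commute[of \<Omega> p])
  have limk: "(\<lambda>n. L2_inner \<Omega> p (partial k (f n))) \<longlonglongrightarrow> L2_inner \<Omega> p (h k)"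
    if "p \<in> L2 \<Omega>" "k \<in> Basis" for p k
    using L2_tendsto_inner[OF f(3)[OF that(2)] fL2(2)[OF that(2)] L2(4)[OF that(2)] that(1)]
    by (simp only: L2_inner_commute[of \<Omega> p])
  have "(\<lambda>n. elliptic_form u g (f n) (\<lambda>k. partial k (f n))) \<longlonglongrightarrow> elliptic_form u g v h"
    using L2 fL2 by (simp add: elliptic_form_eq)
      (intro tendsto_add tendsto_sum lim limk L2_continuous_mult a_cont b_cont c_cont L2)
  moreover have "elliptic_form u g (f n) (\<lambda>k. partial k (f n)) = L2_inner \<Omega> w (f n)" for n
    using u f(1) by (auto simp: weak_solution_def)
  ultimately show ?thesis using lim[OF w] LIMSEQ_unique by simp
qed

text \<open>Tested with \<open>u\<close> itself, the second-order part controls the squared gradient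
  with the factor \<open>1 / B\<close>. Young's inequality spends half of it on the first-order
  term, and what remains is paid by multiples of the squared norm of \<open>u\<close>.\<close>

lemma garding:
  "\<exists>\<kappa>>0. \<exists>K\<ge>0. \<forall>u g w. weak_solution u g w \<longrightarrow>
     \<kappa> * (\<Sum>k\<in>Basis. (L2_norm \<Omega> (g k))\<^sup>2) \<le> L2_inner \<Omega> w u + K * (L2_norm \<Omega> u)\<^sup>2"
proof -
  obtain B where B: "0 < B" and ab: "\<And>k x. k \<in> Basis \<Longrightarrow> x \<in> \<Omega> \<Longrightarrow> 1 / B \<le> a k x \<and> \<bar>b k x\<bar> \<le> B"
    and c: "\<And>x. x \<in> \<Omega> \<Longrightarrow> \<bar>c x\<bar> \<le> B"
    using coefficient_bounds by blast
  \<comment> \<open>Half of the ellipticity constant \<open>1 / B\<close>. The value of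
    \<open>D\<close> makes \<open>\<kappa> * p\<^sup>2 + D * q\<^sup>2 - B * (p * q)\<close> the
    perfect square \<open>\<kappa> * (p - B\<^sup>2 * q)\<^sup>2\<close>; \<open>K\<close> collects
    one \<open>D\<close> per coordinate and \<open>B\<close> for the term of order zero.\<close>
  define \<kappa> where "\<kappa> = 1 / (2 * B)"
  define D where "D = B ^ 3 / 2"
  define K where "K = real (card (Basis :: 'a set)) * D + B"
  have "\<kappa> * (\<Sum>k\<in>Basis. (L2_norm \<Omega> (g k))\<^sup>2) \<le> L2_inner \<Omega> w u + K * (L2_norm \<Omega> u)\<^sup>2"
    if ws: "weak_solution u g w" for u g w
  proof -
    have Hu: "H10_gradient \<Omega> u g" using ws by (auto simp: weak_solution_def)
    note L2 = H10_gradientD[OF Hu]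
    have grad: "\<kappa> * (L2_norm \<Omega> (g k))\<^sup>2 - D * (L2_norm \<Omega> u)\<^sup>2
        \<le> L2_inner \<Omega> (\<lambda>x. a k x * g k x) (g k) + L2_inner \<Omega> (\<lambda>x. b k x * g k x) u"
      if k: "k \<in> Basis" for k
    proof -
      note [simp] = L2_mult_integrable[OF L2_continuous_mult[OF a_cont[OF k] L2(2)[OF k]] L2(2)[OF k]]
        L2_mult_integrable[OF L2_continuous_mult[OF b_cont[OF k] L2(2)[OF k]] L2(1)]
        L2_mult_integrable[OF L2(1) L2(1)] L2_mult_integrable[OF L2(2)[OF k] L2(2)[OF k]]
      have "(\<integral>x. \<kappa> * (g k x * g k x) - D * (u x * u x) \<partial>lebesgue_on \<Omega>)
          \<le> (\<integral>x. a k x * g k x * g k x + b k x * g k x * u x \<partial>lebesgue_on \<Omega>)"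
      proof (rule integral_mono)
        fix x assume "x \<in> space (lebesgue_on \<Omega>)"
        then have x: "x \<in> \<Omega>" by simp
        define p where "p = \<bar>g k x\<bar>"
        define q where "q = \<bar>u x\<bar>"
        have "1 / B * p\<^sup>2 \<le> a k x * p\<^sup>2"
          using ab[OF k x] by (intro mult_right_mono) auto
        moreover have "- (B * (p * q)) \<le> b k x * g k x * u x"
        proof -
          have "\<bar>b k x * g k x * u x\<bar> \<le> B * (p * q)"
            unfolding p_def q_def abs_mult mult.assoc using ab[OF k x] by (intro mult_right_mono) auto
          then show ?thesis by linarith
        qed
        moreover have "B * (p * q) \<le> \<kappa> * p\<^sup>2 + D * q\<^sup>2"
        proof -
          have "0 \<le> \<kappa> * (p - B\<^sup>2 * q)\<^sup>2" using B by (simp add: \<kappa>_def)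
          also have "\<dots> = \<kappa> * p\<^sup>2 + D * q\<^sup>2 - B * (p * q)"
            using B by (simp add: \<kappa>_def D_def power2_eq_square power3_eq_cube field_simps)
          finally show ?thesis by simp
        qed
        moreover have "1 / B = 2 * \<kappa>" using B by (simp add: \<kappa>_def)
        moreover have "p\<^sup>2 = g k x * g k x" "q\<^sup>2 = u x * u x"
          by (simp_all add: p_def q_def power2_eq_square)
        ultimately show "\<kappa> * (g k x * g k x) - D * (u x * u x) \<le> a k x * g k x * g k x + b k x * g k x * u x"
          by (simp add: mult.assoc)
      qed simp_all
      then show ?thesis by (simp add: L2_norm_power2 L2_inner_def)
    qed
    have low: "- (B * (L2_norm \<Omega> u)\<^sup>2) \<le> L2_inner \<Omega> (\<lambda>x. c x * u x) u"
    proof -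
      note [simp] = L2_mult_integrable[OF L2_continuous_mult[OF c_cont L2(1)] L2(1)]
        L2_mult_integrable[OF L2(1) L2(1)]
      have "(\<integral>x. - (B * (u x * u x)) \<partial>lebesgue_on \<Omega>) \<le> (\<integral>x. c x * u x * u x \<partial>lebesgue_on \<Omega>)"
      proof (rule integral_mono)
        fix x assume "x \<in> space (lebesgue_on \<Omega>)"
        then have "- B \<le> c x" using c[of x] by (simp add: abs_le_iff)
        then have "- B * (u x * u x) \<le> c x * (u x * u x)" by (intro mult_right_mono) auto
        then show "- (B * (u x * u x)) \<le> c x * u x * u x" by (simp add: mult.assoc)
      qed simp_all
      then show ?thesis by (simp add: L2_norm_power2 L2_inner_def)
    qed
    have E: "elliptic_form u g u g =
        (\<Sum>k\<in>Basis. L2_inner \<Omega> (\<lambda>x. a k x * g k x) (g k) + L2_inner \<Omega> (\<lambda>x. b k x * g k x) u)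
        + L2_inner \<Omega> (\<lambda>x. c x * u x) u"
      by (rule elliptic_form_eq) (use L2 in auto)
    have "\<kappa> * (\<Sum>k\<in>Basis. (L2_norm \<Omega> (g k))\<^sup>2) - K * (L2_norm \<Omega> u)\<^sup>2 =
        (\<Sum>k\<in>Basis. \<kappa> * (L2_norm \<Omega> (g k))\<^sup>2 - D * (L2_norm \<Omega> u)\<^sup>2) - B * (L2_norm \<Omega> u)\<^sup>2"
      by (simp add: K_def sum_subtractf sum_distrib_left algebra_simps)
    also have "\<dots> \<le> elliptic_form u g u g"
      unfolding E
      using sum_mono[of Basis "\<lambda>k. \<kappa> * (L2_norm \<Omega> (g k))\<^sup>2 - D * (L2_norm \<Omega> u)\<^sup>2"
          "\<lambda>k. L2_inner \<Omega> (\<lambda>x. a k x * g k x) (g k) + L2_inner \<Omega> (\<lambda>x. b k x * g k x) u"] grad low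
      by force
    also have "\<dots> = L2_inner \<Omega> w u" by (rule weak_solution_test_H10[OF ws Hu])
    finally show ?thesis by simp
  qed
  moreover have "0 < \<kappa>" "0 \<le> K" using B by (auto simp: \<kappa>_def K_def D_def)
  ultimately show ?thesis by blast
qed

text \<open>The Garding inequality for the differences, which are weak solutions by linearity:
  convergence of functions and images in L2 already forces the gradients to be Cauchy.\<close>

lemma gradients_Cauchy:
  assumes ws: "\<And>n. weak_solution (u n) (g n) (w n)"
    and u: "L2_tendsto \<Omega> u U" "U \<in> L2 \<Omega>" and w: "L2_tendsto \<Omega> w W" "W \<in> L2 \<Omega>"
    and k: "k \<in> Basis" and e: "0 < e"
  shows "\<exists>N. \<forall>m\<ge>N. \<forall>n\<ge>N. L2_norm \<Omega> (\<lambda>x. g m k x - g n k x) < e"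
proof -
  obtain \<kappa> K where \<kappa>: "0 < \<kappa>" and K: "0 \<le> K" and G: "\<And>u g w. weak_solution u g w \<Longrightarrow>
     \<kappa> * (\<Sum>k\<in>Basis. (L2_norm \<Omega> (g k))\<^sup>2) \<le> L2_inner \<Omega> w u + K * (L2_norm \<Omega> u)\<^sup>2"
    using garding by blast
  \<comment> \<open>Chosen so that \<open>\<delta>\<^sup>2 * (1 + K) = \<kappa> * e\<^sup>2\<close>,
    the bound that the energy estimate has to reach.\<close>
  define \<delta> where "\<delta> = e * sqrt (\<kappa> / (1 + K))"
  have \<delta>: "0 < \<delta>" using e \<kappa> K by (simp add: \<delta>_def)
  have \<delta>2: "\<delta>\<^sup>2 * (1 + K) = \<kappa> * e\<^sup>2"
    using \<kappa> K by (simp add: \<delta>_def power_mult_distrib)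
  have uL2: "u n \<in> L2 \<Omega>" and wL2: "w n \<in> L2 \<Omega>" for n
    using ws[of n] by (auto simp: weak_solution_def H10_gradient_def)
  obtain N1 where N1: "\<And>m n. m \<ge> N1 \<Longrightarrow> n \<ge> N1 \<Longrightarrow> L2_norm \<Omega> (\<lambda>x. u m x - u n x) < \<delta>"
    using L2_tendsto_Cauchy[OF u(1) uL2 u(2) \<delta>] by blast
  obtain N2 where N2: "\<And>m n. m \<ge> N2 \<Longrightarrow> n \<ge> N2 \<Longrightarrow> L2_norm \<Omega> (\<lambda>x. w m x - w n x) < \<delta>"
    using L2_tendsto_Cauchy[OF w(1) wL2 w(2) \<delta>] by blast
  have "L2_norm \<Omega> (\<lambda>x. g m k x - g n k x) < e" if "m \<ge> max N1 N2" "n \<ge> max N1 N2" for m n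
  proof -
    let ?nu = "L2_norm \<Omega> (\<lambda>x. u m x - u n x)" and ?nw = "L2_norm \<Omega> (\<lambda>x. w m x - w n x)"
    let ?ng = "L2_norm \<Omega> (\<lambda>x. g m k x - g n k x)"
    have nu: "?nu < \<delta>" and nw: "?nw < \<delta>" using N1 N2 that by auto
    have d: "weak_solution (\<lambda>x. u m x - u n x) (\<lambda>k x. g m k x - g n k x) (\<lambda>x. w m x - w n x)"
      using weak_solution_lincomb[OF ws[of m] ws[of n], of 1 "-1"] by simp
    have "\<kappa> * ?ng\<^sup>2 \<le> \<kappa> * (\<Sum>k\<in>Basis. (L2_norm \<Omega> (\<lambda>x. g m k x - g n k x))\<^sup>2)"
      using \<kappa> k by (intro mult_left_mono member_le_sum[of k Basis "\<lambda>k. (L2_norm \<Omega> (\<lambda>x. g m k x - g n k x))\<^sup>2"]) auto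
    also have "\<dots> \<le> L2_inner \<Omega> (\<lambda>x. w m x - w n x) (\<lambda>x. u m x - u n x) + K * ?nu\<^sup>2"
      by (rule G[OF d])
    also have "\<dots> \<le> ?nw * ?nu + K * ?nu\<^sup>2"
      using L2_Cauchy_Schwarz[OF L2_diff[OF wL2 wL2] L2_diff[OF uL2 uL2], of m n m n] by linarith
    also have "\<dots> < \<delta> * \<delta> + K * \<delta>\<^sup>2"
    proof (rule add_less_le_mono)
      show "?nw * ?nu < \<delta> * \<delta>" using nu nw by (intro mult_strict_mono') auto
      show "K * ?nu\<^sup>2 \<le> K * \<delta>\<^sup>2" using nu K by (intro mult_left_mono power_mono) auto
    qed
    also have "\<dots> = \<kappa> * e\<^sup>2" using \<delta>2 by (simp add: power2_eq_square algebra_simps)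
    finally have "?ng\<^sup>2 < e\<^sup>2" using \<kappa> by simp
    then show ?thesis by (rule power2_less_imp_less) (use e in simp)
  qed
  then show ?thesis by blast
qed

lemma H10_gradient_closed:
  assumes H: "\<And>n. H10_gradient \<Omega> (u n) (g n)"
    and u: "L2_tendsto \<Omega> u U" "U \<in> L2 \<Omega>"
    and g: "\<And>k. k \<in> Basis \<Longrightarrow> L2_tendsto \<Omega> (\<lambda>n. g n k) (G k)" "\<And>k. k \<in> Basis \<Longrightarrow> G k \<in> L2 \<Omega>"
  shows "H10_gradient \<Omega> U G"
proof -
  note uL2 = H10_gradientD(1)[OF H] and gL2 = H10_gradientD(2)[OF H]
  have "weak_gradient \<Omega> U G"
    unfolding weak_gradient_def
  proof (intro ballI)
    fix k :: 'a and \<phi> assume k: "k \<in> Basis" and \<phi>: "\<phi> \<in> test_functions \<Omega>"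
    have "(\<lambda>n. L2_inner \<Omega> (u n) (partial k \<phi>)) \<longlonglongrightarrow> L2_inner \<Omega> U (partial k \<phi>)"
      by (rule L2_tendsto_inner[OF u(1) uL2 u(2) test_function_partial_L2[OF \<phi> k]])
    moreover have "(\<lambda>n. - L2_inner \<Omega> (g n k) \<phi>) \<longlonglongrightarrow> - L2_inner \<Omega> (G k) \<phi>"
      by (intro tendsto_minus L2_tendsto_inner[OF g(1)[OF k] gL2 g(2) test_function_L2[OF \<phi>]] k)
    moreover have "L2_inner \<Omega> (u n) (partial k \<phi>) = - L2_inner \<Omega> (g n k) \<phi>" for n
      using H[of n] k \<phi> by (auto simp: H10_gradient_def weak_gradient_def)
    ultimately show "L2_inner \<Omega> U (partial k \<phi>) = - L2_inner \<Omega> (G k) \<phi>"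
      using LIMSEQ_unique by simp
  qed
  \<comment> \<open>Each \<open>u n\<close> is itself only a limit of test functions, so a diagonal
    choice is needed. One test function can be close in all directions at once because
    \<open>Basis\<close> is finite.\<close>
  moreover have approx: "\<forall>n. \<exists>f. f \<in> test_functions \<Omega> \<and> L2_norm \<Omega> (\<lambda>x. f x - u n x) < 1 / real (Suc n) \<and>
      (\<forall>k\<in>Basis. L2_norm \<Omega> (\<lambda>x. partial k f x - g n k x) < 1 / real (Suc n))"
  proof
    fix n
    obtain f where f: "\<And>i. f i \<in> test_functions \<Omega>" "L2_tendsto \<Omega> f (u n)"
        "\<And>k. k \<in> Basis \<Longrightarrow> L2_tendsto \<Omega> (\<lambda>i. partial k (f i)) (g n k)"
      using H[of n] by (auto simp: H10_gradient_def)
    have "\<forall>\<^sub>F i in sequentially. L2_norm \<Omega> (\<lambda>x. f i x - u n x) < 1 / real (Suc n)"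
      using f(2) unfolding L2_tendsto_iff_norm by (rule order_tendstoD(2)) simp
    moreover have "\<forall>\<^sub>F i in sequentially. \<forall>k\<in>Basis. L2_norm \<Omega> (\<lambda>x. partial k (f i) x - g n k x) < 1 / real (Suc n)"
    proof (rule eventually_ball_finite[OF finite_Basis], rule ballI)
      fix k :: 'a assume k: "k \<in> Basis"
      show "\<forall>\<^sub>F i in sequentially. L2_norm \<Omega> (\<lambda>x. partial k (f i) x - g n k x) < 1 / real (Suc n)"
        using f(3)[OF k] unfolding L2_tendsto_iff_norm by (rule order_tendstoD(2)) simp
    qed
    ultimately have "\<forall>\<^sub>F i in sequentially. L2_norm \<Omega> (\<lambda>x. f i x - u n x) < 1 / real (Suc n) \<and>
        (\<forall>k\<in>Basis. L2_norm \<Omega> (\<lambda>x. partial k (f i) x - g n k x) < 1 / real (Suc n))"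
      by (rule eventually_conj)
    from eventually_happens'[OF sequentially_bot this]
    show "\<exists>f. f \<in> test_functions \<Omega> \<and> L2_norm \<Omega> (\<lambda>x. f x - u n x) < 1 / real (Suc n) \<and>
        (\<forall>k\<in>Basis. L2_norm \<Omega> (\<lambda>x. partial k f x - g n k x) < 1 / real (Suc n))"
      using f(1) by blast
  qed
  obtain f where f: "\<And>n. f n \<in> test_functions \<Omega>"
      and fu: "\<And>n. L2_norm \<Omega> (\<lambda>x. f n x - u n x) < 1 / real (Suc n)"
      and fg: "\<And>n k. k \<in> Basis \<Longrightarrow> L2_norm \<Omega> (\<lambda>x. partial k (f n) x - g n k x) < 1 / real (Suc n)"
    using choice[OF approx] by blast
  have trans: "L2_tendsto \<Omega> p q"
    if p: "\<And>n. p n \<in> L2 \<Omega>" and r: "\<And>n. r n \<in> L2 \<Omega>" and q: "q \<in> L2 \<Omega>"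
      and pr: "\<And>n. L2_norm \<Omega> (\<lambda>x. p n x - r n x) < 1 / real (Suc n)" and rq: "L2_tendsto \<Omega> r q" for p r q
    unfolding L2_tendsto_iff_norm
  proof (rule Lim_null_comparison)
    have "L2_norm \<Omega> (\<lambda>x. p n x - q x) \<le> 1 / real (Suc n) + L2_norm \<Omega> (\<lambda>x. r n x - q x)" for n
      using L2_norm_triangle_diff[OF p r q, of n n] pr[of n] by linarith
    then show "\<forall>\<^sub>F n in sequentially. norm (L2_norm \<Omega> (\<lambda>x. p n x - q x))
        \<le> 1 / real (Suc n) + L2_norm \<Omega> (\<lambda>x. r n x - q x)"
      unfolding real_norm_def abs_of_nonneg[OF L2_norm_nonneg] by (rule always_eventually[OF allI])
    show "(\<lambda>n. 1 / real (Suc n) + L2_norm \<Omega> (\<lambda>x. r n x - q x)) \<longlonglongrightarrow> 0"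
      using tendsto_add[OF LIMSEQ_Suc[OF lim_1_over_n] rq[unfolded L2_tendsto_iff_norm]] by simp
  qed
  have "L2_tendsto \<Omega> f U"
    by (rule trans[OF test_function_L2[OF f] uL2 u(2) fu u(1)])
  moreover have "L2_tendsto \<Omega> (\<lambda>n. partial k (f n)) (G k)" if k: "k \<in> Basis" for k
    by (rule trans[OF test_function_partial_L2[OF f k] gL2[OF k] g(2)[OF k] fg[OF k] g(1)[OF k]])
  ultimately show ?thesis
    unfolding H10_gradient_def using u g f by blast
qed

text \<open>The gradients converge by completeness, their limit is the gradient of \<open>U\<close>,
  and the weak equation passes to the limit. Closedness puts L2-convergent eigenfunction series into
  the domain of the operator.\<close>

lemma elliptic_op_closed:
  assumes op: "\<And>n. elliptic_op \<Omega> a b c (u n) (w n)"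
    and u: "L2_tendsto \<Omega> u U" "U \<in> L2 \<Omega>" and w: "L2_tendsto \<Omega> w W" "W \<in> L2 \<Omega>"
  shows "elliptic_op \<Omega> a b c U W"
proof -
  obtain g where ws: "\<And>n. weak_solution (u n) (g n) (w n)"
    using op unfolding elliptic_op_iff by metis
  have H: "H10_gradient \<Omega> (u n) (g n)" and wL2: "w n \<in> L2 \<Omega>" for n
    using ws[of n] by (auto simp: weak_solution_def)
  note uL2 = H10_gradientD(1)[OF H] and gL2 = H10_gradientD(2)[OF H]
  have "\<forall>k\<in>Basis. \<exists>G\<in>L2 \<Omega>. L2_tendsto \<Omega> (\<lambda>n. g n k) G"
    using L2_complete[OF dom_lmeasurable gL2 gradients_Cauchy[OF ws u w]] by blast
  then obtain G where G: "\<And>k. k \<in> Basis \<Longrightarrow> L2_tendsto \<Omega> (\<lambda>n. g n k) (G k)" "\<And>k. k \<in> Basis \<Longrightarrow> G k \<in> L2 \<Omega>"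
    by metis
  have HU: "H10_gradient \<Omega> U G" by (rule H10_gradient_closed[OF H u G])
  \<comment> \<open>The bounded coefficient \<open>q\<close> is moved to the fixed factor
    \<open>p\<close>, so that plain L2 convergence of \<open>f\<close> suffices.\<close>
  have mult: "(\<lambda>n. L2_inner \<Omega> (\<lambda>x. q x * f n x) p) \<longlonglongrightarrow> L2_inner \<Omega> (\<lambda>x. q x * f' x) p"
    if q: "continuous_on (closure \<Omega>) q" and f: "L2_tendsto \<Omega> f f'" "\<And>n. f n \<in> L2 \<Omega>" "f' \<in> L2 \<Omega>"
      and p: "p \<in> L2 \<Omega>" for q f f' p
  proof -
    have "L2_inner \<Omega> (\<lambda>x. q x * h x) p = L2_inner \<Omega> h (\<lambda>x. q x * p x)" for h
      unfolding L2_inner_def by (simp add: mult_ac)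
    then show ?thesis using L2_tendsto_inner[OF f L2_continuous_mult[OF q p]] by simp
  qed
  have "elliptic_form U G \<phi> (\<lambda>k. partial k \<phi>) = L2_inner \<Omega> W \<phi>" if \<phi>: "\<phi> \<in> test_functions \<Omega>" for \<phi>
  proof (rule LIMSEQ_unique)
    note p = test_function_L2[OF \<phi>] test_function_partial_L2[OF \<phi>]
    show "(\<lambda>n. elliptic_form (u n) (g n) \<phi> (\<lambda>k. partial k \<phi>)) \<longlonglongrightarrow> elliptic_form U G \<phi> (\<lambda>k. partial k \<phi>)"
      using p uL2 gL2 u(2) G(2) by (simp add: elliptic_form_eq)
        (intro tendsto_add tendsto_sum mult a_cont b_cont c_cont p u uL2 gL2 G)
    show "(\<lambda>n. elliptic_form (u n) (g n) \<phi> (\<lambda>k. partial k \<phi>)) \<longlonglongrightarrow> L2_inner \<Omega> W \<phi>"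
      using L2_tendsto_inner[OF w(1) wL2 w(2) p(1)] ws \<phi> by (simp add: weak_solution_def)
  qed
  then have "weak_solution U G W" using HU w by (simp add: weak_solution_def)
  then show ?thesis using elliptic_op_iff by blast
qed

text \<open>The shift is \<open>s = K + 1\<close> with \<open>K\<close> from the Garding inequality:
  for a function in the kernel the right-hand side becomes minus its squared norm, while the
  left-hand side is nonnegative.\<close>

lemma elliptic_op_shift_injective:
  "\<exists>s>0. \<forall>u w. elliptic_op \<Omega> a b c u w \<longrightarrow> (AE x in lebesgue_on \<Omega>. w x + s * u x = 0) \<longrightarrow>
     (AE x in lebesgue_on \<Omega>. u x = 0)"
proof -
  obtain \<kappa> K where \<kappa>: "0 < \<kappa>" and K: "0 \<le> K" and G: "\<And>u g w. weak_solution u g w \<Longrightarrow>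
     \<kappa> * (\<Sum>k\<in>Basis. (L2_norm \<Omega> (g k))\<^sup>2) \<le> L2_inner \<Omega> w u + K * (L2_norm \<Omega> u)\<^sup>2"
    using garding by blast
  have "AE x in lebesgue_on \<Omega>. u x = 0"
    if op: "elliptic_op \<Omega> a b c u w" and ae: "AE x in lebesgue_on \<Omega>. w x + (K + 1) * u x = 0" for u w
  proof -
    note L2 = elliptic_op_L2[OF op]
    obtain g where g: "weak_solution u g w" using op elliptic_op_iff by blast
    have "L2_inner \<Omega> w u = L2_inner \<Omega> (\<lambda>x. - (K + 1) * u x) u"
      by (rule L2_inner_AE_cong[OF _ L2(2) L2_scale[OF L2(1)] L2(1)])
        (use ae in \<open>eventually_elim, simp add: algebra_simps\<close>)
    also have "\<dots> = - (K + 1) * (L2_norm \<Omega> u)\<^sup>2"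
      unfolding L2_inner_scale_left L2_norm_power2 ..
    finally have "\<kappa> * (\<Sum>k\<in>Basis. (L2_norm \<Omega> (g k))\<^sup>2) \<le> - (L2_norm \<Omega> u)\<^sup>2"
      using G[OF g] by (simp add: algebra_simps)
    moreover have "0 \<le> \<kappa> * (\<Sum>k\<in>Basis. (L2_norm \<Omega> (g k))\<^sup>2)"
      using \<kappa> by (intro mult_nonneg_nonneg sum_nonneg) auto
    ultimately have "(L2_norm \<Omega> u)\<^sup>2 \<le> 0" by linarith
    then have "L2_norm \<Omega> u = 0" by simp
    then show ?thesis by (rule L2_norm_eq_0D[OF _ L2(1)])
  qed
  then show ?thesis using K by (intro exI[of _ "K + 1"]) auto
qed

end

section \<open>Diagonal action of the operator in the eigenbasis\<close>

locale elliptic_eigenbasis = elliptic_coefficients +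
  fixes lam :: "nat \<Rightarrow> real" and \<psi> :: "nat \<Rightarrow> 'a \<Rightarrow> real"
  assumes lam_pos: "0 < lam 0" and lam_mono: "incseq lam"
    and basis: "L2_orthonormal_basis \<Omega> \<psi>"
    and eigen: "\<And>n. elliptic_op \<Omega> a b c (\<psi> n) (\<lambda>x. lam n * \<psi> n x)"
begin

lemma lam_ge: "lam 0 \<le> lam n"
  using lam_mono by (simp add: incseq_def)

text \<open>The hypothesis makes the coefficients of the image square-summable, and those of
  \<open>u\<close> too because \<open>lam n\<close> is at least \<open>lam 0 > 0\<close>. Partial
  sums are handled by linearity and the limit by closedness.\<close>

lemma diagonal_synthesis:
  assumes "summable (\<lambda>n. (lam n * x n)\<^sup>2)"
  shows "\<exists>u w. elliptic_op \<Omega> a b c u w \<and> (\<forall>n. L2_inner \<Omega> u (\<psi> n) = x n) \<and>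
    (\<forall>n. L2_inner \<Omega> w (\<psi> n) = lam n * x n)"
proof -
  have "summable (\<lambda>n. (x n)\<^sup>2)"
  proof (rule summable_comparison_test')
    show "summable (\<lambda>n. 1 / (lam 0)\<^sup>2 * (lam n * x n)\<^sup>2)" using assms by (rule summable_mult)
    fix n
    have "(lam 0)\<^sup>2 * (x n)\<^sup>2 \<le> (lam n)\<^sup>2 * (x n)\<^sup>2"
      using lam_ge[of n] lam_pos by (intro mult_right_mono power_mono) auto
    then show "norm ((x n)\<^sup>2) \<le> 1 / (lam 0)\<^sup>2 * (lam n * x n)\<^sup>2"
      using lam_pos by (simp add: power_mult_distrib field_simps)
  qed
  then obtain u where u: "u \<in> L2 \<Omega>" "L2_tendsto \<Omega> (\<lambda>N y. \<Sum>n<N. x n * \<psi> n y) u"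
    using basis_synthesis[OF basis dom_lmeasurable] by blast
  obtain w where w: "w \<in> L2 \<Omega>" "L2_tendsto \<Omega> (\<lambda>N y. \<Sum>n<N. (lam n * x n) * \<psi> n y) w"
    using basis_synthesis[OF basis dom_lmeasurable assms] by blast
  have "elliptic_op \<Omega> a b c (\<lambda>y. \<Sum>n<N. x n * \<psi> n y) (\<lambda>y. \<Sum>n<N. (lam n * x n) * \<psi> n y)" for N
    using elliptic_op_sum[of "{..<N}" \<psi> "\<lambda>n y. lam n * \<psi> n y" x] eigen by (simp add: mult_ac)
  then have "elliptic_op \<Omega> a b c u w" by (rule elliptic_op_closed[OF _ u(2,1) w(2,1)])
  then show ?thesis
    using basis_coefficients[OF basis u(2,1)] basis_coefficients[OF basis w(2,1)] by blast
qed

text \<open>No symmetry of the operator is available, so its coefficients cannot be obtained by moving it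
  onto the eigenfunction. Instead, the shifted operator is injective and the diagonal operator
  already attains every right-hand side, so that the two coincide.\<close>

lemma elliptic_op_coefficients:
  assumes op: "elliptic_op \<Omega> a b c d z"
  shows "L2_inner \<Omega> z (\<psi> n) = lam n * L2_inner \<Omega> d (\<psi> n)"
proof -
  obtain s where s: "0 < s" and inj: "\<And>u w. elliptic_op \<Omega> a b c u w \<Longrightarrow>
      AE x in lebesgue_on \<Omega>. w x + s * u x = 0 \<Longrightarrow> AE x in lebesgue_on \<Omega>. u x = 0"
    using elliptic_op_shift_injective by blast
  note L2 = elliptic_op_L2[OF op] and \<psi>L2 = basis_L2[OF basis]
  define f where "f y = z y + s * d y" for y
  have f: "f \<in> L2 \<Omega>" unfolding f_def using L2 by (intro L2_add L2_scale)
  \<comment> \<open>The diagonal solution of the shifted equation with right-hand side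
    \<open>f\<close>. Since \<open>lam n / (lam n + s)\<close> is at most 1, Bessel's inequality for
    \<open>f\<close> gives the summability required by \<open>diagonal_synthesis\<close>.\<close>
  define x where "x n = L2_inner \<Omega> f (\<psi> n) / (lam n + s)" for n
  have ls: "0 < lam n" "0 < lam n + s" for n using lam_pos lam_ge[of n] s by linarith+
  have "summable (\<lambda>n. (lam n * x n)\<^sup>2)"
  proof (rule summable_comparison_test'[OF bessel_summable[OF basis f]])
    fix n
    have "\<bar>lam n * x n\<bar> = lam n / (lam n + s) * \<bar>L2_inner \<Omega> f (\<psi> n)\<bar>"
      using ls[of n] by (simp add: x_def abs_mult)
    also have "\<dots> \<le> 1 * \<bar>L2_inner \<Omega> f (\<psi> n)\<bar>"
      using ls[of n] s by (intro mult_right_mono) (auto simp: field_simps)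
    finally show "norm ((lam n * x n)\<^sup>2) \<le> (L2_inner \<Omega> f (\<psi> n))\<^sup>2"
      by (simp add: abs_le_square_iff[symmetric])
  qed
  then obtain d0 z0 where op0: "elliptic_op \<Omega> a b c d0 z0"
    and d0: "\<And>n. L2_inner \<Omega> d0 (\<psi> n) = x n" and z0: "\<And>n. L2_inner \<Omega> z0 (\<psi> n) = lam n * x n"
    using diagonal_synthesis by blast
  note L20 = elliptic_op_L2[OF op0]
  have AEf: "AE y in lebesgue_on \<Omega>. z0 y + s * d0 y = f y"
  proof (rule basis_coefficients_eq_imp_AE_eq[OF basis _ f])
    show "(\<lambda>y. z0 y + s * d0 y) \<in> L2 \<Omega>" using L20 by (intro L2_add L2_scale)
    fix n
    have "L2_inner \<Omega> (\<lambda>y. z0 y + s * d0 y) (\<psi> n) = lam n * x n + s * x n"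
      using L20 \<psi>L2 by (simp add: L2_inner_add_left L2_scale L2_inner_scale_left d0 z0)
    also have "\<dots> = L2_inner \<Omega> f (\<psi> n)"
      unfolding x_def distrib_right[symmetric] using ls[of n] by simp
    finally show "L2_inner \<Omega> (\<lambda>y. z0 y + s * d0 y) (\<psi> n) = L2_inner \<Omega> f (\<psi> n)" .
  qed
  have "AE y in lebesgue_on \<Omega>. d y - d0 y = 0"
  proof (rule inj)
    show "elliptic_op \<Omega> a b c (\<lambda>y. d y - d0 y) (\<lambda>y. z y - z0 y)"
      using elliptic_op_lincomb[OF op op0, of 1 "-1"] by simp
    show "AE y in lebesgue_on \<Omega>. z y - z0 y + s * (d y - d0 y) = 0"
      using AEf by eventually_elim (simp add: f_def algebra_simps)
  qed
  then have dd: "AE y in lebesgue_on \<Omega>. d y = d0 y" by eventually_elim simp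
  have zz: "AE y in lebesgue_on \<Omega>. z y = z0 y"
    using AEf dd by eventually_elim (simp add: f_def)
  show ?thesis
    using L2_inner_AE_cong[OF dd L2(1) L20(1) \<psi>L2] L2_inner_AE_cong[OF zz L2(2) L20(2) \<psi>L2]
    by (simp add: d0 z0)
qed

end

section \<open>The collocation matrix\<close>

text \<open>The scaled adjugate exhibits \<open>A\<close> as a unit of the matrix ring, which
  excludes the answer \<open>None\<close>.\<close>

lemma mat_inverse_nonsingular:
  fixes A :: "'a::field mat"
  assumes A: "A \<in> carrier_mat n n" and det: "det A \<noteq> 0"
  shows "the (mat_inverse A) \<in> carrier_mat n n" "A * the (mat_inverse A) = 1\<^sub>m n"
    "the (mat_inverse A) * A = 1\<^sub>m n"
proof -
  define C where "C = (1 / det A) \<cdot>\<^sub>m adj_mat A"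
  have C: "C \<in> carrier_mat n n" using adj_mat(1)[OF A] by (simp add: C_def)
  have "A * C = 1\<^sub>m n" "C * A = 1\<^sub>m n"
    using det A adj_mat[OF A] unfolding C_def
    by (auto simp: mult_smult_distrib[OF A adj_mat(1)[OF A]] mult_smult_assoc_mat[OF adj_mat(1)[OF A] A])
  then have "A \<in> Units (ring_mat TYPE('a) n ())"
    using A C by (auto simp: Units_def ring_mat_def intro!: bexI[of _ C])
  then have "mat_inverse A \<noteq> None" using mat_inverse(1)[OF A, of "()"] by blast
  then show "the (mat_inverse A) \<in> carrier_mat n n" "A * the (mat_inverse A) = 1\<^sub>m n"
    "the (mat_inverse A) * A = 1\<^sub>m n"
    using mat_inverse(2)[OF A, of "the (mat_inverse A)"] by auto
qed

lemma det_mat_diag: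
  fixes f :: "nat \<Rightarrow> 'a::idom"
  shows "det (mat_diag n f) = (\<Prod>i<n. f i)"
proof -
  have "det (mat_diag n f) = prod_list (diag_mat (mat_diag n f))"
    by (rule det_upper_triangular[of _ n]) (auto simp: mat_diag_def upper_triangular_def)
  also have "diag_mat (mat_diag n f) = map f [0..<n]"
    by (auto simp: diag_mat_def mat_diag_def)
  also have "prod_list (map f [0..<n]) = (\<Prod>i<n. f i)"
    by (simp add: prod.distinct_set_conv_list[symmetric] atLeast0LessThan)
  finally show ?thesis .
qed

lemma collocation_nodesD:
  assumes "collocation_nodes m \<theta>"
  shows "l < Suc m \<Longrightarrow> 0 < \<theta> l" "l < Suc m \<Longrightarrow> \<theta> l \<le> 1" "strict_mono_on {..<Suc m} \<theta>"
proof -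
  have 0: "0 < \<theta> 0" "\<theta> m \<le> 1" and mono: "strict_mono_on {..m} \<theta>"
    using assms by (auto simp: collocation_nodes_def)
  show "0 < \<theta> l" if "l < Suc m"
    using that strict_mono_onD[OF mono, of 0 l] 0 by (cases "l = 0") auto
  show "\<theta> l \<le> 1" if "l < Suc m"
    using that strict_mono_onD[OF mono, of l m] 0 by (cases "l = m") auto
  show "strict_mono_on {..<Suc m} \<theta>" using mono by (simp add: lessThan_Suc_atMost)
qed

text \<open>The diagonal entries of \<open>D2_matrix\<close>: the fractional integral of order
  \<alpha> maps t^j to this multiple of t^(j+\<alpha>).\<close>

definition frac_coeff :: "real \<Rightarrow> nat \<Rightarrow> real" where
  "frac_coeff \<alpha> j = Gamma (real j + 1) / Gamma (real j + 1 + \<alpha>)"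

lemma frac_coeff_pos: "0 < \<alpha> \<Longrightarrow> 0 < frac_coeff \<alpha> j"
  by (simp add: frac_coeff_def)

text \<open>The two weights cover every matrix that occurs: \<open>q = 0\<close> is the Vandermonde
  matrix, \<open>p = 0\<close> the fractional integrals of the monomials at the nodes,
  \<open>p = 1\<close> the systems of the eigenmodes, and \<open>q = 1\<close> with small
  \<open>p\<close> those systems after division by their parameter.\<close>

lemma det_collocation_pos:
  assumes "0 < \<alpha>" "\<alpha> < 1" "collocation_nodes m \<theta>" "0 \<le> p" "0 \<le> q" "0 < p + q"
  shows "0 < det (Matrix.mat (Suc m) (Suc m)
    (\<lambda>(i, j). p * \<theta> i ^ j + q * (frac_coeff \<alpha> j * \<theta> i powr (real j + \<alpha>))))"
proof -
  have "0 < det (Matrix.mat (Suc m) (Suc m)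
    (\<lambda>(i, j). p * \<theta> i ^ j + (q * frac_coeff \<alpha> j) * \<theta> i powr (real j + \<alpha>)))"
  proof (rule det_mixed_vandermonde_pos[OF _ collocation_nodesD(3)[OF assms(3)] assms(1,2)])
    fix j
    have "0 \<le> q * frac_coeff \<alpha> j" using assms frac_coeff_pos[of \<alpha> j] by simp
    moreover have "0 < q * frac_coeff \<alpha> j" if "0 < q" using that assms frac_coeff_pos[of \<alpha> j] by simp
    ultimately show "0 \<le> p \<and> 0 \<le> q * frac_coeff \<alpha> j \<and> 0 < p + q * frac_coeff \<alpha> j"
      using assms by (cases "q = 0") (auto intro: add_nonneg_pos)
  qed (use collocation_nodesD(1)[OF assms(3)] in auto)
  then show ?thesis by (simp add: mult.assoc)
qed

text \<open>For \<open>v = D2 *\<^sub>v u\<close> the eigenvalue equation, freed of its inverses,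
  says that W u equals \<mu> D1 W D2 u. Row i is a homogeneous equation with the entries of
  \<open>det_collocation_pos\<close> for the weights 1 and \<open>- \<mu> > 0\<close>, so
  \<open>u\<close> vanishes.\<close>

lemma collocation_matrix_no_neg_eigenvalue:
  assumes \<alpha>: "0 < \<alpha>" "\<alpha> < 1" and nodes: "collocation_nodes m \<theta>" and \<mu>: "\<mu> < 0"
  shows "\<not> eigenvalue (collocation_matrix m \<alpha> \<theta>) \<mu>"
proof
  define n where "n = Suc m"
  define W where "W = vandermonde_matrix m \<theta>"
  define D1 where "D1 = D1_matrix m \<alpha> \<theta>"
  define D2 where "D2 = D2_matrix m \<alpha>"
  have W: "W \<in> carrier_mat n n" and D1: "D1 \<in> carrier_mat n n" and D2: "D2 \<in> carrier_mat n n"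
    by (simp_all add: W_def D1_def D2_def n_def vandermonde_matrix_def D1_matrix_def D2_matrix_def)
  note \<theta>pos = collocation_nodesD(1)[OF nodes, folded n_def]
  have "det W \<noteq> 0"
    using det_collocation_pos[OF \<alpha> nodes, of 1 0] by (simp add: W_def vandermonde_matrix_def)
  note Wi = mat_inverse_nonsingular[OF W this]
  have "det D1 \<noteq> 0"
    unfolding D1_def D1_matrix_def det_mat_diag prod_zero_iff[OF finite_lessThan]
    using \<theta>pos by (force simp: n_def)
  note D1i = mat_inverse_nonsingular[OF D1 this]
  have "det D2 \<noteq> 0"
    using frac_coeff_pos[OF \<alpha>(1)]
    by (auto simp: D2_def D2_matrix_def det_mat_diag frac_coeff_def[symmetric] less_imp_neq[symmetric])
  note D2i = mat_inverse_nonsingular[OF D2 this]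
  let ?Wi = "the (mat_inverse W)" and ?D1i = "the (mat_inverse D1)" and ?D2i = "the (mat_inverse D2)"
  assume "eigenvalue (collocation_matrix m \<alpha> \<theta>) \<mu>"
  then obtain v where v: "v \<in> carrier_vec n" "v \<noteq> 0\<^sub>v n"
      and ev: "(?Wi * ?D1i * W * ?D2i) *\<^sub>v v = \<mu> \<cdot>\<^sub>v v"
    using Wi(1) unfolding eigenvalue_def eigenvector_def collocation_matrix_def
    by (auto simp: W_def D1_def D2_def)
  define u where "u = ?D2i *\<^sub>v v"
  have u: "u \<in> carrier_vec n" using D2i(1) v by (simp add: u_def)
  have vu: "v = D2 *\<^sub>v u"
    using v D2 D2i by (simp add: u_def assoc_mult_mat_vec[OF D2 D2i(1), symmetric])

  have e1: "?Wi *\<^sub>v (?D1i *\<^sub>v (W *\<^sub>v u)) = \<mu> \<cdot>\<^sub>v v"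
    using ev v W Wi(1) D1i(1) D2i(1) by (simp add: u_def assoc_mult_mat_vec[of _ n n _ n])
  have "W *\<^sub>v (?Wi *\<^sub>v (?D1i *\<^sub>v (W *\<^sub>v u))) = ?D1i *\<^sub>v (W *\<^sub>v u)"
    using W Wi D1i(1) u by (simp add: assoc_mult_mat_vec[OF W Wi(1), symmetric])
  then have e2: "?D1i *\<^sub>v (W *\<^sub>v u) = W *\<^sub>v (\<mu> \<cdot>\<^sub>v v)" by (simp add: e1)
  have "D1 *\<^sub>v (?D1i *\<^sub>v (W *\<^sub>v u)) = W *\<^sub>v u"
    using W D1 D1i u by (simp add: assoc_mult_mat_vec[OF D1 D1i(1), symmetric])
  then have e3: "W *\<^sub>v u = D1 *\<^sub>v (W *\<^sub>v (\<mu> \<cdot>\<^sub>v (D2 *\<^sub>v u)))" by (simp add: e2 vu[symmetric])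
  have diag: "(mat_diag n f *\<^sub>v x) $ i = f i * x $ i" if "x \<in> carrier_vec n" "i < n" for f x i
    using that by (simp add: mat_diag_def scalar_prod_def if_distrib[of "\<lambda>z. z * _"] cong: if_cong)
  have "D2 = mat_diag n (frac_coeff \<alpha>)"
    by (simp add: D2_def D2_matrix_def n_def frac_coeff_def[abs_def])
  then have D2u: "(D2 *\<^sub>v u) $ j = frac_coeff \<alpha> j * u $ j" if "j < n" for j
    using diag[OF u that] by simp
  have Wv: "(W *\<^sub>v x) $ i = (\<Sum>j<n. \<theta> i ^ j * x $ j)" if "x \<in> carrier_vec n" "i < n" for x i
    using that by (simp add: W_def vandermonde_matrix_def scalar_prod_def n_def atLeast0LessThan)
  have "(\<Sum>j<n. (1 * \<theta> i ^ j + (- \<mu>) * (frac_coeff \<alpha> j * \<theta> i powr (real j + \<alpha>))) * u $ j) = 0"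
    if i: "i < n" for i
  proof -
    have "(\<Sum>j<n. \<theta> i ^ j * u $ j) = (W *\<^sub>v u) $ i" by (rule Wv[OF u i, symmetric])
    also have "\<dots> = \<theta> i powr \<alpha> * (W *\<^sub>v (\<mu> \<cdot>\<^sub>v (D2 *\<^sub>v u))) $ i"
      unfolding e3 using W D2 u i diag[of "W *\<^sub>v (\<mu> \<cdot>\<^sub>v (D2 *\<^sub>v u))" i "\<lambda>l. \<theta> l powr \<alpha>"]
      by (simp add: D1_def D1_matrix_def n_def)
    also have "(W *\<^sub>v (\<mu> \<cdot>\<^sub>v (D2 *\<^sub>v u))) $ i = (\<Sum>j<n. \<theta> i ^ j * (\<mu> * (frac_coeff \<alpha> j * u $ j)))"
      using D2 D2u unfolding Wv[OF smult_carrier_vec[THEN iffD2, OF mult_mat_vec_carrier[OF D2 u]] i]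
      by (intro sum.cong refl) auto
    also have "\<theta> i powr \<alpha> * \<dots> = (\<Sum>j<n. \<mu> * (frac_coeff \<alpha> j * \<theta> i powr (real j + \<alpha>)) * u $ j)"
      unfolding sum_distrib_left using \<theta>pos[OF i]
      by (intro sum.cong refl) (simp add: powr_add powr_realpow)
    finally show ?thesis by (simp add: left_diff_distrib sum_subtractf mult.assoc)
  qed
  then have "u $ j = 0" if "j < n" for j
    using linear_system_unique[of n "\<lambda>i j. 1 * \<theta> i ^ j + (- \<mu>) * (frac_coeff \<alpha> j * \<theta> i powr (real j + \<alpha>))" "\<lambda>j. u $ j"]
      det_collocation_pos[OF \<alpha> nodes, of 1 "- \<mu>"] \<mu> that by (simp add: n_def)
  then have "u = 0\<^sub>v n" using u by (intro eq_vecI) auto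
  then have "v = 0\<^sub>v n" using vu D2 by auto
  then show False using v by simp
qed

section \<open>Fractional integrals of polynomials\<close>

text \<open>The substitution s = t r scales the integral to the Beta integral with parameters j + 1
  and \<alpha>, whose Gamma quotient is \<Gamma>(\<alpha>) times \<open>frac_coeff\<close>. The
  exponent \<open>real j + 1 - 1\<close> and the summand \<open>0\<close> in
  \<open>0 + t * r\<close> are kept to fit the Beta integrand and the affine change of
  variables.\<close>

lemma frac_int_monomial:
  assumes \<alpha>: "0 < \<alpha>" and t: "0 < t"
  shows "set_integrable lborel {0<..<t} (\<lambda>s. (t - s) powr (\<alpha> - 1) * s ^ j)"
    "(LINT s:{0<..<t}|lborel. (t - s) powr (\<alpha> - 1) * s ^ j) =
      Gamma \<alpha> * (frac_coeff \<alpha> j * t powr (real j + \<alpha>))"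
proof -
  let ?h = "\<lambda>r::real. r powr (real j + 1 - 1) * (1 - r) powr (\<alpha> - 1)"
  have I: "set_integrable lborel {0<..<1} ?h"
    using \<alpha> by (intro set_integrable_subset[OF integrable_Beta]) auto
  have "(?h has_integral Beta (real j + 1) \<alpha>) {0<..<1}"
    using has_integral_Beta_real[of "real j + 1" \<alpha>] \<alpha> by (simp add: has_integral_Icc_iff_Ioo)
  then have "(LINT r:{0<..<1}|lborel. ?h r) = Beta (real j + 1) \<alpha>"
    using set_borel_integral_eq_integral(2)[OF I] by (simp add: integral_unique)
  then have hb: "has_bochner_integral lborel (\<lambda>r. indicator {0<..<1} r *\<^sub>R ?h r) (Beta (real j + 1) \<alpha>)"
    using I by (simp add: has_bochner_integral_iff set_integrable_def set_lebesgue_integral_def)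
  have cancel: "inverse t * (t * X) = X" for X using t by (simp add: field_simps)
  from has_bochner_integral_mult_right[OF hb, of "t powr (real j + \<alpha> - 1)"]
  have "has_bochner_integral lborel (\<lambda>r. t powr (real j + \<alpha> - 1) * (indicator {0<..<1} r *\<^sub>R ?h r))
      (t powr (real j + \<alpha> - 1) * Beta (real j + 1) \<alpha>)" by simp
  also have "(\<lambda>r. t powr (real j + \<alpha> - 1) * (indicator {0<..<1} r *\<^sub>R ?h r)) =
      (\<lambda>r. indicator {0<..<t} (0 + t * r) *\<^sub>R ((t - (0 + t * r)) powr (\<alpha> - 1) * (0 + t * r) ^ j))"
  proof
    fix r :: real
    show "t powr (real j + \<alpha> - 1) * (indicator {0<..<1} r *\<^sub>R ?h r) =
      indicator {0<..<t} (0 + t * r) *\<^sub>R ((t - (0 + t * r)) powr (\<alpha> - 1) * (0 + t * r) ^ j)"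
    proof (cases "0 < r \<and> r < 1")
      case True
      have "(t - t * r) powr (\<alpha> - 1) = t powr (\<alpha> - 1) * (1 - r) powr (\<alpha> - 1)"
        using t True by (simp add: powr_mult[symmetric] right_diff_distrib)
      moreover have "(t * r) ^ j = t powr real j * r powr real j"
        using t True by (simp add: powr_realpow power_mult_distrib)
      moreover have "t powr (real j + \<alpha> - 1) = t powr (\<alpha> - 1) * t powr real j"
        by (simp add: powr_add[symmetric] algebra_simps)
      ultimately show ?thesis using t True by simp
    next
      case False
      then have "t * r \<notin> {0<..<t}" using t by (auto simp: zero_less_mult_iff)
      then show ?thesis using False by auto
    qed
  qed
  finally have "has_bochner_integral lborel
      (\<lambda>r. indicator {0<..<t} (0 + t * r) *\<^sub>R ((t - (0 + t * r)) powr (\<alpha> - 1) * (0 + t * r) ^ j))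
      ((t * (t powr (real j + \<alpha> - 1) * Beta (real j + 1) \<alpha>)) /\<^sub>R \<bar>t\<bar>)"
    using t by (simp add: cancel)
  then have *: "has_bochner_integral lborel (\<lambda>s. indicator {0<..<t} s *\<^sub>R ((t - s) powr (\<alpha> - 1) * s ^ j))
      (t * (t powr (real j + \<alpha> - 1) * Beta (real j + 1) \<alpha>))"
    by (rule iffD2[OF lborel_has_bochner_integral_real_affine_iff[where t = 0, OF less_imp_neq[OF t, symmetric]]])
  then show "set_integrable lborel {0<..<t} (\<lambda>s. (t - s) powr (\<alpha> - 1) * s ^ j)"
    by (simp add: has_bochner_integral_iff set_integrable_def)
  have "t * t powr (real j + \<alpha> - 1) = t powr (real j + \<alpha>)"
    using t by (simp add: powr_diff)
  then have "t * (t powr (real j + \<alpha> - 1) * Beta (real j + 1) \<alpha>) = t powr (real j + \<alpha>) * Beta (real j + 1) \<alpha>"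
    by (simp add: mult.assoc[symmetric])
  also have "\<dots> = Gamma \<alpha> * (frac_coeff \<alpha> j * t powr (real j + \<alpha>))"
    by (simp add: Beta_def frac_coeff_def)
  finally show "(LINT s:{0<..<t}|lborel. (t - s) powr (\<alpha> - 1) * s ^ j) =
      Gamma \<alpha> * (frac_coeff \<alpha> j * t powr (real j + \<alpha>))"
    using * by (simp add: has_bochner_integral_iff set_lebesgue_integral_def)
qed

lemma frac_int_polynomial:
  assumes \<alpha>: "0 < \<alpha>" and t: "0 < t" "t \<le> 1"
    and v: "\<And>s. s \<in> {0<..1} \<Longrightarrow> v s = (\<Sum>j<n. d j * s ^ j)"
  shows "frac_int \<alpha> v t = (\<Sum>j<n. frac_coeff \<alpha> j * t powr (real j + \<alpha>) * d j)"
proof -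
  note mono = frac_int_monomial[OF \<alpha> t(1)]
  have "(LINT s:{0<..<t}|lborel. (t - s) powr (\<alpha> - 1) * v s) =
      (LINT s:{0<..<t}|lborel. (\<Sum>j<n. d j * ((t - s) powr (\<alpha> - 1) * s ^ j)))"
    using t v by (intro set_lebesgue_integral_cong) (auto simp: sum_distrib_left mult_ac)
  also have "\<dots> = (\<Sum>j<n. LINT s:{0<..<t}|lborel. d j * ((t - s) powr (\<alpha> - 1) * s ^ j))"
    unfolding set_lebesgue_integral_def scaleR_sum_right
    by (rule Bochner_Integration.integral_sum)
      (rule set_integrable_mult_right[OF mono(1), unfolded set_integrable_def])
  also have "\<dots> = (\<Sum>j<n. d j * (Gamma \<alpha> * (frac_coeff \<alpha> j * t powr (real j + \<alpha>))))"
    by (simp add: mono(2))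
  also have "\<dots> = Gamma \<alpha> * (\<Sum>j<n. frac_coeff \<alpha> j * t powr (real j + \<alpha>) * d j)"
    by (simp add: sum_distrib_left mult_ac)
  finally show ?thesis using Gamma_real_pos[OF \<alpha>] by (simp add: frac_int_def)
qed

section \<open>The collocation problem\<close>

context elliptic_coefficients
begin

text \<open>Together with the next lemma this reduces the problem to coefficient functions
  \<open>d j\<close> in the domain of the operator with images \<open>z j\<close>: the fractional
  integral at a node is a fixed linear combination of the \<open>d j\<close>, and the operator acts
  on it by linearity.\<close>

lemma collocation_solutionI:
  assumes \<alpha>: "0 < \<alpha>" and nodes: "collocation_nodes m \<theta>"
    and op: "\<And>j. j < Suc m \<Longrightarrow> elliptic_op \<Omega> a b c (d j) (z j)"
    and eq: "\<And>l. l < Suc m \<Longrightarrow> AE x in lebesgue_on \<Omega>. (\<Sum>j<Suc m. \<theta> l ^ j * d j x) +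
      \<tau> powr \<alpha> * (\<Sum>j<Suc m. frac_coeff \<alpha> j * \<theta> l powr (real j + \<alpha>) * z j x) = F x (\<theta> l)"
  shows "collocation_solution \<Omega> a b c \<alpha> \<tau> m \<theta> F (\<lambda>x t. \<Sum>j<Suc m. t ^ j * d j x)"
  unfolding collocation_solution_def
proof (intro conjI ballI allI impI)
  fix x
  show "\<exists>p. degree p \<le> m \<and> (\<forall>t\<in>{0<..1}. (\<Sum>j<Suc m. t ^ j * d j x) = poly p t)"
  proof (intro exI conjI ballI)
    show "degree (\<Sum>j<Suc m. monom (d j x) j) \<le> m"
      by (rule degree_sum_le) (auto intro: order_trans[OF degree_monom_le])
    fix t :: real
    show "(\<Sum>j<Suc m. t ^ j * d j x) = poly (\<Sum>j<Suc m. monom (d j x) j) t"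
      by (simp only: poly_sum poly_monom mult.commute)
  qed
next
  fix t :: real
  show "(\<lambda>x. \<Sum>j<Suc m. t ^ j * d j x) \<in> H10 \<Omega>"
    using elliptic_op_H10[OF elliptic_op_sum[of "{..<Suc m}" d z "\<lambda>j. t ^ j"]] op by blast
next
  fix l assume "l \<le> m"
  then have l: "l < Suc m" by simp
  note \<theta> = collocation_nodesD(1,2)[OF nodes l]
  let ?B = "\<lambda>j. frac_coeff \<alpha> j * \<theta> l powr (real j + \<alpha>)"
  have "(\<lambda>x. frac_int \<alpha> (\<lambda>t. \<Sum>j<Suc m. t ^ j * d j x) (\<theta> l)) = (\<lambda>x. \<Sum>j<Suc m. ?B j * d j x)"
  proof
    fix x
    show "frac_int \<alpha> (\<lambda>t. \<Sum>j<Suc m. t ^ j * d j x) (\<theta> l) = (\<Sum>j<Suc m. ?B j * d j x)"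
      by (rule frac_int_polynomial[OF \<alpha> \<theta>]) (simp only: mult.commute)
  qed
  moreover have "elliptic_op \<Omega> a b c (\<lambda>x. \<Sum>j<Suc m. ?B j * d j x) (\<lambda>x. \<Sum>j<Suc m. ?B j * z j x)"
    by (rule elliptic_op_sum) (use op in auto)
  ultimately show "\<exists>w. elliptic_op \<Omega> a b c (\<lambda>x. frac_int \<alpha> (\<lambda>t. \<Sum>j<Suc m. t ^ j * d j x) (\<theta> l)) w \<and>
      (AE x in lebesgue_on \<Omega>. (\<Sum>j<Suc m. \<theta> l ^ j * d j x) + \<tau> powr \<alpha> * w x = F x (\<theta> l))"
    using eq[OF l] by (intro exI[of _ "\<lambda>x. \<Sum>j<Suc m. ?B j * z j x"] conjI) (simp_all only:)
qed

text \<open>A solution puts only the fractional integrals at the nodes, that is m + 1 combinations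
  of its coefficients, into the domain of the operator. The matrix \<open>?A\<close> of these
  combinations is invertible, so each coefficient is in turn a combination of them.\<close>

lemma collocation_solutionE:
  assumes \<alpha>: "0 < \<alpha>" "\<alpha> < 1" and nodes: "collocation_nodes m \<theta>"
    and sol: "collocation_solution \<Omega> a b c \<alpha> \<tau> m \<theta> F U"
  obtains d z where "\<And>x t. x \<in> \<Omega> \<Longrightarrow> t \<in> {0<..1} \<Longrightarrow> U x t = (\<Sum>j<Suc m. t ^ j * d j x)"
    and "\<And>j. j < Suc m \<Longrightarrow> elliptic_op \<Omega> a b c (d j) (z j)"
    and "\<And>l. l < Suc m \<Longrightarrow> AE x in lebesgue_on \<Omega>. (\<Sum>j<Suc m. \<theta> l ^ j * d j x) +
      \<tau> powr \<alpha> * (\<Sum>j<Suc m. frac_coeff \<alpha> j * \<theta> l powr (real j + \<alpha>) * z j x) = F x (\<theta> l)"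
proof -
  note \<theta> = collocation_nodesD(1,2)[OF nodes]
  have "\<forall>x. \<exists>p :: real poly. x \<in> \<Omega> \<longrightarrow> degree p \<le> m \<and> (\<forall>t \<in> {0<..1}. U x t = poly p t)"
    using sol unfolding collocation_solution_def by blast
  then obtain p :: "'a \<Rightarrow> real poly" where
    p: "\<And>x. x \<in> \<Omega> \<Longrightarrow> degree (p x) \<le> m \<and> (\<forall>t \<in> {0<..1}. U x t = poly (p x) t)"
    using choice by metis
  have U: "U x t = (\<Sum>j<Suc m. t ^ j * coeff (p x) j)" if "x \<in> \<Omega>" "t \<in> {0<..1}" for x t
  proof -
    have "poly (p x) t = poly (\<Sum>j\<le>m. monom (coeff (p x) j) j) t"
      using p[OF that(1)] by (simp only: poly_as_sum_of_monoms')
    then have "poly (p x) t = (\<Sum>j\<le>m. coeff (p x) j * t ^ j)"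
      by (simp only: poly_sum poly_monom)
    then show ?thesis using p[OF that(1)] that(2) by (simp only: lessThan_Suc_atMost mult.commute)
  qed
  let ?A = "\<lambda>l j. frac_coeff \<alpha> j * \<theta> l powr (real j + \<alpha>)"
  obtain w where w: "\<And>l. l < Suc m \<Longrightarrow> elliptic_op \<Omega> a b c (\<lambda>x. frac_int \<alpha> (U x) (\<theta> l)) (w l)"
    and F: "\<And>l. l < Suc m \<Longrightarrow> AE x in lebesgue_on \<Omega>. U x (\<theta> l) + \<tau> powr \<alpha> * w l x = F x (\<theta> l)"
  proof -
    have "\<forall>l. \<exists>w. l < Suc m \<longrightarrow> elliptic_op \<Omega> a b c (\<lambda>x. frac_int \<alpha> (U x) (\<theta> l)) w \<and>
        (AE x in lebesgue_on \<Omega>. U x (\<theta> l) + \<tau> powr \<alpha> * w x = F x (\<theta> l))"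
      using sol unfolding collocation_solution_def less_Suc_eq_le by blast
    from choice[OF this] show ?thesis using that by blast
  qed
  have "det (Matrix.mat (Suc m) (Suc m) (\<lambda>(l, j). ?A l j)) \<noteq> 0"
    using det_collocation_pos[OF \<alpha> nodes, of 0 1] by simp
  from linear_system_inverse[OF this] obtain B where
    "\<forall>i<Suc m. \<forall>k<Suc m. (\<Sum>j<Suc m. ?A i j * B j k) = (if i = k then 1 else 0)
      \<and> (\<Sum>j<Suc m. B i j * ?A j k) = (if i = k then 1 else 0)" ..
  then have B: "\<And>i k. i < Suc m \<Longrightarrow> k < Suc m \<Longrightarrow> (\<Sum>j<Suc m. ?A i j * B j k) = (if i = k then 1 else 0)"
    "\<And>i k. i < Suc m \<Longrightarrow> k < Suc m \<Longrightarrow> (\<Sum>j<Suc m. B i j * ?A j k) = (if i = k then 1 else 0)"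
    by blast+
  \<comment> \<open>The images \<open>w l\<close> are combined exactly as the fractional integrals
    are combined to \<open>d j\<close>. That \<open>B\<close> inverts \<open>?A\<close> from the
    left identifies \<open>d j\<close>; that it does so from the right returns \<open>w l\<close> in
    the equations.\<close>
  define z where "z j x = (\<Sum>l<Suc m. B j l * w l x)" for j x
  show thesis
  proof (rule that)
    show "U x t = (\<Sum>j<Suc m. t ^ j * coeff (p x) j)" if "x \<in> \<Omega>" "t \<in> {0<..1}" for x t
      using U that by blast
    show "elliptic_op \<Omega> a b c (\<lambda>x. coeff (p x) j) (z j)" if j: "j < Suc m" for j
    proof (rule elliptic_op_cong)
      show "elliptic_op \<Omega> a b c (\<lambda>x. \<Sum>l<Suc m. B j l * frac_int \<alpha> (U x) (\<theta> l)) (z j)"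
        unfolding z_def[abs_def] by (rule elliptic_op_sum) (use w in auto)
      fix x assume x: "x \<in> \<Omega>"
      have "frac_int \<alpha> (U x) (\<theta> l) = (\<Sum>k<Suc m. ?A l k * coeff (p x) k)" if "l < Suc m" for l
        by (rule frac_int_polynomial[OF \<alpha>(1) \<theta>[OF that]]) (simp only: U[OF x] mult.commute)
      then have "(\<Sum>l<Suc m. B j l * frac_int \<alpha> (U x) (\<theta> l)) =
          (\<Sum>l<Suc m. \<Sum>k<Suc m. B j l * ?A l k * coeff (p x) k)"
        by (intro sum.cong refl) (simp only: lessThan_iff sum_distrib_left mult.assoc)
      also have "\<dots> = (\<Sum>k<Suc m. (\<Sum>l<Suc m. B j l * ?A l k) * coeff (p x) k)"
        by (subst sum.swap) (simp only: sum_distrib_right)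
      also have "\<dots> = (\<Sum>k<Suc m. (if j = k then 1 else 0) * coeff (p x) k)"
        using B(2)[OF j] by (intro sum.cong refl) (simp only: lessThan_iff)
      also have "\<dots> = coeff (p x) j"
        by (rule sum_delta_mult[OF j])
      finally show "(\<Sum>l<Suc m. B j l * frac_int \<alpha> (U x) (\<theta> l)) = coeff (p x) j" .
    qed
    fix l assume l: "l < Suc m"
    have Az: "(\<Sum>j<Suc m. ?A l j * z j x) = w l x" for x
    proof -
      have "(\<Sum>j<Suc m. ?A l j * z j x) = (\<Sum>j<Suc m. \<Sum>k<Suc m. ?A l j * B j k * w k x)"
        unfolding z_def by (simp only: sum_distrib_left mult.assoc)
      also have "\<dots> = (\<Sum>k<Suc m. (\<Sum>j<Suc m. ?A l j * B j k) * w k x)"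
        by (subst sum.swap) (simp only: sum_distrib_right)
      also have "\<dots> = (\<Sum>k<Suc m. (if l = k then 1 else 0) * w k x)"
        using B(1)[OF l] by (intro sum.cong refl) (simp only: lessThan_iff)
      also have "\<dots> = w l x"
        by (rule sum_delta_mult[OF l])
      finally show ?thesis .
    qed
    have tl: "\<theta> l \<in> {0<..1}" using \<theta>[OF l] by simp
    show "AE x in lebesgue_on \<Omega>. (\<Sum>j<Suc m. \<theta> l ^ j * coeff (p x) j) +
        \<tau> powr \<alpha> * (\<Sum>j<Suc m. ?A l j * z j x) = F x (\<theta> l)"
      using F[OF l] AE_space unfolding Az
    proof eventually_elim
      case (elim x)
      then have "x \<in> \<Omega>" by simp
      then show ?case using elim(1) U[OF _ tl] by simp
    qed
  qed
qed

end

context elliptic_eigenbasis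
begin

text \<open>An L2 identity holds almost everywhere iff all coefficients agree, and on coefficients
  the operator is multiplication by \<open>lam n\<close>. The redundant factor 1 keeps the sums in
  the shape of \<open>det_collocation_pos\<close> with \<open>p = 1\<close>.\<close>

lemma collocation_coefficients:
  assumes op: "\<And>j. j < Suc m \<Longrightarrow> elliptic_op \<Omega> a b c (d j) (z j)"
    and F: "F \<in> L2 \<Omega>"
  shows "(AE x in lebesgue_on \<Omega>. (\<Sum>j<Suc m. s ^ j * d j x) + q * (\<Sum>j<Suc m. A j * z j x) = F x) \<longleftrightarrow>
    (\<forall>n. (\<Sum>j<Suc m. (1 * s ^ j + q * lam n * A j) * L2_inner \<Omega> (d j) (\<psi> n)) =
      L2_inner \<Omega> F (\<psi> n))"
proof -
  let ?f = "\<lambda>x. (\<Sum>j<Suc m. s ^ j * d j x) + q * (\<Sum>j<Suc m. A j * z j x)"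
  note \<psi>L2 = basis_L2[OF basis]
  have d: "d j \<in> L2 \<Omega>" and z: "z j \<in> L2 \<Omega>"
    and dz: "L2_inner \<Omega> (z j) (\<psi> n) = lam n * L2_inner \<Omega> (d j) (\<psi> n)" if "j < Suc m" for j n
    using elliptic_op_L2[OF op[OF that]] elliptic_op_coefficients[OF op[OF that]] by auto
  have dL2: "(\<lambda>x. \<Sum>j<Suc m. s ^ j * d j x) \<in> L2 \<Omega>" and zL2: "(\<lambda>x. \<Sum>j<Suc m. A j * z j x) \<in> L2 \<Omega>"
    using d z by (auto intro!: L2_sum L2_scale simp del: sum.lessThan_Suc)
  have f: "?f \<in> L2 \<Omega>" by (intro L2_add L2_scale dL2 zL2)
  have inner: "L2_inner \<Omega> ?f (\<psi> n) =
      (\<Sum>j<Suc m. (1 * s ^ j + q * lam n * A j) * L2_inner \<Omega> (d j) (\<psi> n))" for n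
  proof -
    have "L2_inner \<Omega> ?f (\<psi> n) = L2_inner \<Omega> (\<lambda>x. \<Sum>j<Suc m. s ^ j * d j x) (\<psi> n) +
        q * L2_inner \<Omega> (\<lambda>x. \<Sum>j<Suc m. A j * z j x) (\<psi> n)"
      by (simp only: L2_inner_add_left[OF dL2 L2_scale[OF zL2] \<psi>L2] L2_inner_scale_left)
    also have "L2_inner \<Omega> (\<lambda>x. \<Sum>j<Suc m. s ^ j * d j x) (\<psi> n) =
        (\<Sum>j<Suc m. s ^ j * L2_inner \<Omega> (d j) (\<psi> n))"
      by (subst L2_inner_sum_left) (auto simp: d L2_scale \<psi>L2 L2_inner_scale_left simp del: sum.lessThan_Suc)
    also have "L2_inner \<Omega> (\<lambda>x. \<Sum>j<Suc m. A j * z j x) (\<psi> n) =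
        (\<Sum>j<Suc m. A j * (lam n * L2_inner \<Omega> (d j) (\<psi> n)))"
      by (subst L2_inner_sum_left) (auto simp: z dz L2_scale \<psi>L2 L2_inner_scale_left simp del: sum.lessThan_Suc)
    also have "(\<Sum>j<Suc m. s ^ j * L2_inner \<Omega> (d j) (\<psi> n)) +
        q * (\<Sum>j<Suc m. A j * (lam n * L2_inner \<Omega> (d j) (\<psi> n))) =
        (\<Sum>j<Suc m. (1 * s ^ j + q * lam n * A j) * L2_inner \<Omega> (d j) (\<psi> n))"
      unfolding sum_distrib_left sum.distrib[symmetric]
      by (intro sum.cong refl) (simp add: algebra_simps)
    finally show ?thesis .
  qed
  show ?thesis
    unfolding inner[symmetric]
    using L2_inner_AE_cong[OF _ f F \<psi>L2] basis_coefficients_eq_imp_AE_eq[OF basis f F] by blast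
qed

text \<open>Each eigenmode is a solvable linear system. The point is that its solutions assemble to
  functions in the domain, for which \<open>lam n * x n j\<close>, and not just
  \<open>x n j\<close>, must be square-summable over \<open>n\<close>.\<close>

lemma collocation_exists:
  assumes \<alpha>: "0 < \<alpha>" "\<alpha> < 1" and nodes: "collocation_nodes m \<theta>" and \<tau>: "0 < \<tau>"
    and F: "\<And>l. l < Suc m \<Longrightarrow> (\<lambda>x. F x (\<theta> l)) \<in> L2 \<Omega>"
  shows "\<exists>d. collocation_solution \<Omega> a b c \<alpha> \<tau> m \<theta> F (\<lambda>x t. \<Sum>j<Suc m. t ^ j * d j x)"
proof -
  let ?N = "Suc m"
  let ?A = "\<lambda>l j. frac_coeff \<alpha> j * \<theta> l powr (real j + \<alpha>)"
  define q where "q = \<tau> powr \<alpha>"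
  have q: "0 < q" using \<tau> by (simp add: q_def)
  have lamp: "0 < lam n" for n using lam_pos lam_ge[of n] by linarith
  define \<phi> where "\<phi> n l = L2_inner \<Omega> (\<lambda>x. F x (\<theta> l)) (\<psi> n)" for n l
  have "\<forall>n. \<exists>x. \<forall>l<?N. (\<Sum>j<?N. (1 * \<theta> l ^ j + q * lam n * ?A l j) * x j) = \<phi> n l"
  proof
    fix n
    let ?G = "\<lambda>l j. 1 * \<theta> l ^ j + q * lam n * ?A l j"
    have "0 < q * lam n" using q lamp by simp
    then have "det (Matrix.mat ?N ?N (\<lambda>(l, j). ?G l j)) \<noteq> 0"
      using det_collocation_pos[OF \<alpha> nodes, of 1 "q * lam n"] by simp
    then show "\<exists>x. \<forall>l<?N. (\<Sum>j<?N. ?G l j * x j) = \<phi> n l"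
      by (rule linear_system_solution)
  qed
  from choice[OF this] obtain x where
    x: "\<And>n l. l < ?N \<Longrightarrow> (\<Sum>j<?N. (1 * \<theta> l ^ j + q * lam n * ?A l j) * x n j) = \<phi> n l"
    by blast
  \<comment> \<open>An upper bound for all \<open>1 / (q * lam n)\<close>, since
    \<open>lam 0\<close> is the smallest eigenvalue. The interval from 0 to \<open>E\<close>
    includes the limit of infinitely large eigenvalues, where the matrix is still
    nonsingular.\<close>
  define E where "E = 1 / (q * lam 0)"
  have "\<exists>C\<ge>0. \<forall>t\<in>{0..E}. \<forall>v. \<forall>j<?N. \<bar>v j\<bar> \<le> C * (\<Sum>i<?N. \<bar>\<Sum>k<?N. (t * \<theta> i ^ k + 1 * ?A i k) * v k\<bar>)"
  proof (rule uniform_inverse_bound)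
    show "continuous_on {0..E} (\<lambda>t. t * \<theta> i ^ j + 1 * ?A i j)" for i j
      by (intro continuous_intros)
    show "det (Matrix.mat ?N ?N (\<lambda>(i, j). t * \<theta> i ^ j + 1 * ?A i j)) \<noteq> 0" if "t \<in> {0..E}" for t
      using det_collocation_pos[OF \<alpha> nodes, of t 1] that by simp
  qed simp
  then obtain C where C: "0 \<le> C" and bound: "\<And>t v j. t \<in> {0..E} \<Longrightarrow> j < ?N \<Longrightarrow>
      \<bar>v j\<bar> \<le> C * (\<Sum>i<?N. \<bar>\<Sum>k<?N. (t * \<theta> i ^ k + 1 * ?A i k) * v k\<bar>)"
    by blast
  \<comment> \<open>The system for \<open>q * lam n * x n\<close> has the small parameter \<open>1 / (q * lam n)\<close> in front of the
    Vandermonde part, so its inverse is bounded uniformly in \<open>n\<close>.\<close>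
  have xb: "\<bar>q * lam n * x n j\<bar> \<le> C * (\<Sum>i<?N. \<bar>\<phi> n i\<bar>)" if j: "j < ?N" for n j
  proof -
    let ?k = "q * lam n"
    have k: "0 < ?k" using q lamp by simp
    have "1 / ?k \<in> {0..E}"
      using q lam_pos lamp[of n] lam_ge[of n] unfolding E_def by (auto intro!: divide_left_mono mult_left_mono)
    from bound[OF this j, of "\<lambda>j. ?k * x n j"]
    have "\<bar>?k * x n j\<bar> \<le> C * (\<Sum>i<?N. \<bar>\<Sum>k<?N. (1 / ?k * \<theta> i ^ k + 1 * ?A i k) * (?k * x n k)\<bar>)" .
    also have "(\<Sum>i<?N. \<bar>\<Sum>k<?N. (1 / ?k * \<theta> i ^ k + 1 * ?A i k) * (?k * x n k)\<bar>) = (\<Sum>i<?N. \<bar>\<phi> n i\<bar>)"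
    proof (intro sum.cong refl)
      fix i assume "i \<in> {..<?N}"
      then have "\<phi> n i = (\<Sum>k<?N. (1 * \<theta> i ^ k + ?k * ?A i k) * x n k)" using x by simp
      also have "\<dots> = (\<Sum>k<?N. (1 / ?k * \<theta> i ^ k + 1 * ?A i k) * (?k * x n k))"
        using q lamp[of n] by (intro sum.cong refl) (simp add: field_simps)
      finally show "\<bar>\<Sum>k<?N. (1 / ?k * \<theta> i ^ k + 1 * ?A i k) * (?k * x n k)\<bar> = \<bar>\<phi> n i\<bar>" by simp
    qed
    finally show ?thesis .
  qed
  \<comment> \<open>The bound \<open>xb\<close> is a finite sum over the nodes; squaring it costs
    the factor \<open>real ?N\<close>, and each node's data are square-summable by Bessel's
    inequality.\<close>
  have summ: "summable (\<lambda>n. (lam n * x n j)\<^sup>2)" if j: "j < ?N" for j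
  proof (rule summable_comparison_test')
    show "summable (\<lambda>n. (C / q)\<^sup>2 * ((\<Sum>i<?N. (\<phi> n i)\<^sup>2) * real ?N))"
      unfolding \<phi>_def
      by (intro summable_mult summable_mult2 summable_sum bessel_summable[OF basis] F) auto
    fix n
    have "q * \<bar>lam n * x n j\<bar> \<le> C * (\<Sum>i<?N. \<bar>\<phi> n i\<bar>)"
      using xb[OF j, of n] q by (simp add: abs_mult mult.assoc del: sum.lessThan_Suc)
    then have "\<bar>lam n * x n j\<bar> \<le> \<bar>C / q * (\<Sum>i<?N. \<bar>\<phi> n i\<bar>)\<bar>"
      using q by (simp add: field_simps del: sum.lessThan_Suc)
    then have "(lam n * x n j)\<^sup>2 \<le> (C / q * (\<Sum>i<?N. \<bar>\<phi> n i\<bar>))\<^sup>2"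
      by (simp only: abs_le_square_iff)
    also have "\<dots> \<le> (C / q)\<^sup>2 * ((\<Sum>i<?N. (\<phi> n i)\<^sup>2) * real ?N)"
      unfolding power_mult_distrib[of "C / q"]
      using sum_squared_le_sum_of_squares[of "\<lambda>i. \<bar>\<phi> n i\<bar>" "{..<?N}"]
      by (intro mult_left_mono) (simp_all del: sum.lessThan_Suc)
    finally show "norm ((lam n * x n j)\<^sup>2) \<le> (C / q)\<^sup>2 * ((\<Sum>i<?N. (\<phi> n i)\<^sup>2) * real ?N)"
      by simp
  qed
  have "\<forall>j. \<exists>u w. j < ?N \<longrightarrow> elliptic_op \<Omega> a b c u w \<and> (\<forall>n. L2_inner \<Omega> u (\<psi> n) = x n j)"
    using diagonal_synthesis[OF summ] by blast
  then obtain d z where op: "\<And>j. j < ?N \<Longrightarrow> elliptic_op \<Omega> a b c (d j) (z j)"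
    and dx: "\<And>j n. j < ?N \<Longrightarrow> L2_inner \<Omega> (d j) (\<psi> n) = x n j"
    by metis
  have eq: "AE y in lebesgue_on \<Omega>. (\<Sum>j<?N. \<theta> l ^ j * d j y) + q * (\<Sum>j<?N. ?A l j * z j y) = F y (\<theta> l)"
    if l: "l < ?N" for l
  proof -
    have "(\<Sum>j<?N. (1 * \<theta> l ^ j + q * lam n * ?A l j) * L2_inner \<Omega> (d j) (\<psi> n)) = \<phi> n l" for n
    proof -
      have "(\<Sum>j<?N. (1 * \<theta> l ^ j + q * lam n * ?A l j) * L2_inner \<Omega> (d j) (\<psi> n)) =
          (\<Sum>j<?N. (1 * \<theta> l ^ j + q * lam n * ?A l j) * x n j)"
        by (intro sum.cong refl) (simp only: dx lessThan_iff)
      then show ?thesis using x[OF l] by (simp only:)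
    qed
    then show ?thesis
      by (intro collocation_coefficients[where m = m, THEN iffD2]) (auto simp: op F[OF l] \<phi>_def simp del: sum.lessThan_Suc)
  qed
  have "collocation_solution \<Omega> a b c \<alpha> \<tau> m \<theta> F (\<lambda>x t. \<Sum>j<?N. t ^ j * d j x)"
    by (rule collocation_solutionI[where z = z, OF \<alpha>(1) nodes]) (use op eq[unfolded q_def] in blast)+
  then show ?thesis by blast
qed

text \<open>In each eigenmode the difference of the two coefficient vectors solves the homogeneous
  system, so all Fourier coefficients of \<open>d j\<close> and \<open>e j\<close> agree.\<close>

lemma collocation_unique:
  assumes \<alpha>: "0 < \<alpha>" "\<alpha> < 1" and nodes: "collocation_nodes m \<theta>" and \<tau>: "0 < \<tau>"
    and F: "\<And>l. l < Suc m \<Longrightarrow> (\<lambda>x. F x (\<theta> l)) \<in> L2 \<Omega>"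
    and U: "collocation_solution \<Omega> a b c \<alpha> \<tau> m \<theta> F U"
    and V: "collocation_solution \<Omega> a b c \<alpha> \<tau> m \<theta> F V"
  shows "AE x in lebesgue_on \<Omega>. \<forall>t\<in>{0<..1}. V x t = U x t"
proof -
  let ?N = "Suc m"
  let ?A = "\<lambda>l j. frac_coeff \<alpha> j * \<theta> l powr (real j + \<alpha>)"
  obtain d z where dU: "\<And>x t. x \<in> \<Omega> \<Longrightarrow> t \<in> {0<..1} \<Longrightarrow> U x t = (\<Sum>j<?N. t ^ j * d j x)"
    and opd: "\<And>j. j < ?N \<Longrightarrow> elliptic_op \<Omega> a b c (d j) (z j)"
    and eqd: "\<And>l. l < ?N \<Longrightarrow> AE x in lebesgue_on \<Omega>. (\<Sum>j<?N. \<theta> l ^ j * d j x) +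
      \<tau> powr \<alpha> * (\<Sum>j<?N. ?A l j * z j x) = F x (\<theta> l)"
    using collocation_solutionE[OF \<alpha> nodes U] by blast
  obtain e y where eV: "\<And>x t. x \<in> \<Omega> \<Longrightarrow> t \<in> {0<..1} \<Longrightarrow> V x t = (\<Sum>j<?N. t ^ j * e j x)"
    and ope: "\<And>j. j < ?N \<Longrightarrow> elliptic_op \<Omega> a b c (e j) (y j)"
    and eqe: "\<And>l. l < ?N \<Longrightarrow> AE x in lebesgue_on \<Omega>. (\<Sum>j<?N. \<theta> l ^ j * e j x) +
      \<tau> powr \<alpha> * (\<Sum>j<?N. ?A l j * y j x) = F x (\<theta> l)"
    using collocation_solutionE[OF \<alpha> nodes V] by blast
  have coeff_eq: "L2_inner \<Omega> (e j) (\<psi> n) = L2_inner \<Omega> (d j) (\<psi> n)" if j: "j < ?N" for j n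
  proof -
    let ?G = "\<lambda>l j. 1 * \<theta> l ^ j + \<tau> powr \<alpha> * lam n * ?A l j"
    have "0 < \<tau> powr \<alpha> * lam n" using \<tau> lam_pos lam_ge[of n] by simp
    then have det: "det (Matrix.mat ?N ?N (\<lambda>(l, j). ?G l j)) \<noteq> 0"
      using det_collocation_pos[OF \<alpha> nodes, of 1 "\<tau> powr \<alpha> * lam n"] by simp
    have "(\<Sum>j<?N. ?G l j * (L2_inner \<Omega> (e j) (\<psi> n) - L2_inner \<Omega> (d j) (\<psi> n))) = 0" if l: "l < ?N" for l
    proof -
      note coeff_iff = collocation_coefficients[where m = m and F = "\<lambda>x. F x (\<theta> l)" and s = "\<theta> l"
          and q = "\<tau> powr \<alpha>" and A = "?A l"]
      have "(\<Sum>j<?N. ?G l j * L2_inner \<Omega> (e j) (\<psi> n)) = L2_inner \<Omega> (\<lambda>x. F x (\<theta> l)) (\<psi> n)"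
        by (rule coeff_iff[where d = e and z = y, THEN iffD1, THEN spec]) (use ope F[OF l] eqe[OF l] in blast)+
      moreover have "(\<Sum>j<?N. ?G l j * L2_inner \<Omega> (d j) (\<psi> n)) = L2_inner \<Omega> (\<lambda>x. F x (\<theta> l)) (\<psi> n)"
        by (rule coeff_iff[where d = d and z = z, THEN iffD1, THEN spec]) (use opd F[OF l] eqd[OF l] in blast)+
      ultimately show ?thesis unfolding right_diff_distrib sum_subtractf by linarith
    qed
    from linear_system_unique[OF det this j] show ?thesis by simp
  qed
  have "AE x in lebesgue_on \<Omega>. e j x = d j x" if "j < ?N" for j
    by (rule basis_coefficients_eq_imp_AE_eq[OF basis elliptic_op_L2(1)[OF ope[OF that]]
        elliptic_op_L2(1)[OF opd[OF that]] coeff_eq[OF that]])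
  \<comment> \<open>Equality of finitely many coefficients leaves a single null set, outside of
    which the two polynomials agree for all times at once.\<close>
  then have "AE x in lebesgue_on \<Omega>. \<forall>j\<in>{..<?N}. e j x = d j x"
    by (intro AE_finite_allI) auto
  then show ?thesis
    using AE_space
  proof eventually_elim
    case (elim x)
    then have "x \<in> \<Omega>" by simp
    then show ?case using elim(1) dU eV by (auto intro!: sum.cong simp del: sum.lessThan_Suc)
  qed
qed

end

theorem theorem2p6:
  fixes \<alpha> :: real and m :: nat and \<theta> :: "nat \<Rightarrow> real"
  assumes "0 < \<alpha>" and "\<alpha> < 1"
    and "collocation_nodes m \<theta>"
  shows
    "(\<forall>\<mu> < 0. \<not> eigenvalue (collocation_matrix m \<alpha> \<theta>) \<mu>) \<and>
     (\<forall>(\<Omega> :: 'a::euclidean_space set) a b c lam \<psi> F \<tau>.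
        DIM('a) \<in> {1, 2, 3} \<longrightarrow>
        bounded_lipschitz_domain \<Omega> \<longrightarrow>
        admissible_coefficients \<Omega> a b c \<longrightarrow>
        0 < lam 0 \<longrightarrow> incseq lam \<longrightarrow>
        L2_orthonormal_basis \<Omega> \<psi> \<longrightarrow>
        (\<forall>n. elliptic_op \<Omega> a b c (\<psi> n) (\<lambda>x. lam n * \<psi> n x)) \<longrightarrow>
        (\<forall>l \<le> m. (\<lambda>x. F x (\<theta> l)) \<in> L2 \<Omega>) \<longrightarrow>
        0 < \<tau> \<longrightarrow>
        (\<exists>U. collocation_solution \<Omega> a b c \<alpha> \<tau> m \<theta> F U \<and>
          (\<forall>U'. collocation_solution \<Omega> a b c \<alpha> \<tau> m \<theta> F U' \<longrightarrow>
             (AE x in lebesgue_on \<Omega>. \<forall>t \<in> {0<..1}. U' x t = U x t))))"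
proof (intro conjI allI impI)
  show "\<not> eigenvalue (collocation_matrix m \<alpha> \<theta>) \<mu>" if "\<mu> < 0" for \<mu>
    using collocation_matrix_no_neg_eigenvalue assms that by blast
next
  fix \<Omega> :: "'a set" and a b c lam \<psi> F and \<tau> :: real
  assume \<Omega>: "bounded_lipschitz_domain \<Omega>" and coeffs: "admissible_coefficients \<Omega> a b c"
    and lam: "0 < lam 0" "incseq lam" and basis: "L2_orthonormal_basis \<Omega> \<psi>"
    and eigen: "\<forall>n. elliptic_op \<Omega> a b c (\<psi> n) (\<lambda>x. lam n * \<psi> n x)"
    and F: "\<forall>l\<le>m. (\<lambda>x. F x (\<theta> l)) \<in> L2 \<Omega>" and \<tau>: "0 < \<tau>"
  interpret elliptic_eigenbasis \<Omega> a b c lam \<psi>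
    using \<Omega> coeffs lam basis eigen by unfold_locales (auto simp: bounded_lipschitz_domain_def)
  have F': "(\<lambda>x. F x (\<theta> l)) \<in> L2 \<Omega>" if "l < Suc m" for l using F that by simp
  have "\<exists>d. collocation_solution \<Omega> a b c \<alpha> \<tau> m \<theta> F (\<lambda>x t. \<Sum>j<Suc m. t ^ j * d j x)"
    by (rule collocation_exists[OF assms \<tau>]) (rule F')
  then obtain U where U: "collocation_solution \<Omega> a b c \<alpha> \<tau> m \<theta> F U" by blast
  have "AE x in lebesgue_on \<Omega>. \<forall>t\<in>{0<..1}. U' x t = U x t"
    if "collocation_solution \<Omega> a b c \<alpha> \<tau> m \<theta> F U'" for U'
    by (rule collocation_unique[OF assms \<tau> _ U that]) (rule F')
  with U show "\<exists>U. collocation_solution \<Omega> a b c \<alpha> \<tau> m \<theta> F U \<and>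
      (\<forall>U'. collocation_solution \<Omega> a b c \<alpha> \<tau> m \<theta> F U' \<longrightarrow>
        (AE x in lebesgue_on \<Omega>. \<forall>t\<in>{0<..1}. U' x t = U x t))"
    by blast
qed

end
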